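(* If $\beta>-1$, then, as $n\to\infty$, $$\frac{L_n-\dfrac{\phi_\beta(\infty)}{\mu_\beta}\log n}{\sqrt{\Bigl(\dfrac{\phi_\beta(\infty)^2\tau_\beta^2}{\mu_\beta^3}-\dfrac{\phi_\beta(\infty)}{\mu_\beta}\Bigr)\log n}}\xrightarrow{d}\mathcal N(0,1).$$ At $\beta=-1$, as $n\to\infty$, $$\frac{L_n-\dfrac1{2\mu_{-1}}(\log n)^2}{\sqrt{\dfrac{\tau_{-1}^2}{3\mu_{-1}^3}(\log n)^3}}\xrightarrow{d}\mathcal N(0,1),$$ where $\mu_{-1}=\zeta(2)$ and $\tau_{-1}^2=2\zeta(3)$.
   Context: For $\beta>-2$ put $\phi_\beta(z)=\int_0^1(1-s^z)s^{\beta+1}(1-s)^\beta\,ds$, $$\mu_\beta=\phi_\beta'(0)=-\int_0^1\log(s)\,s^{\beta+1}(1-s)^\beta\,ds,\qquad \tau_\beta^2=-\phi_\beta''(0)=\int_0^1(\log s)^2s^{\beta+1}(1-s)^\beta\,ds,$$ and, for $\beta>-1$, $\phi_\beta(\infty)=\lim_{a\to\infty}\phi_\beta(a)=B(\beta+2,\beta+1)$, where $B(a,b)=\Gamma(a)\Gamma(b)/\Gamma(a+b)$. $\zeta$ is the Riemann zeta function. Continuous-time beta-splitting tree on $n$ leaves: a continuous-time Markov chain $\Pi_n$ on partitions of $[n]=\{1,\dots,n\}$ started from the one-block partition, in which different blocks evolve independently, singletons are absorbing, and a block containing $m\ge2$ labels waits an exponential time of rate $\phi_\beta(m-1)$ and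 then splits into an ordered pair of nonempty blocks; the first has size $i$, $1\le i\le m-1$, with probability $q_\beta(m,i)=\frac{1}{2\phi_\beta(m-1)}\binom mi B(i+\beta+1,m-i+\beta+1)$, and, given $i$, the set of labels of the first block is uniform among subsets of size $i$. $L_n$ is the discrete height of a uniformly chosen leaf, i.e. the number of splits of blocks containing a uniformly chosen label of $[n]$ before it becomes a singleton. *)

theory Defs
  imports "HOL-Probability.Probability"
begin

definition phi :: "real \<Rightarrow> real \<Rightarrow> real" where
  "phi \<beta> z = (LBINT s:{0<..<1}. (1 - s powr z) * s powr (\<beta> + 1) * (1 - s) powr \<beta>)"

text \<open>\<open>mu \<beta>\<close> and \<open>tau2 \<beta>\<close> are the integral forms of \<open>\<phi>\<^sub>\<beta>'(0)\<close> and \<open>-\<phi>\<^sub>\<beta>''(0)\<close>;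
  \<open>phi_inf \<beta>\<close> is the value of \<open>lim\<^sub>a \<phi>\<^sub>\<beta>(a)\<close> for \<open>\<beta> > -1\<close>.\<close>

definition mu :: "real \<Rightarrow> real" where
  "mu \<beta> = - (LBINT s:{0<..<1}. ln s * s powr (\<beta> + 1) * (1 - s) powr \<beta>)"

definition tau2 :: "real \<Rightarrow> real" where
  "tau2 \<beta> = (LBINT s:{0<..<1}. (ln s)\<^sup>2 * s powr (\<beta> + 1) * (1 - s) powr \<beta>)"

definition phi_inf :: "real \<Rightarrow> real" where
  "phi_inf \<beta> = Beta (\<beta> + 2) (\<beta> + 1)"

text \<open>The Riemann zeta function on the half-line \<open>s > 1\<close>, where the Dirichlet series converges.\<close>

definition zeta :: "real \<Rightarrow> real" where
  "zeta s = (\<Sum>k. 1 / real (Suc k) powr s)"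

definition split_prob :: "real \<Rightarrow> nat \<Rightarrow> nat \<Rightarrow> real" where
  "split_prob \<beta> m i =
     1 / (2 * phi \<beta> (real m - 1)) * real (m choose i)
       * Beta (real i + \<beta> + 1) (real m - real i + \<beta> + 1)"

text \<open>The size of the first block. For \<open>m \<ge> 2\<close> and \<open>\<beta> > -2\<close> the weights are
  nonnegative and sum to 1 (lemma \<open>pmf_size_law\<close> below), so \<open>embed_pmf\<close> is meaningful.\<close>

definition size_law :: "real \<Rightarrow> nat \<Rightarrow> nat pmf" where
  "size_law \<beta> m = embed_pmf (\<lambda>i. if 1 \<le> i \<and> i \<le> m - 1 then split_prob \<beta> m i else 0)"

definition split_law :: "real \<Rightarrow> nat set \<Rightarrow> nat set pmf" where
  "split_law \<beta> B =
     bind_pmf (size_law \<beta> (card B)) (\<lambda>i. pmf_of_set {A. A \<subseteq> B \<and> card A = i})"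

text \<open>Explicit construction of the chain \<open>\<Pi>\<^sub>n\<close>. Every set \<open>B\<close> of at least two labels receives a
  waiting time \<open>T B\<close> and a first child \<open>S B\<close>, all independent. A set \<open>B\<close> can be a block of the chain
  during one time interval only, so \<open>T B\<close> and \<open>S B\<close> are used at most once: if and when \<open>B\<close>
  becomes a block, it waits for a time \<open>T B\<close> and then splits into \<open>S B\<close> and \<open>B - S B\<close>.
  The last component of the sample space is the uniformly chosen label.\<close>

definition splittable :: "nat \<Rightarrow> nat set set" where
  "splittable n = {B. B \<subseteq> {1..n} \<and> 2 \<le> card B}"

type_synonym sample = "(nat set \<Rightarrow> real) \<times> (nat set \<Rightarrow> nat set) \<times> nat"

definition tree_space :: "real \<Rightarrow> nat \<Rightarrow> sample measure" where
  "tree_space \<beta> n =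
     (\<Pi>\<^sub>M B\<in>splittable n. density lborel (exponential_density (phi \<beta> (real (card B) - 1))))
     \<Otimes>\<^sub>M (\<Pi>\<^sub>M B\<in>splittable n. measure_pmf (split_law \<beta> B))
     \<Otimes>\<^sub>M uniform_count_measure {1..n}"

text \<open>\<open>frag T S B t\<close> is the set of the blocks into which \<open>B\<close> has broken up a time \<open>t\<close> after \<open>B\<close>
  appeared. The condition \<open>S B \<noteq> {} \<and> S B \<subset> B\<close> holds almost surely under \<open>tree_space\<close>
  for every \<open>B\<close> with at least two elements; it makes the recursion terminate for every \<open>S\<close>.\<close>

function frag :: "(nat set \<Rightarrow> real) \<Rightarrow> (nat set \<Rightarrow> nat set) \<Rightarrow> nat set \<Rightarrow> real \<Rightarrow> nat set set" where
  "frag T S B t =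
     (if finite B \<and> 2 \<le> card B \<and> S B \<noteq> {} \<and> S B \<subset> B \<and> T B \<le> t
      then frag T S (S B) (t - T B) \<union> frag T S (B - S B) (t - T B)
      else {B})"
  by auto
termination
  by (relation "Wellfounded.measure (\<lambda>(T, S, B, t). card B)")
     (auto intro!: psubset_card_mono)

declare frag.simps [simp del]

fun Pi_chain :: "nat \<Rightarrow> sample \<Rightarrow> real \<Rightarrow> nat set set" where
  "Pi_chain n (T, S, u) t = frag T S {1..n} t"

fun chosen_label :: "sample \<Rightarrow> nat" where
  "chosen_label (T, S, u) = u"

text \<open>The blocks that split are those present at some time and absent at a later one. Each of them
  splits exactly once, and singletons never do.\<close>

definition leaf_height :: "nat \<Rightarrow> sample \<Rightarrow> nat" where
  "leaf_height n \<omega> =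
     card {B. chosen_label \<omega> \<in> B \<and>
              (\<exists>s t. 0 \<le> s \<and> s < t \<and> B \<in> Pi_chain n \<omega> s \<and> B \<notin> Pi_chain n \<omega> t)}"

lemma frag_partition_on:
  assumes "finite B" "B \<noteq> {}"
  shows "partition_on B (frag T S B t)"
  using assms
proof (induction T S B t rule: frag.induct)
  case (1 T S B t)
  show ?case
  proof (cases "finite B \<and> 2 \<le> card B \<and> S B \<noteq> {} \<and> S B \<subset> B \<and> T B \<le> t")
    case True
    let ?P = "frag T S (S B) (t - T B)" and ?Q = "frag T S (B - S B) (t - T B)"
    have P: "partition_on (S B) ?P"
      using True finite_subset by (intro "1.IH"(1)) auto
    have Q: "partition_on (B - S B) ?Q"
      using True by (intro "1.IH"(2)) auto
    have "disjoint (?P \<union> ?Q)"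
    proof (rule disjoint_union)
      show "\<Union>?P \<inter> \<Union>?Q = {}"
        using partition_onD1[OF P] partition_onD1[OF Q] by blast
    qed (rule partition_onD2[OF P] partition_onD2[OF Q])+
    then have "partition_on (S B \<union> (B - S B)) (?P \<union> ?Q)"
      using partition_onD1[OF P] partition_onD1[OF Q] partition_onD3[OF P] partition_onD3[OF Q]
      unfolding partition_on_def by (metis Un_iff Union_Un_distrib)
    moreover have "S B \<union> (B - S B) = B" using True by auto
    ultimately show ?thesis using True by (subst frag.simps) simp
  next
    case False
    then show ?thesis using 1 by (subst frag.simps) (auto intro: partition_on_space)
  qed
qed

lemma partition_on_Pi_chain: "n \<ge> 1 \<Longrightarrow> partition_on {1..n} (Pi_chain n \<omega> t)"
  by (cases \<omega>) (simp add: frag_partition_on)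

lemma phi_nat:
  assumes "\<beta> > -2" and "m \<ge> 2"
  shows "((\<lambda>s. (1 - s powr (real m - 1)) * s powr (\<beta> + 1) * (1 - s) powr \<beta>)
            has_integral phi \<beta> (real m - 1)) {0<..<1}"
    and "phi \<beta> (real m - 1) > 0"
proof -
  let ?f = "\<lambda>s. (1 - s powr (real m - 1)) * s powr (\<beta> + 1) * (1 - s) powr \<beta>"
  let ?g = "\<lambda>s::real. \<Sum>j<m-1. s powr (real j + \<beta> + 1) * (1 - s) powr (\<beta> + 1)"
  have eq: "?f s = ?g s" if "s \<in> {0<..<1}" for s
  proof -
    have s: "0 < s" "s < 1" using that by auto
    have w: "(1 - s) powr (\<beta> + 1) = (1 - s) powr \<beta> * (1 - s)"
      using s by (simp add: powr_add)
    have "s powr (real m - 1) = s ^ (m - 1)"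
      using s assms(2) by (simp add: powr_realpow[symmetric] of_nat_diff)
    then have "?f s = (\<Sum>j<m-1. s ^ j) * (s powr (\<beta> + 1) * ((1 - s) powr \<beta> * (1 - s)))"
      using one_diff_power_eq[of s "m - 1"] by (simp add: mult_ac)
    also have "\<dots> = (\<Sum>j<m-1. s ^ j) * (s powr (\<beta> + 1) * (1 - s) powr (\<beta> + 1))"
      by (simp only: w)
    also have "\<dots> = ?g s"
      unfolding sum_distrib_right
    proof (intro sum.cong refl)
      fix j
      have "s powr (real j + \<beta> + 1) = s powr real j * s powr (\<beta> + 1)"
        unfolding add.assoc by (rule powr_add)
      then show "s ^ j * (s powr (\<beta> + 1) * (1 - s) powr (\<beta> + 1)) =
          s powr (real j + \<beta> + 1) * (1 - s) powr (\<beta> + 1)"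
        by (simp only: powr_realpow[OF s(1)] mult.assoc)
    qed
    finally show ?thesis .
  qed
  have int: "set_integrable lborel {0<..<1} ?g"
  proof -
    have "set_integrable lborel {0<..<1} (\<lambda>s. s powr (real j + \<beta> + 1) * (1 - s) powr (\<beta> + 1))"
      for j
    proof (rule set_integrable_subset)
      have "real j + \<beta> + 2 - 1 = real j + \<beta> + 1" "\<beta> + 2 - 1 = \<beta> + 1" by auto
      then show "set_integrable lborel {0..1}
          (\<lambda>s. s powr (real j + \<beta> + 1) * (1 - s) powr (\<beta> + 1))"
        using integrable_Beta[of "real j + \<beta> + 2" "\<beta> + 2"] assms(1) by (simp add: add_ac)
    qed auto
    then show ?thesis unfolding set_integrable_def scaleR_sum_right by (rule Bochner_Integration.integrable_sum)
  qed
  have hg: "(?g has_integral (\<Sum>j<m-1. Beta (real j + \<beta> + 2) (\<beta> + 2))) {0<..<1}"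
  proof (intro has_integral_sum finite_lessThan)
    fix j assume "j \<in> {..<m-1}"
    show "((\<lambda>s. s powr (real j + \<beta> + 1) * (1 - s) powr (\<beta> + 1))
            has_integral Beta (real j + \<beta> + 2) (\<beta> + 2)) {0<..<1}"
      using has_integral_Beta_real[of "real j + \<beta> + 2" "\<beta> + 2"] assms(1)
      by (simp add: has_integral_Icc_iff_Ioo algebra_simps)
  qed
  have "phi \<beta> (real m - 1) = (LBINT s:{0<..<1}. ?g s)"
    unfolding phi_def by (intro set_lebesgue_integral_cong) (use eq in auto)
  also have "\<dots> = integral {0<..<1} ?g"
    by (rule set_borel_integral_eq_integral(2)[OF int])
  also have "\<dots> = (\<Sum>j<m-1. Beta (real j + \<beta> + 2) (\<beta> + 2))"
    using hg by (rule integral_unique)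
  finally have phi: "phi \<beta> (real m - 1) = (\<Sum>j<m-1. Beta (real j + \<beta> + 2) (\<beta> + 2))" .
  show "(?f has_integral phi \<beta> (real m - 1)) {0<..<1}"
    unfolding phi using hg eq by (subst has_integral_cong[where g = ?g]) auto
  have "Beta (real j + \<beta> + 2) (\<beta> + 2) > 0" for j
    using assms(1) by (auto simp: Beta_def intro!: mult_pos_pos divide_pos_pos Gamma_real_pos)
  then show "phi \<beta> (real m - 1) > 0"
    unfolding phi using assms(2) by (intro sum_pos) (auto simp: lessThan_empty_iff)
qed

lemma sum_split_prob:
  assumes "\<beta> > -2" and "m \<ge> 2"
  shows "(\<Sum>i=1..m-1. split_prob \<beta> m i) = 1"
proof -
  let ?f = "\<lambda>s. (1 - s powr (real m - 1)) * s powr (\<beta> + 1) * (1 - s) powr \<beta>"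
  let ?g = "\<lambda>s::real. \<Sum>i=1..m-1. real (m choose i) * (s powr (real i + \<beta>) * (1 - s) powr (real m - real i + \<beta>))"
  have f: "(?f has_integral phi \<beta> (real m - 1)) {0..1}"
    using phi_nat(1)[OF assms] by (simp add: has_integral_Icc_iff_Ioo)
  have f': "((\<lambda>s. ?f (1 - s)) has_integral phi \<beta> (real m - 1)) {0..1}"
    using has_integral_affinity[OF f[folded cbox_interval], of "-1" 1] by (simp add: minus_diff_commute)
  have sum: "((\<lambda>s. ?f s + ?f (1 - s)) has_integral 2 * phi \<beta> (real m - 1)) {0<..<1}"
    using has_integral_add[OF f f'] by (simp add: has_integral_Icc_iff_Ioo)
  have eq: "?f s + ?f (1 - s) = ?g s" if "s \<in> {0<..<1}" for s
  proof -
    have s: "0 < s" "s < 1" using that by auto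
    have pw: "x powr (real m - 1) = x ^ (m - 1)" if "x > 0" for x :: real
      using that assms(2) by (simp add: powr_realpow[symmetric] of_nat_diff)
    have pm: "x ^ m = x * x ^ (m - 1)" for x :: real
      using assms(2) by (cases m) auto
    let ?w = "s powr \<beta> * (1 - s) powr \<beta>"
    have "?f s + ?f (1 - s) = (1 - s ^ m - (1 - s) ^ m) * ?w"
      unfolding pm using s by (simp add: pw powr_add) (simp add: algebra_simps)
    also have "1 - s ^ m - (1 - s) ^ m = (\<Sum>i=1..m-1. real (m choose i) * s ^ i * (1 - s) ^ (m - i))"
    proof -
      have "1 = (s + (1 - s)) ^ m" by simp
      also have "\<dots> = (\<Sum>i\<le>m. real (m choose i) * s ^ i * (1 - s) ^ (m - i))"
        by (rule binomial_ring)
      also have "{..m} = insert 0 (insert m {1..m-1})" using assms(2) by auto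
      finally show ?thesis using assms(2) by auto
    qed
    also have "\<dots> * ?w = ?g s"
      unfolding sum_distrib_right
    proof (intro sum.cong refl)
      fix i assume i: "i \<in> {1..m-1}"
      have "real m - real i = real (m - i)"
        using i by (subst of_nat_diff) auto
      then have "(1 - s) powr (real m - real i) = (1 - s) ^ (m - i)"
        using s by (simp add: powr_realpow del: of_nat_diff)
      then show "real (m choose i) * s ^ i * (1 - s) ^ (m - i) * ?w =
          real (m choose i) * (s powr (real i + \<beta>) * (1 - s) powr (real m - real i + \<beta>))"
        using s by (simp add: powr_add powr_realpow mult_ac)
    qed
    finally show ?thesis .
  qed
  have g: "(?g has_integral
      (\<Sum>i=1..m-1. real (m choose i) * Beta (real i + \<beta> + 1) (real m - real i + \<beta> + 1))) {0<..<1}"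
  proof (intro has_integral_sum finite_atLeastAtMost has_integral_mult_right)
    fix i assume i: "i \<in> {1..m-1}"
    have "real i \<ge> 1" "real m - real i \<ge> 1" using i by auto
    then show "((\<lambda>s. s powr (real i + \<beta>) * (1 - s) powr (real m - real i + \<beta>))
        has_integral Beta (real i + \<beta> + 1) (real m - real i + \<beta> + 1)) {0<..<1}"
      using has_integral_Beta_real[of "real i + \<beta> + 1" "real m - real i + \<beta> + 1"] assms(1)
      by (simp add: has_integral_Icc_iff_Ioo)
  qed
  have "(?g has_integral 2 * phi \<beta> (real m - 1)) {0<..<1}"
    using sum eq by (subst has_integral_cong[where g = "\<lambda>s. ?f s + ?f (1 - s)"]) auto
  from has_integral_unique[OF g this] have
    "(\<Sum>i=1..m-1. split_prob \<beta> m i) = 1 / (2 * phi \<beta> (real m - 1)) * (2 * phi \<beta> (real m - 1))"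
    unfolding split_prob_def mult.assoc sum_distrib_left[symmetric] by (simp only:)
  then show ?thesis
    using phi_nat(2)[OF assms] by simp
qed

lemma split_prob_nonneg:
  assumes "\<beta> > -2" "1 \<le> i" "i \<le> m - 1"
  shows "split_prob \<beta> m i \<ge> 0"
proof -
  have m: "m \<ge> 2" using assms by auto
  have "real i \<ge> 1" "real m - real i \<ge> 1" using assms by auto
  then have "Beta (real i + \<beta> + 1) (real m - real i + \<beta> + 1) > 0"
    using assms(1) by (auto simp: Beta_def intro!: mult_pos_pos divide_pos_pos Gamma_real_pos)
  then show ?thesis
    using phi_nat(2)[OF assms(1) m] by (simp add: split_prob_def)
qed

lemma pmf_size_law:
  assumes "\<beta> > -2" and "m \<ge> 2"
  shows "pmf (size_law \<beta> m) i = (if 1 \<le> i \<and> i \<le> m - 1 then split_prob \<beta> m i else 0)"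
proof -
  let ?p = "\<lambda>i. if 1 \<le> i \<and> i \<le> m - 1 then split_prob \<beta> m i else 0"
  have nonneg: "?p i \<ge> 0" for i
    using split_prob_nonneg[OF assms(1)] by auto
  have "(\<integral>\<^sup>+ i. ennreal (?p i) \<partial>count_space UNIV) =
        (\<Sum>i=1..m-1. ennreal (?p i))"
    by (intro nn_integral_count_space') auto
  also have "\<dots> = ennreal (\<Sum>i=1..m-1. ?p i)"
    by (intro sum_ennreal) (rule nonneg)
  also have "(\<Sum>i=1..m-1. ?p i) = 1"
    by (rule trans[OF sum.cong sum_split_prob[OF assms]]) auto
  finally show ?thesis
    unfolding size_law_def by (subst pmf_embed_pmf) (use nonneg in auto)
qed

end

theory Submission
  imports Defs "HOL-Real_Asymp.Real_Asymp"
begin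

text \<open>Follow the block that contains a tagged label. Almost surely every waiting time is positive, and
  then the height of the leaf is the number of splits of this block, which is determined by the
  splits alone (\<open>leaf_height_conv_descent\<close>). For a uniform label the size of the tagged block is a
  Markov chain: from \<open>m\<close> it goes to \<open>j < m\<close> with the size-biased probability \<open>tagged_prob \<beta> m j\<close>, and
  the height is the number of steps from \<open>n\<close> to \<open>1\<close>. Conditioning on the first split turns this into
  a recursion for the characteristic function (\<open>tagged_block_char\<close>, \<open>leaf_height_char\<close>).

  If the chain is run in continuous time with rate \<open>phi \<beta> (m - 1)\<close> in \<open>m\<close>, then \<open>m - 1\<close> is thinned:
  with intensity \<open>s powr (\<beta> + 1) * (1 - s) powr \<beta>\<close> each of the \<open>m - 1\<close> other labels is kept with
  probability \<open>s\<close> (\<open>tagged_rate\<close>). For large \<open>m\<close> a thinning lowers \<open>ln m\<close> by about \<open>- ln s\<close>. Therefore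
  the moments of the one-step decrease of \<open>ln m\<close>, multiplied by \<open>phi \<beta> (m - 1)\<close>, converge to the
  integrals of the powers of \<open>- ln s\<close>, of which the first two are \<open>mu \<beta>\<close> and \<open>tau2 \<beta>\<close>. The error is
  of order \<open>1 / sqrt m\<close> (\<open>step_log_moments\<close>), so \<open>ln m\<close> behaves like a linear function of time plus a
  diffusive fluctuation, and the number of steps is governed by the integral of the rate along it.

  To make this precise, choose functions \<open>h\<close> and \<open>v\<close> of \<open>ln m\<close> such that, to leading order, a step
  lowers \<open>h\<close> by \<open>1\<close> in the mean and lowers \<open>v\<close> in the mean by the mean square of \<open>1\<close> minus the
  decrease of \<open>h\<close>. Then \<open>exp (\<i> * u * h - u\<^sup>2 * v / 2)\<close> solves the recursion for the characteristic
  function up to a small error in each step. The errors add up along the chain, and an error that is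
  small compared with the mean decrease of a power of \<open>ln m\<close> adds up to something small compared with
  that power (\<open>potential_negligible\<close>). This is the criterion \<open>char_fun_asymptotics\<close>.

  For \<open>\<beta> > -1\<close> the rate tends to \<open>phi_inf \<beta>\<close>, and \<open>h\<close> and \<open>v\<close> are multiples of \<open>ln m\<close>; for \<open>\<beta> = -1\<close> the
  rate is a harmonic number, hence close to \<open>ln m\<close>, and \<open>h\<close> and \<open>v\<close> are multiples of the square and
  the cube of \<open>ln m\<close>. In both cases these are exactly the centring and the squared scaling of the
  theorem, and Levy's continuity theorem concludes the proof.\<close>

section \<open>Additive functionals of descending chains\<close>

text \<open>The tangent to \<open>\<lambda>x. x powr r\<close> gives the factor \<open>r\<close> when \<open>r \<le> 1\<close>; for \<open>r \<ge> 1\<close> the chord from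
  the origin gives the factor \<open>1\<close>.\<close>

lemma powr_diff_ge:
  fixes x y r :: real
  assumes "0 < r" "0 \<le> y" "y < x"
  shows "y powr r \<le> x powr r - min 1 r * (x powr (r - 1) * (x - y))"
proof -
  define t where "t = y / x"
  have t: "0 \<le> t" "t < 1" and y: "y = t * x" using assms by (auto simp: t_def field_simps)
  have x: "x > 0" using assms by auto
  have *: "t powr r \<le> 1 - min 1 r * (1 - t)"
  proof (cases "r \<ge> 1")
    case True
    then have "t powr r \<le> t powr 1" using t by (intro powr_mono') auto
    then show ?thesis using True t by simp
  next
    case False
    have "t powr r \<le> r * t + (1 - r) * 1"
      using Youngs_inequality_0[of r "1 - r" t 1] False assms(1) t by (cases "t = 0") auto
    then show ?thesis using False by (simp add: algebra_simps)
  qed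
  have "y powr r = t powr r * x powr r" unfolding y using t x by (simp add: powr_mult)
  also have "\<dots> \<le> (1 - min 1 r * (1 - t)) * x powr r" using * by (intro mult_right_mono) auto
  also have "\<dots> = x powr r - min 1 r * (x powr (r - 1) * (x - y))"
    using x unfolding y by (simp add: powr_diff field_simps)
  finally show ?thesis .
qed

text \<open>The real part of the exponent counts as second order in \<open>u\<close> and the imaginary part as first
  order, so that only the square of the latter is kept. The bound on \<open>u\<^sup>2 * b\<close> keeps the modulus of the
  exponential bounded.\<close>

lemma exp_second_order:
  fixes u a b K :: real
  assumes b: "0 \<le> b" and K: "u\<^sup>2 * b \<le> 2 * K"
  shows "norm (exp (Complex (u\<^sup>2 * b / 2) (u * a)) - 1 - Complex (u\<^sup>2 * b / 2 - u\<^sup>2 * a\<^sup>2 / 2) (u * a))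
          \<le> ((K + 2) * exp K + 1) * (\<bar>u\<bar>^3 * (\<bar>a\<bar>^3 + \<bar>a\<bar> * b) + u^4 * b\<^sup>2)"
proof -
  define x y where "x = u\<^sup>2 * b / 2" and "y = u * a"
  define z where "z = Complex x y"
  have x: "0 \<le> x" "x \<le> K" using assms by (auto simp: x_def)
  have S: "(\<Sum>k\<le>2. z ^ k / fact k) = 1 + z + z\<^sup>2 / 2"
    by (simp add: numeral_2_eq_2)
  have T: "norm (exp z - (1 + z + z\<^sup>2 / 2)) \<le> exp \<bar>Re z\<bar> * norm z ^ 3 / 2"
    using Taylor_exp[of z 2] unfolding S by (simp add: numeral_3_eq_3)
  have z2: "z\<^sup>2 / 2 = Complex (x\<^sup>2 / 2 - y\<^sup>2 / 2) (x * y)"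
    by (simp add: z_def complex_eq_iff power2_eq_square)
  have "exp z - 1 - Complex (x - y\<^sup>2 / 2) y = (exp z - (1 + z + z\<^sup>2 / 2)) + Complex (x\<^sup>2 / 2) (x * y)"
    unfolding z2 by (simp add: z_def complex_eq_iff)
  then have "norm (exp z - 1 - Complex (x - y\<^sup>2 / 2) y) \<le> exp \<bar>Re z\<bar> * norm z ^ 3 / 2 + norm (Complex (x\<^sup>2 / 2) (x * y))"
    using T norm_triangle_ineq[of "exp z - (1 + z + z\<^sup>2 / 2)" "Complex (x\<^sup>2 / 2) (x * y)"] by (simp only:)
  also have "norm (Complex (x\<^sup>2 / 2) (x * y)) \<le> x\<^sup>2 / 2 + x * \<bar>y\<bar>"
    using cmod_le[of "Complex (x\<^sup>2 / 2) (x * y)"] x by (simp add: abs_mult)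
  finally have **: "norm (exp z - 1 - Complex (x - y\<^sup>2 / 2) y)
      \<le> exp \<bar>Re z\<bar> * norm z ^ 3 / 2 + (x\<^sup>2 / 2 + x * \<bar>y\<bar>)"
    by simp
  have "norm z ^ 3 \<le> (x + \<bar>y\<bar>) ^ 3"
    using cmod_le[of z] x by (intro power_mono) (auto simp: z_def)
  \<comment> \<open>convexity of the cube; the difference is an explicit square\<close>
  also have "(x + \<bar>y\<bar>) ^ 3 \<le> 4 * (x ^ 3 + \<bar>y\<bar> ^ 3)"
  proof -
    have "0 \<le> 3 * ((x + \<bar>y\<bar>) * (x - \<bar>y\<bar>)\<^sup>2)" using x by auto
    also have "\<dots> = 4 * (x ^ 3 + \<bar>y\<bar> ^ 3) - (x + \<bar>y\<bar>) ^ 3"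
      by (simp add: power2_eq_square power3_eq_cube algebra_simps)
    finally show ?thesis by simp
  qed
  also have "x ^ 3 \<le> K * x\<^sup>2"
    using mult_right_mono[OF x(2), of "x\<^sup>2"] by (simp add: power3_eq_cube power2_eq_square mult.assoc)
  finally have "norm z ^ 3 \<le> 4 * (K * x\<^sup>2 + \<bar>y\<bar> ^ 3)" by simp
  then have "exp \<bar>Re z\<bar> * norm z ^ 3 \<le> exp K * (4 * (K * x\<^sup>2 + \<bar>y\<bar> ^ 3))"
    using x by (intro mult_mono) (auto simp: z_def)
  with ** have *: "norm (exp z - 1 - Complex (x - y\<^sup>2 / 2) y)
      \<le> exp K * (4 * (K * x\<^sup>2 + \<bar>y\<bar> ^ 3)) / 2 + (x\<^sup>2 / 2 + x * \<bar>y\<bar>)"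
    by linarith
  have eqs: "x\<^sup>2 = u^4 * b\<^sup>2 / 4" "\<bar>y\<bar> ^ 3 = \<bar>u\<bar>^3 * \<bar>a\<bar>^3" "x * \<bar>y\<bar> = \<bar>u\<bar>^3 * (\<bar>a\<bar> * b) / 2"
  proof -
    show "x\<^sup>2 = u^4 * b\<^sup>2 / 4" by (simp add: x_def power_mult_distrib power_divide power_mult[symmetric])
    show "\<bar>y\<bar> ^ 3 = \<bar>u\<bar>^3 * \<bar>a\<bar>^3" by (simp add: y_def abs_mult power_mult_distrib)
    have "u\<^sup>2 * \<bar>u\<bar> = \<bar>u\<bar>^3" by (simp add: power3_eq_cube power2_eq_square abs_mult)
    then show "x * \<bar>y\<bar> = \<bar>u\<bar>^3 * (\<bar>a\<bar> * b) / 2" by (simp add: x_def y_def abs_mult algebra_simps)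
  qed
  define P Q R where "P = \<bar>u\<bar>^3 * \<bar>a\<bar>^3" and "Q = \<bar>u\<bar>^3 * (\<bar>a\<bar> * b)" and "R = u^4 * b\<^sup>2"
  have nn: "0 \<le> P" "0 \<le> Q" "0 \<le> R" "0 \<le> K" using b x by (auto simp: P_def Q_def R_def)
  have Ke: "K \<le> exp K" using exp_ge_add_one_self[of K] by linarith
  have "exp K * (4 * (K * x\<^sup>2 + \<bar>y\<bar> ^ 3)) / 2 + (x\<^sup>2 / 2 + x * \<bar>y\<bar>)
      = exp K * K * R / 2 + 2 * exp K * P + R / 8 + Q / 2"
    unfolding eqs P_def Q_def R_def by (simp add: algebra_simps)
  also have "\<dots> \<le> ((K + 2) * exp K + 1) * (P + Q + R)"
  proof -
    have "0 \<le> exp K * K * R" "0 \<le> K * exp K * P" "0 \<le> K * exp K * Q" "0 \<le> exp K * Q" "0 \<le> exp K * R"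
      using nn by auto
    moreover have "((K + 2) * exp K + 1) * (P + Q + R) - (exp K * K * R / 2 + 2 * exp K * P + R / 8 + Q / 2)
        = exp K * K * R / 2 + K * exp K * P + K * exp K * Q + 2 * (exp K * Q) + 2 * (exp K * R)
          + P + Q / 2 + 7 * R / 8"
      by (simp add: algebra_simps)
    ultimately show ?thesis using nn by linarith
  qed
  finally have "norm (exp z - 1 - Complex (x - y\<^sup>2 / 2) y) \<le> ((K + 2) * exp K + 1) * (P + Q + R)"
    using * by linarith
  moreover have "x - y\<^sup>2 / 2 = u\<^sup>2 * b / 2 - u\<^sup>2 * a\<^sup>2 / 2"
    by (simp add: x_def y_def power_mult_distrib)
  moreover have "P + Q + R = \<bar>u\<bar>^3 * (\<bar>a\<bar>^3 + \<bar>a\<bar> * b) + u^4 * b\<^sup>2"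
    by (simp add: P_def Q_def R_def algebra_simps)
  ultimately show ?thesis unfolding z_def x_def y_def by simp
qed


text \<open>A Markov chain on the positive integers that moves downwards until it is absorbed in \<open>1\<close>. The
  function \<open>l\<close> is the scale on which its distance from \<open>1\<close> is measured.\<close>

locale descending_chain =
  fixes p :: "nat \<Rightarrow> nat \<Rightarrow> real" and l :: "nat \<Rightarrow> real"
  assumes p_nonneg: "\<And>m j. 2 \<le> m \<Longrightarrow> j \<in> {1..<m} \<Longrightarrow> 0 \<le> p m j"
    and p_sum: "\<And>m. 2 \<le> m \<Longrightarrow> (\<Sum>j=1..<m. p m j) = 1"
    and l_1: "l 1 = 0"
    and l_less: "\<And>m j. j \<in> {1..<m} \<Longrightarrow> l j < l m"
    and l_at_top: "filterlim l at_top sequentially"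
begin

definition step_mean :: "nat \<Rightarrow> (nat \<Rightarrow> 'a::real_vector) \<Rightarrow> 'a" where
  "step_mean m f = (\<Sum>j=1..<m. p m j *\<^sub>R f j)"

definition drift :: "nat \<Rightarrow> real" where
  "drift m = step_mean m (\<lambda>j. l m - l j)"

lemma l_nonneg: "1 \<le> m \<Longrightarrow> 0 \<le> l m"
  using l_less[of 1 m] l_1 by (cases "m = 1") auto

lemma l_pos: "2 \<le> m \<Longrightarrow> 0 < l m"
  using l_less[of 1 m] l_1 by auto

lemma step_mean_const: "2 \<le> m \<Longrightarrow> step_mean m (\<lambda>_. c) = c"
  unfolding step_mean_def using p_sum by (simp add: scaleR_left.sum[symmetric] del: One_nat_def)

lemma step_mean_add: "step_mean m (\<lambda>j. f j + g j) = step_mean m f + step_mean m g"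
  unfolding step_mean_def by (simp add: scaleR_add_right sum.distrib)

lemma step_mean_diff: "step_mean m (\<lambda>j. f j - g j) = step_mean m f - step_mean m g"
  unfolding step_mean_def by (simp add: scaleR_diff_right sum_subtractf)

lemma step_mean_mult: "step_mean m (\<lambda>j. c * f j) = c * step_mean m (f :: nat \<Rightarrow> 'a::real_algebra)"
  unfolding step_mean_def by (simp add: sum_distrib_left)

lemma step_mean_of_real:
  "step_mean m (\<lambda>j. of_real (f j) :: 'a::real_algebra_1) = of_real (step_mean m f)"
  unfolding step_mean_def by (simp add: scaleR_conv_of_real)

lemma step_mean_mono:
  fixes f :: "nat \<Rightarrow> real"
  assumes "2 \<le> m" "\<And>j. j \<in> {1..<m} \<Longrightarrow> f j \<le> g j"
  shows "step_mean m f \<le> step_mean m g"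
  unfolding step_mean_def using assms p_nonneg by (auto intro!: sum_mono mult_left_mono)

lemma step_mean_cong:
  "(\<And>j. j \<in> {1..<m} \<Longrightarrow> f j = g j) \<Longrightarrow> step_mean m f = step_mean m g"
  unfolding step_mean_def by (intro sum.cong) auto

lemma norm_step_mean:
  fixes f :: "nat \<Rightarrow> 'a::real_normed_vector"
  assumes "2 \<le> m"
  shows "norm (step_mean m f) \<le> step_mean m (\<lambda>j. norm (f j))"
  unfolding step_mean_def using p_nonneg[OF assms]
  by (intro order.trans[OF norm_sum] sum_mono) auto

lemma step_mean_nonneg:
  fixes f :: "nat \<Rightarrow> real"
  assumes "2 \<le> m" "\<And>j. j \<in> {1..<m} \<Longrightarrow> 0 \<le> f j"
  shows "0 \<le> step_mean m f"
  unfolding step_mean_def using p_nonneg[OF assms(1)] assms(2) by (auto intro!: sum_nonneg)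

lemma drift_pos:
  assumes "2 \<le> m" shows "0 < drift m"
proof -
  have "drift m \<noteq> 0"
  proof
    assume "drift m = 0"
    then have "(\<Sum>j=1..<m. p m j * (l m - l j)) = 0" by (simp add: drift_def step_mean_def)
    then have "\<And>j. j \<in> {1..<m} \<Longrightarrow> p m j * (l m - l j) = 0"
      using p_nonneg[OF assms] l_less
      by (subst (asm) sum_nonneg_eq_0_iff) (auto intro!: mult_nonneg_nonneg simp: less_imp_le)
    then have "\<And>j. j \<in> {1..<m} \<Longrightarrow> p m j = 0" using l_less by fastforce
    then show False using p_sum[OF assms] by simp
  qed
  moreover have "0 \<le> drift m"
    unfolding drift_def using assms l_less by (intro step_mean_nonneg) (auto simp: less_imp_le)
  ultimately show ?thesis by simp
qed

text \<open>The expected sum of \<open>e\<close> over the states that the chain, started in \<open>m\<close>, visits before its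
  absorption.\<close>

function potential :: "(nat \<Rightarrow> real) \<Rightarrow> nat \<Rightarrow> real" where
  "potential e m = (if m < 2 then 0 else e m + (\<Sum>j=1..<m. p m j * potential e j))"
  by auto
termination by (relation "Wellfounded.measure snd") auto

declare potential.simps [simp del]

lemma potential_step:
  "2 \<le> m \<Longrightarrow> potential e m = e m + step_mean m (potential e)"
  by (subst potential.simps) (simp add: step_mean_def)

lemma potential_1: "m < 2 \<Longrightarrow> potential e m = 0"
  by (subst potential.simps) simp

lemma potential_nonneg:
  assumes "\<And>m. 2 \<le> m \<Longrightarrow> 0 \<le> e m"
  shows "0 \<le> potential e m"
proof (induction m rule: less_induct)
  case (less m)
  then show ?case
    using assms[of m] by (cases "m < 2") (auto simp: potential_step potential_1 intro!: add_nonneg_nonneg step_mean_nonneg)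
qed

lemma potential_lincomb:
  "potential (\<lambda>m. a * e m + b * f m) m = a * potential e m + b * potential f m"
proof (induction m rule: less_induct)
  case (less m)
  show ?case
  proof (cases "m < 2")
    case False
    have "step_mean m (potential (\<lambda>m. a * e m + b * f m)) = step_mean m (\<lambda>j. a * potential e j + b * potential f j)"
      by (intro step_mean_cong less) auto
    then show ?thesis
      using False by (simp add: potential_step step_mean_add step_mean_mult algebra_simps)
  qed (simp add: potential_1)
qed

text \<open>This turns a one-step error into a global one: a function that deviates in each step by at
  most \<open>e\<close> from its mean after the step deviates in total by at most the expected sum of \<open>e\<close>.\<close>

lemma potential_dominates:
  fixes x :: "nat \<Rightarrow> complex"
  assumes "x 1 = 0"
    and "\<And>m. 2 \<le> m \<Longrightarrow> m \<le> n \<Longrightarrow> norm (x m) \<le> step_mean m (\<lambda>j. norm (x j)) + e m"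
    and "1 \<le> m" "m \<le> n"
  shows "norm (x m) \<le> potential e m"
  using assms(3,4)
proof (induction m rule: less_induct)
  case (less m)
  show ?case
  proof (cases "m = 1")
    case False
    then have m: "2 \<le> m" using less by auto
    have "norm (x m) \<le> step_mean m (\<lambda>j. norm (x j)) + e m" using assms(2) m less by auto
    also have "\<dots> \<le> step_mean m (potential e) + e m"
      using less by (intro add_right_mono step_mean_mono m) auto
    also have "\<dots> = potential e m" using m by (simp add: potential_step)
    finally show ?thesis .
  qed (use assms(1) in \<open>simp add: potential_1\<close>)
qed

text \<open>Each step lowers \<open>l powr r\<close> in the mean by at least a multiple of \<open>l powr (r - 1)\<close> times the
  drift. Powers of \<open>l\<close> thereby serve as Lyapunov functions for expected sums.\<close>

lemma step_mean_l_powr: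
  assumes "2 \<le> m" "0 < r"
  shows "step_mean m (\<lambda>j. l j powr r) + min 1 r * (l m powr (r - 1) * drift m) \<le> l m powr r"
proof -
  have "step_mean m (\<lambda>j. l j powr r) \<le> step_mean m (\<lambda>j. l m powr r - min 1 r * (l m powr (r - 1) * (l m - l j)))"
    using assms l_less l_nonneg by (intro step_mean_mono powr_diff_ge) auto
  also have "\<dots> = l m powr r - min 1 r * (l m powr (r - 1) * drift m)"
    using assms by (simp add: step_mean_diff[of _ "\<lambda>_. c" for c] step_mean_const step_mean_mult drift_def)
  finally show ?thesis by simp
qed

text \<open>Beyond a finite set of states, \<open>e\<close> is at most a small multiple of the mean decrease of
  \<open>l powr r\<close>. The expected sum of these decreases telescopes, and the exceptional states add only a
  constant, which is negligible because \<open>l\<close> is unbounded.\<close>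

lemma potential_negligible:
  assumes e: "\<And>m. 2 \<le> m \<Longrightarrow> 0 \<le> e m" and r: "0 < r"
    and lim: "(\<lambda>m. e m / (l m powr (r - 1) * drift m)) \<longlonglongrightarrow> 0"
  shows "(\<lambda>m. potential e m / l m powr r) \<longlonglongrightarrow> 0"
proof (rule LIMSEQ_I)
  fix \<epsilon> :: real assume \<epsilon>: "\<epsilon> > 0"
  define k where "k = min 1 r"
  have k: "k > 0" using r by (simp add: k_def)
  have "\<forall>\<^sub>F m in sequentially. e m / (l m powr (r - 1) * drift m) < \<epsilon> / 2 * k"
    using lim \<epsilon> k by (intro order_tendstoD) auto
  then obtain M where M: "\<And>m. m \<ge> M \<Longrightarrow> e m / (l m powr (r - 1) * drift m) < \<epsilon> / 2 * k"
    by (auto simp: eventually_sequentially)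
  \<comment> \<open>accounts for the states in which the ratio is not yet small\<close>
  define C where "C = (\<Sum>j<max M 2. potential e j)"
  have C: "0 \<le> C" unfolding C_def by (intro sum_nonneg potential_nonneg e)
  have bound: "potential e m \<le> \<epsilon> / 2 * l m powr r + C" if "1 \<le> m" for m
    using that
  proof (induction m rule: less_induct)
    case (less m)
    show ?case
    proof (cases "m < max M 2")
      case True
      have "potential e m \<le> C"
        unfolding C_def using True by (intro member_le_sum potential_nonneg e) auto
      then show ?thesis using \<epsilon> by (auto intro: add_increasing)
    next
      case False
      then have m: "2 \<le> m" "M \<le> m" by auto
      have "e m \<le> \<epsilon> / 2 * k * (l m powr (r - 1) * drift m)"
        using M[OF m(2)] drift_pos[OF m(1)] l_pos[OF m(1)] by (simp add: field_simps)
      then have "potential e m \<le> \<epsilon> / 2 * k * (l m powr (r - 1) * drift m) + step_mean m (potential e)"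
        using potential_step[OF m(1)] by simp
      also have "step_mean m (potential e) \<le> step_mean m (\<lambda>j. \<epsilon> / 2 * l j powr r + C)"
        using less by (intro step_mean_mono m) auto
      also have "\<dots> = \<epsilon> / 2 * step_mean m (\<lambda>j. l j powr r) + C"
        using m by (simp only: step_mean_add step_mean_const step_mean_mult)
      finally have "potential e m \<le> \<epsilon> / 2 * (step_mean m (\<lambda>j. l j powr r) + k * (l m powr (r - 1) * drift m)) + C"
        by (simp add: algebra_simps)
      also have "\<dots> \<le> \<epsilon> / 2 * l m powr r + C"
        using step_mean_l_powr[OF m(1) r] \<epsilon> unfolding k_def by (intro add_right_mono mult_left_mono) auto
      finally show ?thesis .
    qed
  qed
  have "filterlim (\<lambda>m. l m powr r) at_top sequentially"
    by (rule filterlim_compose[OF _ l_at_top]) (use r in real_asymp)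
  then have "(\<lambda>m. C / l m powr r) \<longlonglongrightarrow> 0"
    by (intro real_tendsto_divide_at_top[OF tendsto_const])
  then have "\<forall>\<^sub>F m in sequentially. C / l m powr r < \<epsilon> / 2"
    using \<epsilon> by (intro order_tendstoD) auto
  then have "\<forall>\<^sub>F m in sequentially. norm (potential e m / l m powr r - 0) < \<epsilon>"
    using eventually_ge_at_top[of 2]
  proof eventually_elim
    case (elim m)
    have "0 < l m powr r" using l_pos[OF elim(2)] by simp
    then have "potential e m / l m powr r \<le> \<epsilon> / 2 + C / l m powr r"
      using bound[of m] elim by (simp add: field_simps)
    moreover have "0 \<le> potential e m / l m powr r" using potential_nonneg[OF e] by simp
    ultimately show ?case using elim(1) unfolding real_norm_def diff_0_right by linarith
  qed
  then show "\<exists>N. \<forall>m\<ge>N. norm (potential e m / l m powr r - 0) < \<epsilon>"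
    by (auto simp: eventually_sequentially)
qed

text \<open>After division by \<open>g m\<close> each summand is the exponential of a number whose first and second
  order parts have small mean; the four terms are the orders \<open>u\<close> to \<open>u^4\<close> of the error.\<close>

lemma one_step_error:
  fixes h v :: "nat \<Rightarrow> real" and u K :: real
  defines "g \<equiv> \<lambda>m. exp (Complex (- (u\<^sup>2 * v m) / 2) (u * h m))"
  assumes m: "2 \<le> m" and v: "\<And>j. j \<in> {1..<m} \<Longrightarrow> v j \<le> v m" "0 \<le> v m" "u\<^sup>2 * v m \<le> 2 * K"
    and v0: "\<And>j. j \<in> {1..<m} \<Longrightarrow> 0 \<le> v j"
  shows "norm (iexp u * step_mean m g - g m)
     \<le> \<bar>u\<bar> * \<bar>step_mean m (\<lambda>j. 1 - (h m - h j))\<bar>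
       + u\<^sup>2 * \<bar>step_mean m (\<lambda>j. (1 - (h m - h j))\<^sup>2 - (v m - v j))\<bar>
       + ((K + 2) * exp K + 1) *
          (\<bar>u\<bar>^3 * step_mean m (\<lambda>j. \<bar>1 - (h m - h j)\<bar>^3 + \<bar>1 - (h m - h j)\<bar> * (v m - v j))
           + u^4 * step_mean m (\<lambda>j. (v m - v j)\<^sup>2))"
proof -
  define a b where "a = (\<lambda>j. 1 - (h m - h j))" and "b = (\<lambda>j. v m - v j)"
  define C where "C = (K + 2) * exp K + 1"
  define z where "z = (\<lambda>j. Complex (u\<^sup>2 * b j / 2) (u * a j))"
  define q where "q = (\<lambda>j. Complex (u\<^sup>2 * b j / 2 - u\<^sup>2 * (a j)\<^sup>2 / 2) (u * a j))"
  have gz: "iexp u * g j = g m * exp (z j)" for j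
    unfolding g_def z_def exp_add[symmetric]
    by (intro arg_cong[where f = exp]) (simp add: complex_eq_iff a_def b_def algebra_simps add_divide_distrib diff_divide_distrib)
  have "iexp u * step_mean m g - g m = g m * (step_mean m (\<lambda>j. exp (z j)) - 1)"
    by (simp only: step_mean_mult[symmetric] gz) (simp add: step_mean_mult algebra_simps)
  also have "step_mean m (\<lambda>j. exp (z j)) - 1 = step_mean m (\<lambda>j. (exp (z j) - 1 - q j) + q j)"
    by (simp add: step_mean_diff step_mean_const m)
  also have "\<dots> = step_mean m (\<lambda>j. exp (z j) - 1 - q j) + step_mean m q"
    by (rule step_mean_add)
  finally have "norm (iexp u * step_mean m g - g m)
      = norm (g m) * norm (step_mean m (\<lambda>j. exp (z j) - 1 - q j) + step_mean m q)"
    by (simp add: norm_mult)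
  also have "\<dots> \<le> 1 * norm (step_mean m (\<lambda>j. exp (z j) - 1 - q j) + step_mean m q)"
    using v(2) by (intro mult_right_mono) (auto simp: g_def)
  also have "\<dots> \<le> norm (step_mean m (\<lambda>j. exp (z j) - 1 - q j)) + norm (step_mean m q)"
    by (simp add: norm_triangle_ineq)
  also have "norm (step_mean m (\<lambda>j. exp (z j) - 1 - q j))
      \<le> step_mean m (\<lambda>j. C * (\<bar>u\<bar>^3 * (\<bar>a j\<bar>^3 + \<bar>a j\<bar> * b j) + u^4 * (b j)\<^sup>2))"
  proof (intro order.trans[OF norm_step_mean[OF m]] step_mean_mono m)
    fix j assume j: "j \<in> {1..<m}"
    have "u\<^sup>2 * b j \<le> u\<^sup>2 * v m" using v0[OF j] by (intro mult_left_mono) (auto simp: b_def)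
    then show "norm (exp (z j) - 1 - q j) \<le> C * (\<bar>u\<bar>^3 * (\<bar>a j\<bar>^3 + \<bar>a j\<bar> * b j) + u^4 * (b j)\<^sup>2)"
      unfolding z_def q_def C_def using v(1)[OF j] v(3) by (intro exp_second_order) (auto simp: b_def)
  qed
  also have "\<dots> = C * (\<bar>u\<bar>^3 * step_mean m (\<lambda>j. \<bar>a j\<bar>^3 + \<bar>a j\<bar> * b j) + u^4 * step_mean m (\<lambda>j. (b j)\<^sup>2))"
    by (simp only: step_mean_add step_mean_mult)
  also have "norm (step_mean m q) \<le> \<bar>u\<bar> * \<bar>step_mean m a\<bar> + u\<^sup>2 * \<bar>step_mean m (\<lambda>j. (a j)\<^sup>2 - b j)\<bar>"
  proof -
    have "step_mean m q = step_mean m (\<lambda>j. \<i> * of_real u * of_real (a j)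
        + (- of_real (u\<^sup>2 / 2)) * of_real ((a j)\<^sup>2 - b j))"
      by (intro step_mean_cong) (simp add: q_def complex_eq_iff power2_eq_square field_simps)
    also have "\<dots> = Complex (- (u\<^sup>2 / 2) * step_mean m (\<lambda>j. (a j)\<^sup>2 - b j)) (u * step_mean m a)"
      unfolding step_mean_add step_mean_mult step_mean_of_real by (simp add: complex_eq_iff)
    also have "norm \<dots> \<le> \<bar>- (u\<^sup>2 / 2) * step_mean m (\<lambda>j. (a j)\<^sup>2 - b j)\<bar> + \<bar>u * step_mean m a\<bar>"
      by (rule order.trans[OF cmod_le]) simp
    also have "\<dots> \<le> \<bar>u\<bar> * \<bar>step_mean m a\<bar> + u\<^sup>2 * \<bar>step_mean m (\<lambda>j. (a j)\<^sup>2 - b j)\<bar>"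
      by (simp add: abs_mult)
    finally show ?thesis .
  qed
  finally show ?thesis unfolding a_def b_def C_def by simp
qed

text \<open>A central limit theorem for the number of steps of the chain, in terms of its characteristic
  function \<open>F u\<close>. Here \<open>h\<close> is an approximate mean and \<open>v\<close> an approximate variance. The relevant
  \<open>u\<close> is of order \<open>l powr (- c / 2)\<close>, so the error of order \<open>u^k\<close> may add up to anything negligible
  against \<open>l powr (k * c / 2)\<close>; by \<open>potential_negligible\<close> this is what the \<open>k\<close>-th of the four limits
  guarantees.\<close>

theorem char_fun_asymptotics:
  fixes h :: "nat \<Rightarrow> real" and \<sigma> t :: real and c :: nat and F :: "real \<Rightarrow> nat \<Rightarrow> complex"
  defines "v \<equiv> \<lambda>m. \<sigma> * l m ^ c"
  defines "e1 \<equiv> \<lambda>m. \<bar>step_mean m (\<lambda>j. 1 - (h m - h j))\<bar>"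
    and "e2 \<equiv> \<lambda>m. \<bar>step_mean m (\<lambda>j. (1 - (h m - h j))\<^sup>2 - (v m - v j))\<bar>"
    and "e3 \<equiv> \<lambda>m. step_mean m (\<lambda>j. \<bar>1 - (h m - h j)\<bar>^3 + \<bar>1 - (h m - h j)\<bar> * (v m - v j))"
    and "e4 \<equiv> \<lambda>m. step_mean m (\<lambda>j. (v m - v j)\<^sup>2)"
  assumes F1: "\<And>u. F u 1 = 1"
    and F: "\<And>u m. 2 \<le> m \<Longrightarrow> F u m = iexp u * step_mean m (F u)"
    and h1: "h 1 = 0" and \<sigma>: "0 < \<sigma>" and c: "1 \<le> c"
    and lim1: "(\<lambda>m. e1 m / (l m powr (c / 2 - 1) * drift m)) \<longlonglongrightarrow> 0"
    and lim2: "(\<lambda>m. e2 m / (l m powr (real c - 1) * drift m)) \<longlonglongrightarrow> 0"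
    and lim3: "(\<lambda>m. e3 m / (l m powr (3 * c / 2 - 1) * drift m)) \<longlonglongrightarrow> 0"
    and lim4: "(\<lambda>m. e4 m / (l m powr (2 * real c - 1) * drift m)) \<longlonglongrightarrow> 0"
  shows "(\<lambda>n. F (t / sqrt (v n)) n * iexp (- (t / sqrt (v n) * h n))) \<longlonglongrightarrow> of_real (exp (- t\<^sup>2 / 2))"
proof -
  define K where "K = t\<^sup>2 / 2"
  define C where "C = (K + 2) * exp K + 1"
  define u where "u = (\<lambda>n. t / sqrt (v n))"
  define g where "g = (\<lambda>u m. exp (Complex (- (u\<^sup>2 * v m) / 2) (u * h m)))"
  have C: "0 \<le> C" by (simp add: C_def K_def)
  have v_mono: "v j \<le> v m" if "1 \<le> j" "j \<le> m" for j m
    using that l_nonneg[of j] l_less[of j m] \<sigma> unfolding v_def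
    by (cases "j = m") (auto intro!: mult_left_mono power_mono simp: less_imp_le)
  have v_nonneg: "0 \<le> v m" if "1 \<le> m" for m
    using l_nonneg[OF that] \<sigma> by (simp add: v_def)
  have v_pos: "0 < v m" if "2 \<le> m" for m
    using l_pos[OF that] \<sigma> by (simp add: v_def)
  have e_nonneg: "0 \<le> e1 m" "0 \<le> e2 m" "0 \<le> e3 m" "0 \<le> e4 m" if "2 \<le> m" for m
    unfolding e1_def e2_def e3_def e4_def using that
    by (auto intro!: step_mean_nonneg add_nonneg_nonneg mult_nonneg_nonneg simp: v_mono)
  \<comment> \<open>the accumulated error of all steps, for the value of u that belongs to n\<close>
  define B where "B = (\<lambda>n. \<bar>u n\<bar> * potential e1 n + (u n)\<^sup>2 * potential e2 n
      + C * (\<bar>u n\<bar>^3 * potential e3 n + (u n)^4 * potential e4 n))"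
  have bound: "norm (F (u n) n - g (u n) n) \<le> B n" if n: "2 \<le> n" for n
  proof -
    define e where "e = (\<lambda>m. 1 * (\<bar>u n\<bar> * e1 m + (u n)\<^sup>2 * e2 m) + C * (\<bar>u n\<bar>^3 * e3 m + (u n)^4 * e4 m))"
    have un: "(u n)\<^sup>2 * v n = 2 * K"
      using v_pos[OF n] by (simp add: u_def K_def power_divide)
    have "norm (F (u n) n - g (u n) n) \<le> potential e n"
    proof (rule potential_dominates[where n = n and x = "\<lambda>m. F (u n) m - g (u n) m"])
      show "F (u n) 1 - g (u n) 1 = 0"
        using c l_1 by (simp add: F1[simplified] g_def h1[simplified] v_def zero_power zero_complex.code[symmetric])
    next
      fix m assume m: "2 \<le> m" "m \<le> n"
      have "(u n)\<^sup>2 * v m \<le> 2 * K"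
        unfolding un[symmetric] using m v_mono[of m n] by (intro mult_left_mono) auto
      then have *: "norm (iexp (u n) * step_mean m (g (u n)) - g (u n) m) \<le> e m"
        unfolding g_def e_def C_def e1_def e2_def e3_def e4_def mult_1
        using m v_mono v_nonneg by (intro one_step_error) auto
      have "F (u n) m - g (u n) m = iexp (u n) * step_mean m (\<lambda>j. F (u n) j - g (u n) j)
          + (iexp (u n) * step_mean m (g (u n)) - g (u n) m)"
        using m by (simp add: F step_mean_diff algebra_simps)
      then have "norm (F (u n) m - g (u n) m) \<le> norm (iexp (u n) * step_mean m (\<lambda>j. F (u n) j - g (u n) j)) + e m"
        using * by (simp only:) (rule norm_triangle_le, simp)
      also have "norm (iexp (u n) * step_mean m (\<lambda>j. F (u n) j - g (u n) j))
          \<le> step_mean m (\<lambda>j. norm (F (u n) j - g (u n) j))"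
        using norm_step_mean[OF m(1)] by (simp add: norm_mult)
      finally show "norm (F (u n) m - g (u n) m) \<le> step_mean m (\<lambda>j. norm (F (u n) j - g (u n) j)) + e m"
        by simp
    qed (use n in auto)
    also have "potential e n = B n"
      unfolding e_def potential_lincomb B_def by simp
    finally show ?thesis .
  qed
  have lim_pot: "(\<lambda>n. \<bar>u n\<bar> ^ k * potential e n) \<longlonglongrightarrow> 0"
    if e: "\<And>m. 2 \<le> m \<Longrightarrow> 0 \<le> e m" and k: "1 \<le> k"
      and lim: "(\<lambda>m. e m / (l m powr (k * c / 2 - 1) * drift m)) \<longlonglongrightarrow> 0" for k :: nat and e
  proof -
    have "(\<lambda>m. potential e m / l m powr (k * c / 2)) \<longlonglongrightarrow> 0"
      using e k c lim by (intro potential_negligible) auto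
    then have "(\<lambda>m. (\<bar>t\<bar> / sqrt \<sigma>) ^ k * (potential e m / l m powr (k * c / 2))) \<longlonglongrightarrow> 0"
      by (rule tendsto_mult_right_zero)
    moreover have "\<forall>\<^sub>F n in sequentially. (\<bar>t\<bar> / sqrt \<sigma>) ^ k * (potential e n / l n powr (k * c / 2))
        = \<bar>u n\<bar> ^ k * potential e n"
      using eventually_ge_at_top[of 2]
    proof eventually_elim
      case (elim n)
      have l: "0 < l n" using l_pos[OF elim] .
      have "sqrt (l n ^ c) ^ k = l n powr (k * c / 2)"
        using l by (simp add: powr_realpow[symmetric] powr_half_sqrt[symmetric] powr_powr mult.commute)
      then show ?case using l \<sigma>
        by (simp add: u_def v_def abs_divide real_sqrt_mult power_divide power_mult_distrib)
    qed
    ultimately show ?thesis by (rule Lim_transform_eventually)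
  qed
  have "(\<lambda>n. \<bar>u n\<bar> ^ 1 * potential e1 n) \<longlonglongrightarrow> 0"
    by (rule lim_pot) (use e_nonneg lim1 in simp_all)
  moreover have "(\<lambda>n. \<bar>u n\<bar> ^ 2 * potential e2 n) \<longlonglongrightarrow> 0"
    by (rule lim_pot) (use e_nonneg lim2 in simp_all)
  moreover have "(\<lambda>n. \<bar>u n\<bar> ^ 3 * potential e3 n) \<longlonglongrightarrow> 0"
    by (rule lim_pot) (use e_nonneg lim3 in simp_all)
  moreover have "(\<lambda>n. \<bar>u n\<bar> ^ 4 * potential e4 n) \<longlonglongrightarrow> 0"
    by (rule lim_pot) (use e_nonneg lim4 in simp_all)
  ultimately have "(\<lambda>n. \<bar>u n\<bar> ^ 1 * potential e1 n + \<bar>u n\<bar> ^ 2 * potential e2 n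
      + C * (\<bar>u n\<bar> ^ 3 * potential e3 n + \<bar>u n\<bar> ^ 4 * potential e4 n)) \<longlonglongrightarrow> 0 + 0 + C * (0 + 0)"
    by (intro tendsto_intros)
  then have "B \<longlonglongrightarrow> 0"
    unfolding B_def by simp
  then have "(\<lambda>n. F (u n) n - g (u n) n) \<longlonglongrightarrow> 0"
    by (rule Lim_null_comparison[rotated]) (use bound in \<open>auto simp: eventually_sequentially\<close>)
  then have "(\<lambda>n. (F (u n) n - g (u n) n) * iexp (- (u n * h n))) \<longlonglongrightarrow> 0"
    by (rule Lim_null_comparison[rotated, OF tendsto_norm_zero]) (simp add: norm_mult)
  then have "(\<lambda>n. (F (u n) n - g (u n) n) * iexp (- (u n * h n)) + of_real (exp (- t\<^sup>2 / 2))) \<longlonglongrightarrow> 0 + of_real (exp (- t\<^sup>2 / 2))"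
    by (intro tendsto_intros)
  moreover have "\<forall>\<^sub>F n in sequentially. (F (u n) n - g (u n) n) * iexp (- (u n * h n)) + of_real (exp (- t\<^sup>2 / 2))
      = F (u n) n * iexp (- (u n * h n))"
    using eventually_ge_at_top[of 2]
  proof eventually_elim
    case (elim n)
    have "g (u n) n * iexp (- (u n * h n)) = of_real (exp (- t\<^sup>2 / 2))"
      unfolding g_def exp_add[symmetric] exp_of_real[symmetric] using v_pos[OF elim]
      by (intro arg_cong[where f = exp]) (simp add: complex_eq_iff u_def power_divide)
    then show ?case by (simp add: algebra_simps)
  qed
  ultimately show ?thesis
    unfolding u_def by (simp add: tendsto_cong)
qed

end

section \<open>Logarithmic moments of binomial thinning\<close>

lemma Beta_set_integral:
  fixes a b :: real
  assumes "0 < a" "0 < b"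
  shows "set_integrable lborel {0<..<1} (\<lambda>t. t powr (a - 1) * (1 - t) powr (b - 1))"
    and "(LBINT t:{0<..<1}. t powr (a - 1) * (1 - t) powr (b - 1)) = Beta a b"
proof -
  show *: "set_integrable lborel {0<..<1} (\<lambda>t. t powr (a - 1) * (1 - t) powr (b - 1))"
    by (rule set_integrable_subset[OF integrable_Beta[OF assms]]) auto
  have "((\<lambda>t. t powr (a - 1) * (1 - t) powr (b - 1)) has_integral Beta a b) {0<..<1}"
    using has_integral_Beta_real[OF assms] by (simp add: has_integral_Icc_iff_Ioo)
  then show "(LBINT t:{0<..<1}. t powr (a - 1) * (1 - t) powr (b - 1)) = Beta a b"
    using set_borel_integral_eq_integral(2)[OF *] by (simp add: integral_unique)
qed

text \<open>The singularity of the logarithm at \<open>0\<close> costs an arbitrarily small power of \<open>s\<close>, while its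
  zero at \<open>1\<close> gains a full factor \<open>1 - s\<close>.\<close>

lemma minus_ln_le:
  fixes s e :: real
  assumes "0 < s" "s < 1" "0 < e" "e \<le> 1"
  shows "- ln s \<le> (1 - s) * s powr (- e) / e"
proof -
  have "ln (s powr (-e)) \<le> s powr (-e) - 1"
    using assms by (intro ln_le_minus_one) auto
  then have "e * (- ln s) \<le> s powr (-e) - 1" using assms by (simp add: ln_powr)
  also have "\<dots> = (1 - s powr e) * s powr (-e)"
    using assms by (simp add: algebra_simps powr_add[symmetric])
  also have "\<dots> \<le> (1 - s) * s powr (- e)"
    using assms powr_mono'[of e 1 s] by (intro mult_right_mono) auto
  finally show ?thesis using assms by (simp add: field_simps)
qed

text \<open>The zero of the logarithm at \<open>1\<close> is what admits exponents \<open>b\<close> down to \<open>-2\<close>.\<close>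

lemma ln_power_integrable:
  fixes a b :: real
  assumes a: "-1 < a" and b: "-1 < b \<or> 1 \<le> j \<and> -2 < b"
  shows "set_integrable lborel {0<..<1} (\<lambda>s. (- ln s) ^ j * (s powr a * (1 - s) powr b))"
proof -
  \<comment> \<open>so small that the j factors s powr (- e) do not destroy integrability at 0\<close>
  define e where "e = min 1 ((a + 1) / (2 * (real j + 1)))"
  define i where "i = (if 1 \<le> j then 1 else 0 :: nat)"
  have e: "0 < e" "e \<le> 1" using a by (auto simp: e_def)
  have je: "real j * e < a + 1"
  proof -
    have "real j * e \<le> real j * ((a + 1) / (2 * (real j + 1)))"
      by (intro mult_left_mono) (auto simp: e_def)
    also have "\<dots> = (a + 1) * (real j / (2 * (real j + 1)))" by simp
    also have "\<dots> < (a + 1) * 1" using a by (intro mult_strict_left_mono) (auto simp: field_simps)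
    also have "\<dots> = a + 1" by simp
    finally show ?thesis .
  qed
  have "set_integrable lborel {0<..<1} (\<lambda>s. s powr ((a - real j * e + 1) - 1) * (1 - s) powr ((b + real i + 1) - 1))"
    using je a b by (intro Beta_set_integral) (auto simp: i_def)
  then have "set_integrable lborel {0<..<1} (\<lambda>s. (1 / e) ^ j * (s powr ((a - real j * e + 1) - 1) * (1 - s) powr ((b + real i + 1) - 1)))"
    by (intro set_integrable_mult_right) auto
  then show ?thesis
  proof (rule set_integrable_bound)
    show "AE s in lborel. s \<in> {0<..<1} \<longrightarrow> norm ((- ln s) ^ j * (s powr a * (1 - s) powr b))
       \<le> norm ((1 / e) ^ j * (s powr ((a - real j * e + 1) - 1) * (1 - s) powr ((b + real i + 1) - 1)))"
    proof (intro AE_I2 impI)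
      fix s :: real assume "s \<in> {0<..<1}"
      then have s: "0 < s" "s < 1" by auto
      have "(- ln s) ^ j \<le> ((1 - s) * s powr (- e) / e) ^ j"
        using minus_ln_le[OF s e] s by (intro power_mono) (auto simp: ln_le_zero_iff less_imp_le)
      also have "\<dots> = (1 - s) ^ j * (1 / e) ^ j * s powr (- (real j * e))"
        using s by (simp add: power_mult_distrib power_divide powr_realpow[symmetric] powr_powr mult.commute)
      also have "\<dots> \<le> (1 - s) powr real i * (1 / e) ^ j * s powr (- (real j * e))"
      proof (intro mult_right_mono)
        show "(1 - s) ^ j \<le> (1 - s) powr real i"
          using s power_decreasing[of 1 j "1 - s"] by (cases "j = 0") (auto simp: i_def)
      qed (use e in auto)
      finally have "(- ln s) ^ j * (s powr a * (1 - s) powr b)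
          \<le> ((1 - s) powr real i * (1 / e) ^ j * s powr (- (real j * e))) * (s powr a * (1 - s) powr b)"
        by (intro mult_right_mono) auto
      also have "\<dots> = (1 / e) ^ j * (s powr ((a - real j * e + 1) - 1) * (1 - s) powr ((b + real i + 1) - 1))"
        using s by (simp add: powr_add powr_diff powr_minus field_simps)
      finally show "norm ((- ln s) ^ j * (s powr a * (1 - s) powr b))
       \<le> norm ((1 / e) ^ j * (s powr ((a - real j * e + 1) - 1) * (1 - s) powr ((b + real i + 1) - 1)))"
        using s e by (simp add: abs_mult power_abs)
    qed
  qed (auto simp: set_borel_measurable_def)
qed

text \<open>Under the substitution \<open>x = - ln s\<close> the measure with this density becomes the Levy measure of
  the subordinator whose Laplace exponent is \<open>phi \<beta>\<close>.\<close>

definition levy_density :: "real \<Rightarrow> real \<Rightarrow> real" where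
  "levy_density \<beta> s = s powr (\<beta> + 1) * (1 - s) powr \<beta>"

definition log_moment :: "real \<Rightarrow> nat \<Rightarrow> real" where
  "log_moment \<beta> k = (LBINT s:{0<..<1}. (- ln s) ^ k * levy_density \<beta> s)"

lemma mu_conv_log_moment: "mu \<beta> = log_moment \<beta> 1"
  unfolding mu_def log_moment_def levy_density_def set_lebesgue_integral_def
  by (subst Bochner_Integration.integral_minus[symmetric], intro Bochner_Integration.integral_cong) auto

lemma tau2_conv_log_moment: "tau2 \<beta> = log_moment \<beta> 2"
  unfolding tau2_def log_moment_def levy_density_def by (simp add: mult.assoc)

text \<open>This is twice the hyperbolic sine of \<open>\<bar>ln x\<bar> / 2\<close>. It dominates every positive power of
  \<open>\<bar>ln x\<bar>\<close>, and its square is a linear combination of \<open>x\<close> and \<open>1 / x\<close>, whose means under a shifted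
  binomial law are explicit. It thus controls all moments of the logarithm of a binomial variable
  at once.\<close>

definition sinh_gap :: "real \<Rightarrow> real" where
  "sinh_gap x = \<bar>sqrt x - 1 / sqrt x\<bar>"

lemma sinh_gap_squared: "0 < x \<Longrightarrow> (sinh_gap x)\<^sup>2 = x - 2 + 1 / x"
  by (simp add: sinh_gap_def power2_diff power_divide)

lemma sinh_gap_exp: "0 < x \<Longrightarrow> sinh_gap x = exp (\<bar>ln x\<bar> / 2) - exp (- (\<bar>ln x\<bar> / 2))"
proof -
  assume x: "0 < x"
  have "sqrt x = exp (ln x / 2)" using x by (simp add: powr_half_sqrt[symmetric] powr_def)
  then have *: "sinh_gap x = \<bar>exp (ln x / 2) - exp (- (ln x / 2))\<bar>"
    by (simp add: sinh_gap_def exp_minus inverse_eq_divide)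
  show ?thesis
  proof (cases "0 \<le> ln x")
    case True then show ?thesis unfolding * by simp
  next
    case False then show ?thesis unfolding * by simp
  qed
qed

lemma abs_ln_power_le_sinh_gap:
  assumes x: "0 < x" and k: "1 \<le> k"
  shows "\<bar>ln x\<bar> ^ k \<le> 2 ^ (k + 1) * fact k * sinh_gap x"
proof -
  define y where "y = \<bar>ln x\<bar>"
  have y: "0 \<le> y" by (simp add: y_def)
  have sk: "sinh_gap x = exp (y / 2) - exp (- (y / 2))" using sinh_gap_exp[OF x] by (simp add: y_def)
  show ?thesis
  proof (cases "y \<le> 1")
    case True
    have "y ^ k \<le> y" using power_decreasing[of 1 k y] True y k by simp
    also have "\<dots> \<le> 2 * sinh_gap x"
    proof -
      have "1 + y / 2 \<le> exp (y / 2)" by (rule exp_ge_add_one_self)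
      moreover have "exp (- (y / 2)) \<le> 1" using y by simp
      moreover have "2 * (exp (y / 2) - exp (- (y / 2))) = 2 * exp (y / 2) - 2 * exp (- (y / 2))" by simp
      ultimately show ?thesis unfolding sk using y by linarith
    qed
    also have "\<dots> \<le> 2 ^ (k + 1) * fact k * sinh_gap x"
    proof (intro mult_right_mono)
      have "(1::real) * 1 \<le> 2 ^ k * fact k" by (intro mult_mono) (auto simp: fact_ge_1)
      then show "2 \<le> (2 ^ (k + 1) * fact k :: real)" by simp
    qed (simp add: sinh_gap_def)
    finally show ?thesis unfolding y_def .
  next
    case False
    have "(y / 2) ^ k / fact k \<le> exp (y / 2)"
    proof -
      have "(\<Sum>n\<in>{k}. (y/2) ^ n /\<^sub>R fact n) \<le> (\<Sum>n. (y/2) ^ n /\<^sub>R fact n)"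
        using y by (intro sum_le_suminf summable_exp_generic) auto
      also have "\<dots> = exp (y / 2)" by (rule exp_converges[THEN sums_unique, symmetric])
      finally show ?thesis by (simp add: inverse_eq_divide)
    qed
    also have "exp (y / 2) \<le> 2 * sinh_gap x"
    proof -
      have "1 + 1 \<le> exp (1::real)" by (rule exp_ge_add_one_self)
      also have "exp 1 \<le> exp y" using False by simp
      finally have "2 * exp (- (y / 2)) \<le> exp y * exp (- (y / 2))" by (intro mult_right_mono) auto
      also have "\<dots> = exp (y / 2)" by (simp add: exp_add[symmetric])
      finally show ?thesis unfolding sk by simp
    qed
    finally show ?thesis unfolding y_def[symmetric] by (simp add: power_divide field_simps)
  qed
qed

lemma abs_power_diff_le:
  fixes x z :: real
  assumes "0 \<le> x"
  shows "\<bar>(x + z) ^ Suc n - x ^ Suc n\<bar> \<le> real (Suc n) * (\<bar>z\<bar> * (x + \<bar>z\<bar>) ^ n)"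
proof -
  have "\<bar>\<Sum>p<Suc n. (x + z) ^ p * x ^ (n - p)\<bar> \<le> (\<Sum>p<Suc n. (x + \<bar>z\<bar>) ^ n)"
  proof (intro order.trans[OF sum_abs] sum_mono)
    fix p assume p: "p \<in> {..<Suc n}"
    have "\<bar>(x + z) ^ p * x ^ (n - p)\<bar> \<le> (x + \<bar>z\<bar>) ^ p * (x + \<bar>z\<bar>) ^ (n - p)"
      unfolding abs_mult power_abs using assms by (intro mult_mono power_mono) auto
    also have "\<dots> = (x + \<bar>z\<bar>) ^ n" using p by (simp add: power_add[symmetric])
    finally show "\<bar>(x + z) ^ p * x ^ (n - p)\<bar> \<le> (x + \<bar>z\<bar>) ^ n" .
  qed
  then have "\<bar>\<Sum>p<Suc n. (x + z) ^ p * x ^ (n - p)\<bar> \<le> real (Suc n) * (x + \<bar>z\<bar>) ^ n" by simp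
  moreover have "\<bar>(x + z) ^ Suc n - x ^ Suc n\<bar> = \<bar>z\<bar> * \<bar>\<Sum>p<Suc n. (x + z) ^ p * x ^ (n - p)\<bar>"
    unfolding diff_power_eq_sum abs_mult by simp
  ultimately show ?thesis
    using mult_left_mono[of "\<bar>\<Sum>p<Suc n. (x + z) ^ p * x ^ (n - p)\<bar>" "real (Suc n) * (x + \<bar>z\<bar>) ^ n" "\<bar>z\<bar>"]
    by (simp only: mult_ac abs_ge_zero)
qed

lemma power_log_perturb:
  assumes k: "1 \<le> k"
  shows "\<exists>C\<ge>0. \<forall>x y. 0 < x \<longrightarrow> 0 \<le> y \<longrightarrow> \<bar>(y - ln x) ^ k - y ^ k\<bar> \<le> C * ((1 + y ^ (k - 1)) * sinh_gap x)"
proof -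
  obtain n where n: "k = Suc n" using k by (cases k) auto
  define A where "A = (\<lambda>k. 2 ^ (k + 1) * fact k :: real)"
  define C where "C = real k * 2 ^ n * (A 1 + A k)"
  have A: "0 \<le> A i" for i by (simp add: A_def)
  have "\<bar>(y - ln x) ^ k - y ^ k\<bar> \<le> C * ((1 + y ^ (k - 1)) * sinh_gap x)" if x: "0 < x" and y: "0 \<le> y" for x y
  proof -
    define z where "z = \<bar>ln x\<bar>"
    have z: "0 \<le> z" by (simp add: z_def)
    have sk: "0 \<le> sinh_gap x" by (simp add: sinh_gap_def)
    have "\<bar>(y - ln x) ^ k - y ^ k\<bar> \<le> real k * (z * (y + z) ^ n)"
      using abs_power_diff_le[OF y, of "- ln x" n] by (simp add: n z_def)
    also have "\<dots> \<le> real k * (z * (2 ^ n * (y ^ n + z ^ n)))"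
    proof (intro mult_left_mono)
      have "(y + z) ^ n \<le> (2 * max y z) ^ n" using y z by (intro power_mono) auto
      also have "\<dots> \<le> 2 ^ n * (y ^ n + z ^ n)"
        using y z by (auto simp: power_mult_distrib max_def)
      finally show "(y + z) ^ n \<le> 2 ^ n * (y ^ n + z ^ n)" .
    qed (use z in auto)
    \<comment> \<open>both powers of z are now at least 1, as is needed for the bound by the hyperbolic sine\<close>
    also have "real k * (z * (2 ^ n * (y ^ n + z ^ n))) = real k * 2 ^ n * (z ^ 1 * y ^ n + z ^ k)"
      by (simp add: n algebra_simps)
    also have "\<dots> \<le> real k * 2 ^ n * (A 1 * sinh_gap x * y ^ n + A k * sinh_gap x)"
      using abs_ln_power_le_sinh_gap[OF x, of 1] abs_ln_power_le_sinh_gap[OF x k] y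
      unfolding z_def A_def by (intro mult_left_mono add_mono mult_right_mono) auto
    also have "\<dots> \<le> real k * 2 ^ n * ((A 1 + A k) * (1 + y ^ n) * sinh_gap x)"
    proof (intro mult_left_mono)
      have "0 \<le> A 1 * sinh_gap x" "0 \<le> A k * (sinh_gap x * y ^ n)" using A sk y by auto
      then show "A 1 * sinh_gap x * y ^ n + A k * sinh_gap x \<le> (A 1 + A k) * (1 + y ^ n) * sinh_gap x"
        by (simp add: algebra_simps)
    qed auto
    finally show ?thesis using z by (simp add: C_def n mult_ac)
  qed
  moreover have "0 \<le> C" unfolding C_def using A[of 1] A[of k] by (intro mult_nonneg_nonneg add_nonneg_nonneg) auto
  ultimately show ?thesis by blast
qed

text \<open>Division of the binomial weights by \<open>k + 1\<close> produces, up to a factor, the binomial weights for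
  \<open>N + 1\<close> trials, without the one for no success.\<close>

lemma sum_inverse_Bernstein:
  assumes "0 < s" "s < 1"
  shows "(\<Sum>k\<le>N. Bernstein N k s * ((real N + 1) * s / (real k + 1))) \<le> 1"
proof -
  have "(\<Sum>k\<le>N. Bernstein N k s * ((real N + 1) * s / (real k + 1))) = (\<Sum>k\<le>N. Bernstein (Suc N) (Suc k) s)"
  proof (intro sum.cong refl)
    fix k
    have "real (Suc k) * real (Suc N choose Suc k) = real (Suc N) * real (N choose k)"
      by (simp only: of_nat_mult[symmetric] Suc_times_binomial)
    then have "real (N choose k) * ((real N + 1) / (real k + 1)) = real (Suc N choose Suc k)"
      by (simp add: field_simps del: binomial_Suc_Suc)
    moreover have "Bernstein N k s * ((real N + 1) * s / (real k + 1))
        = real (N choose k) * ((real N + 1) / (real k + 1)) * (s * s ^ k * (1 - s) ^ (N - k))"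
      by (simp add: Bernstein_def)
    ultimately show "Bernstein N k s * ((real N + 1) * s / (real k + 1)) = Bernstein (Suc N) (Suc k) s"
      by (simp add: Bernstein_def del: binomial_Suc_Suc)
  qed
  also have "\<dots> \<le> (\<Sum>k\<le>Suc N. Bernstein (Suc N) k s)"
    unfolding sum.atMost_Suc_shift using assms by (simp add: Bernstein_nonneg del: sum.atMost_Suc)
  also have "\<dots> = 1" by simp
  finally show ?thesis .
qed

text \<open>Let \<open>k\<close> be binomial with \<open>N\<close> trials and put \<open>x = (k + 1) / ((N + 1) * s)\<close>. The mean of \<open>x\<close> is
  \<open>(N * s + 1) / ((N + 1) * s)\<close> and that of \<open>1 / x\<close> is at most \<open>1\<close>, so the mean of \<open>x - 2 + 1 / x\<close> is at
  most \<open>(1 - s) / ((N + 1) * s)\<close>. It remains to apply the Cauchy-Schwarz inequality.\<close>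

lemma Bernstein_mean_sinh_gap:
  assumes s: "0 < s" "s < 1"
  shows "(\<Sum>k\<le>N. Bernstein N k s * sinh_gap ((real k + 1) / ((real N + 1) * s)))
           \<le> sqrt ((1 - s) / ((real N + 1) * s))"
proof -
  define x where "x = (\<lambda>k. (real k + 1) / ((real N + 1) * s))"
  define \<eta> where "\<eta> = sqrt ((1 - s) / ((real N + 1) * s))"
  have \<eta>: "0 < \<eta>" and \<eta>2: "\<eta>\<^sup>2 = (1 - s) / ((real N + 1) * s)" using s by (auto simp: \<eta>_def)
  have x: "0 < x k" for k using s by (simp add: x_def)
  have B: "0 \<le> Bernstein N k s" for k using s by (simp add: Bernstein_nonneg)
  have "(\<Sum>k\<le>N. Bernstein N k s * (sinh_gap (x k))\<^sup>2)
      = (\<Sum>k\<le>N. Bernstein N k s * x k) - 2 * (\<Sum>k\<le>N. Bernstein N k s) + (\<Sum>k\<le>N. Bernstein N k s * (1 / x k))"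
  proof -
    have "Bernstein N k s * (sinh_gap (x k))\<^sup>2 = (Bernstein N k s * x k - 2 * Bernstein N k s) + Bernstein N k s * (1 / x k)" for k
      unfolding sinh_gap_squared[OF x] by (simp add: algebra_simps)
    then show ?thesis by (simp only: sum.distrib sum_subtractf sum_distrib_left)
  qed
  also have "(\<Sum>k\<le>N. Bernstein N k s * x k) = ((\<Sum>k\<le>N. real k * Bernstein N k s) + (\<Sum>k\<le>N. Bernstein N k s)) / ((real N + 1) * s)"
  proof -
    have "Bernstein N k s * x k = (real k * Bernstein N k s + Bernstein N k s) / ((real N + 1) * s)" for k
      unfolding x_def times_divide_eq_right by (intro arg_cong2[where f = "(/)"]) (simp_all add: algebra_simps)
    then show ?thesis by (simp only: sum_divide_distrib[symmetric] sum.distrib)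
  qed
  also have "\<dots> = (real N * s + 1) / ((real N + 1) * s)" by simp
  also have "(\<Sum>k\<le>N. Bernstein N k s * (1 / x k)) \<le> 1"
    using sum_inverse_Bernstein[OF s, of N] by (simp add: x_def)
  also have "(real N * s + 1) / ((real N + 1) * s) - 2 * (\<Sum>k\<le>N. Bernstein N k s) + 1 = \<eta>\<^sup>2"
  proof -
    have "s + s * real N > 0" using s by (simp add: add_pos_nonneg)
    then show ?thesis unfolding \<eta>2 using s by (simp add: field_simps)
  qed
  finally have sq: "(\<Sum>k\<le>N. Bernstein N k s * (sinh_gap (x k))\<^sup>2) \<le> \<eta>\<^sup>2" by simp
  \<comment> \<open>Cauchy-Schwarz, linearised as an inequality of arithmetic and geometric means\<close>
  have "(\<Sum>k\<le>N. Bernstein N k s * sinh_gap (x k)) \<le> (\<Sum>k\<le>N. Bernstein N k s * ((\<eta> + (sinh_gap (x k))\<^sup>2 / \<eta>) / 2))"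
  proof (intro sum_mono mult_left_mono B)
    fix k
    have "0 \<le> (\<eta> - sinh_gap (x k))\<^sup>2" by simp
    then show "sinh_gap (x k) \<le> (\<eta> + (sinh_gap (x k))\<^sup>2 / \<eta>) / 2"
      using \<eta> by (simp add: power2_eq_square field_simps)
  qed
  also have "\<dots> = (\<eta> * (\<Sum>k\<le>N. Bernstein N k s) + (\<Sum>k\<le>N. Bernstein N k s * (sinh_gap (x k))\<^sup>2) / \<eta>) / 2"
  proof -
    have "Bernstein N k s * ((\<eta> + (sinh_gap (x k))\<^sup>2 / \<eta>) / 2)
        = (\<eta> * Bernstein N k s + Bernstein N k s * (sinh_gap (x k))\<^sup>2 / \<eta>) / 2" for k
      by (simp add: distrib_left mult.commute)
    then show ?thesis by (simp only: sum_divide_distrib[symmetric] sum.distrib sum_distrib_left)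
  qed
  also have "\<dots> \<le> (\<eta> * 1 + \<eta>\<^sup>2 / \<eta>) / 2"
    using sq \<eta> by (intro divide_right_mono add_mono) (auto simp: divide_right_mono)
  also have "\<dots> = \<eta>" using \<eta> by (simp add: power2_eq_square)
  finally show ?thesis unfolding x_def \<eta>_def .
qed

section \<open>The size of the block of a tagged label\<close>

text \<open>The law of the size of the block that contains a given label after the split of a block of
  size \<open>m\<close>: by symmetry each of the two ordered blocks has size \<open>j\<close> with probability
  \<open>split_prob \<beta> m j\<close>, and a block of size \<open>j\<close> contains the label with probability \<open>j / m\<close>.\<close>

definition tagged_prob :: "real \<Rightarrow> nat \<Rightarrow> nat \<Rightarrow> real" where
  "tagged_prob \<beta> m j = 2 * split_prob \<beta> m j * (real j / real m)"

lemma split_prob_sym: "j \<le> m \<Longrightarrow> split_prob \<beta> m (m - j) = split_prob \<beta> m j"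
  using binomial_symmetric[of j m] Beta_commute[of "real j + \<beta> + 1"]
  by (simp add: split_prob_def of_nat_diff)

lemma tagged_prob_sum:
  fixes f :: "nat \<Rightarrow> 'a::real_vector"
  shows "(\<Sum>j=1..<m. tagged_prob \<beta> m j *\<^sub>R f j)
     = (\<Sum>j=1..<m. split_prob \<beta> m j *\<^sub>R ((real j / real m) *\<^sub>R f j + (real (m - j) / real m) *\<^sub>R f (m - j)))"
proof -
  have "(\<Sum>j=1..<m. split_prob \<beta> m j *\<^sub>R ((real (m - j) / real m) *\<^sub>R f (m - j)))
      = (\<Sum>j=1..<m. split_prob \<beta> m j *\<^sub>R ((real j / real m) *\<^sub>R f j))"
    by (rule sum.reindex_bij_witness[where i = "\<lambda>j. m - j" and j = "\<lambda>j. m - j"])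
       (auto simp: split_prob_sym)
  moreover have "tagged_prob \<beta> m j *\<^sub>R f j = split_prob \<beta> m j *\<^sub>R ((real j / real m) *\<^sub>R f j)
      + split_prob \<beta> m j *\<^sub>R ((real j / real m) *\<^sub>R f j)" for j
    unfolding tagged_prob_def scaleR_scaleR scaleR_add_left[symmetric] by simp
  ultimately show ?thesis
    by (simp only: scaleR_add_right sum.distrib)
qed

lemma tagged_prob_stochastic:
  assumes "-2 < \<beta>" "2 \<le> m"
  shows "(\<Sum>j=1..<m. tagged_prob \<beta> m j) = 1"
proof -
  have "(\<Sum>j=1..<m. tagged_prob \<beta> m j) = (\<Sum>j=1..<m. split_prob \<beta> m j *\<^sub>R ((real j / real m) *\<^sub>R 1 + (real (m - j) / real m) *\<^sub>R 1))"
    using tagged_prob_sum[of \<beta> m "\<lambda>_. 1 :: real"] by simp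
  also have "\<dots> = (\<Sum>j=1..<m. split_prob \<beta> m j)"
    using assms by (intro sum.cong refl) (auto simp: add_divide_distrib[symmetric])
  also have "\<dots> = (\<Sum>j=1..m-1. split_prob \<beta> m j)"
    using assms by (intro sum.cong) auto
  finally show ?thesis using sum_split_prob[OF assms] by (simp only:)
qed

lemma tagged_prob_nonneg:
  assumes "-2 < \<beta>" "j \<in> {1..<m}"
  shows "0 \<le> tagged_prob \<beta> m j"
  using split_prob_nonneg[of \<beta> j m] assms by (auto simp: tagged_prob_def)

text \<open>With \<open>m = N + 1\<close> and \<open>j = k + 1\<close>, the size bias \<open>j / m\<close> turns the binomial coefficient of \<open>m\<close> and \<open>j\<close>
  into that of \<open>N\<close> and \<open>k\<close>. The right-hand side is the rate at which a binomial thinning of \<open>N\<close>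
  points leaves \<open>k\<close> of them, see \<open>Bernstein_levy_integral\<close>.\<close>

lemma tagged_rate:
  assumes "-2 < \<beta>" "k < N"
  shows "phi \<beta> (real N) * tagged_prob \<beta> (Suc N) (Suc k)
     = real (N choose k) * Beta (real k + \<beta> + 2) (real N - real k + \<beta> + 1)"
proof -
  have pos: "0 < phi \<beta> (real N)" using phi_nat(2)[of \<beta> "Suc N"] assms by simp
  have binom: "real (Suc N choose Suc k) * real (Suc k) / real (Suc N) = real (N choose k)"
  proof -
    have "real (Suc k) * real (Suc N choose Suc k) = real (Suc N) * real (N choose k)"
      by (simp only: of_nat_mult[symmetric] Suc_times_binomial)
    then show ?thesis by (simp add: field_simps del: binomial_Suc_Suc)
  qed
  have cancel: "p * (2 * (1 / (2 * p) * c * b) * (x / y)) = (c * x / y) * b" if "0 < p" for p c b x y :: real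
  proof -
    have "p * (2 * (1 / (2 * p) * c * b) * (x / y)) = (p * (2 * (1 / (2 * p)))) * (c * b * (x / y))"
      by (simp only: mult_ac)
    also have "p * (2 * (1 / (2 * p))) = 1" using that by simp
    finally show ?thesis by simp
  qed
  have N: "real (Suc N) - 1 = real N" by simp
  have "phi \<beta> (real N) * tagged_prob \<beta> (Suc N) (Suc k)
     = (real (Suc N choose Suc k) * real (Suc k) / real (Suc N)) * Beta (real (Suc k) + \<beta> + 1) (real (Suc N) - real (Suc k) + \<beta> + 1)"
    unfolding tagged_prob_def split_prob_def N by (rule cancel[OF pos])
  also have "\<dots> = real (N choose k) * Beta (real k + \<beta> + 2) (real N - real k + \<beta> + 1)"
    unfolding binom
    by (simp add: algebra_simps)
  finally show ?thesis .
qed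

lemma Bernstein_levy_integral:
  assumes "-2 < \<beta>" "k < N"
  shows "set_integrable lborel {0<..<1} (\<lambda>s. Bernstein N k s * levy_density \<beta> s)"
    and "(LBINT s:{0<..<1}. Bernstein N k s * levy_density \<beta> s)
           = real (N choose k) * Beta (real k + \<beta> + 2) (real N - real k + \<beta> + 1)"
proof -
  define a b where "a = real k + \<beta> + 2" and "b = real N - real k + \<beta> + 1"
  have "real k + 1 \<le> real N" using assms(2) by linarith
  then have ab: "0 < a" "0 < b" using assms by (auto simp: a_def b_def)
  have eq: "Bernstein N k s * levy_density \<beta> s = real (N choose k) * (s powr (a - 1) * (1 - s) powr (b - 1))"
    if "s \<in> {0<..<1}" for s
  proof -
    have s: "0 < s" "0 < 1 - s" using that by auto
    have "s ^ k = s powr real k" "(1 - s) ^ (N - k) = (1 - s) powr (real N - real k)"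
      using s assms(2) by (simp_all add: powr_realpow[symmetric] of_nat_diff)
    then have "Bernstein N k s * levy_density \<beta> s
        = real (N choose k) * ((s powr real k * s powr (\<beta> + 1)) * ((1 - s) powr (real N - real k) * (1 - s) powr \<beta>))"
      by (simp add: Bernstein_def levy_density_def)
    also have "s powr real k * s powr (\<beta> + 1) = s powr (a - 1)"
      unfolding powr_add[symmetric] by (simp add: a_def algebra_simps)
    also have "(1 - s) powr (real N - real k) * (1 - s) powr \<beta> = (1 - s) powr (b - 1)"
      unfolding powr_add[symmetric] by (simp add: b_def algebra_simps)
    finally show ?thesis .
  qed
  have "set_integrable lborel {0<..<1} (\<lambda>s. real (N choose k) * (s powr (a - 1) * (1 - s) powr (b - 1)))"
    by (intro set_integrable_mult_right Beta_set_integral ab)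
  then show "set_integrable lborel {0<..<1} (\<lambda>s. Bernstein N k s * levy_density \<beta> s)"
    by (rule set_integrable_cong[THEN iffD1, rotated -1]) (use eq in auto)
  have "(LBINT s:{0<..<1}. Bernstein N k s * levy_density \<beta> s)
      = (LBINT s:{0<..<1}. real (N choose k) * (s powr (a - 1) * (1 - s) powr (b - 1)))"
    by (intro set_lebesgue_integral_cong) (use eq in auto)
  also have "\<dots> = real (N choose k) * Beta a b"
    using Beta_set_integral[OF ab] by simp
  finally show "(LBINT s:{0<..<1}. Bernstein N k s * levy_density \<beta> s)
           = real (N choose k) * Beta (real k + \<beta> + 2) (real N - real k + \<beta> + 1)"
    by (simp add: a_def b_def)
qed

text \<open>The thinning that keeps all \<open>N\<close> points may have infinite rate; it is not a step of the chain,
  and the condition on \<open>f N\<close> removes it from the integral.\<close>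

lemma tagged_step_integral:
  fixes f :: "nat \<Rightarrow> real"
  assumes "-2 < \<beta>" and f: "f N = 0"
  shows "set_integrable lborel {0<..<1} (\<lambda>s. (\<Sum>k\<le>N. Bernstein N k s * f k) * levy_density \<beta> s)"
    and "phi \<beta> (real N) * (\<Sum>k<N. tagged_prob \<beta> (Suc N) (Suc k) * f k)
           = (LBINT s:{0<..<1}. (\<Sum>k\<le>N. Bernstein N k s * f k) * levy_density \<beta> s)"
proof -
  have eq: "(\<Sum>k\<le>N. Bernstein N k s * f k) * levy_density \<beta> s
      = (\<Sum>k<N. f k * (Bernstein N k s * levy_density \<beta> s))" for s
  proof -
    have red: "(\<Sum>k\<le>N. Bernstein N k s * f k) = (\<Sum>k<N. Bernstein N k s * f k)"
      using f by (simp add: lessThan_Suc_atMost[symmetric])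
    show ?thesis unfolding red sum_distrib_right by (intro sum.cong refl) simp
  qed
  have int: "set_integrable lborel {0<..<1} (\<lambda>s. f k * (Bernstein N k s * levy_density \<beta> s))"
    if "k < N" for k
    by (intro set_integrable_mult_right Bernstein_levy_integral assms that)
  show "set_integrable lborel {0<..<1} (\<lambda>s. (\<Sum>k\<le>N. Bernstein N k s * f k) * levy_density \<beta> s)"
    unfolding eq set_integrable_def scaleR_sum_right
    by (intro Bochner_Integration.integrable_sum) (use int in \<open>simp add: set_integrable_def\<close>)
  have "(LBINT s:{0<..<1}. (\<Sum>k\<le>N. Bernstein N k s * f k) * levy_density \<beta> s)
      = (\<Sum>k<N. LBINT s:{0<..<1}. f k * (Bernstein N k s * levy_density \<beta> s))"
    unfolding eq set_lebesgue_integral_def scaleR_sum_right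
    by (intro Bochner_Integration.integral_sum) (use int in \<open>simp add: set_integrable_def\<close>)
  also have "\<dots> = (\<Sum>k<N. f k * (phi \<beta> (real N) * tagged_prob \<beta> (Suc N) (Suc k)))"
    using assms by (intro sum.cong refl) (simp add: Bernstein_levy_integral(2) tagged_rate)
  finally show "phi \<beta> (real N) * (\<Sum>k<N. tagged_prob \<beta> (Suc N) (Suc k) * f k)
           = (LBINT s:{0<..<1}. (\<Sum>k\<le>N. Bernstein N k s * f k) * levy_density \<beta> s)"
    by (simp add: sum_distrib_left mult_ac)
qed

text \<open>Given \<open>s\<close>, the decrease \<open>ln m - ln j\<close> is \<open>- ln s - ln x\<close> with \<open>x\<close> as in
  \<open>Bernstein_mean_sinh_gap\<close>, so its \<open>k\<close>-th power differs from that of \<open>- ln s\<close> in the mean by at most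
  a multiple of \<open>sqrt ((1 - s) / (m * s))\<close>, up to powers of the logarithm. This is integrable against
  the Levy density for all \<open>\<beta> \<ge> -1\<close>.\<close>

lemma step_log_moments:
  assumes \<beta>: "-1 \<le> \<beta>" and k: "1 \<le> k"
  shows "\<exists>C. \<forall>m\<ge>2. \<bar>phi \<beta> (real m - 1) * (\<Sum>j=1..<m. tagged_prob \<beta> m j * (ln m - ln j) ^ k)
             - log_moment \<beta> k\<bar> \<le> C / sqrt m"
proof -
  obtain C where C: "0 \<le> C" "\<And>x y. 0 < x \<Longrightarrow> 0 \<le> y \<Longrightarrow> \<bar>(y - ln x) ^ k - y ^ k\<bar> \<le> C * ((1 + y ^ (k - 1)) * sinh_gap x)"
    using power_log_perturb[OF k] by blast
  define W where "W = (\<lambda>s. C * ((1 + (- ln s) ^ (k - 1)) * (s powr (\<beta> + 1/2) * (1 - s) powr (\<beta> + 1/2))))"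
  have W: "set_integrable lborel {0<..<1} W"
  proof -
    have "set_integrable lborel {0<..<1} (\<lambda>s. (- ln s) ^ 0 * (s powr (\<beta> + 1/2) * (1 - s) powr (\<beta> + 1/2))
        + (- ln s) ^ (k - 1) * (s powr (\<beta> + 1/2) * (1 - s) powr (\<beta> + 1/2)))"
      using \<beta> by (intro set_integral_add ln_power_integrable) auto
    then have "set_integrable lborel {0<..<1} (\<lambda>s. C * ((- ln s) ^ 0 * (s powr (\<beta> + 1/2) * (1 - s) powr (\<beta> + 1/2))
        + (- ln s) ^ (k - 1) * (s powr (\<beta> + 1/2) * (1 - s) powr (\<beta> + 1/2))))"
      by (intro set_integrable_mult_right) auto
    then show ?thesis unfolding W_def by (simp add: distrib_right)
  qed
  have mom: "set_integrable lborel {0<..<1} (\<lambda>s. (- ln s) ^ k * levy_density \<beta> s)"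
    unfolding levy_density_def using \<beta> k by (intro ln_power_integrable) auto
  have "\<bar>phi \<beta> (real m - 1) * (\<Sum>j=1..<m. tagged_prob \<beta> m j * (ln m - ln j) ^ k)
             - log_moment \<beta> k\<bar> \<le> (LBINT s:{0<..<1}. W s) / sqrt m" if m: "2 \<le> m" for m
  proof -
    obtain N where N: "m = Suc N" "1 \<le> N" using m by (cases m) auto
    define f where "f = (\<lambda>i. (ln (real N + 1) - ln (real i + 1)) ^ k)"
    define S where "S = (\<lambda>s. \<Sum>i\<le>N. Bernstein N i s * f i)"
    have fN: "f N = 0" using k by (simp add: f_def)
    have reindex: "(\<Sum>j=1..<m. tagged_prob \<beta> m j * (ln m - ln j) ^ k) = (\<Sum>i<N. tagged_prob \<beta> (Suc N) (Suc i) * f i)"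
      unfolding N f_def by (rule sum.reindex_bij_witness[where i = Suc and j = "\<lambda>j. j - 1"]) (auto simp: add_ac)
    have rep: "phi \<beta> (real m - 1) * (\<Sum>j=1..<m. tagged_prob \<beta> m j * (ln m - ln j) ^ k)
        = (LBINT s:{0<..<1}. S s * levy_density \<beta> s)"
      unfolding reindex S_def using tagged_step_integral(2)[where f = f and N = N and \<beta> = \<beta>] fN \<beta> by (simp add: N)
    have intS: "set_integrable lborel {0<..<1} (\<lambda>s. S s * levy_density \<beta> s)"
      unfolding S_def using tagged_step_integral(1)[where f = f and N = N and \<beta> = \<beta>] fN \<beta> by simp
    \<comment> \<open>the factor sqrt ((1 - s) / s) moves both exponents of the density by one half\<close>
    have pointwise: "\<bar>S s * levy_density \<beta> s - (- ln s) ^ k * levy_density \<beta> s\<bar> \<le> 1 / sqrt m * W s"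
      if "s \<in> {0<..<1}" for s
    proof -
      have s: "0 < s" "s < 1" using that by auto
      define x where "x = (\<lambda>i. (real i + 1) / ((real N + 1) * s))"
      have x: "0 < x i" for i using s by (simp add: x_def)
      have y: "0 \<le> - ln s" using s by simp
      have B: "0 \<le> Bernstein N i s" for i using s by (simp add: Bernstein_nonneg)
      have f: "f i = (- ln s - ln (x i)) ^ k" for i
        using s by (simp add: f_def x_def ln_div ln_mult add_pos_nonneg)
      have "\<bar>S s - (- ln s) ^ k\<bar> = \<bar>\<Sum>i\<le>N. Bernstein N i s * (f i - (- ln s) ^ k)\<bar>"
        unfolding S_def right_diff_distrib sum_subtractf sum_distrib_right[symmetric] by simp
      also have "\<dots> \<le> (\<Sum>i\<le>N. Bernstein N i s * (C * ((1 + (- ln s) ^ (k - 1)) * sinh_gap (x i))))"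
        using C(2)[OF x y] B
        by (intro order.trans[OF sum_abs] sum_mono) (auto simp: abs_mult f intro!: mult_left_mono)
      also have "\<dots> = C * (1 + (- ln s) ^ (k - 1)) * (\<Sum>i\<le>N. Bernstein N i s * sinh_gap (x i))"
        by (simp add: sum_distrib_left mult_ac)
      also have "\<dots> \<le> C * (1 + (- ln s) ^ (k - 1)) * sqrt ((1 - s) / ((real N + 1) * s))"
        unfolding x_def using Bernstein_mean_sinh_gap[OF s] C(1) y
        by (intro mult_left_mono mult_nonneg_nonneg add_nonneg_nonneg zero_le_power) auto
      finally have "\<bar>S s - (- ln s) ^ k\<bar> * levy_density \<beta> s
          \<le> C * (1 + (- ln s) ^ (k - 1)) * sqrt ((1 - s) / ((real N + 1) * s)) * levy_density \<beta> s"
        by (intro mult_right_mono) (auto simp: levy_density_def)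
      also have "\<dots> = C * (1 + (- ln s) ^ (k - 1)) * (sqrt ((1 - s) / ((real N + 1) * s)) * levy_density \<beta> s)"
        by (rule mult.assoc)
      also have "sqrt ((1 - s) / ((real N + 1) * s)) * levy_density \<beta> s
          = 1 / sqrt m * (s powr (\<beta> + 1/2) * (1 - s) powr (\<beta> + 1/2))"
      proof -
        have "s powr (\<beta> + 1/2) = s powr (\<beta> + 1) / sqrt s"
          using s by (simp add: powr_half_sqrt[symmetric] powr_diff[symmetric] add.commute)
        moreover have "(1 - s) powr (\<beta> + 1/2) = (1 - s) powr \<beta> * sqrt (1 - s)"
          using s by (simp add: powr_half_sqrt[symmetric] powr_add[symmetric] add.commute)
        ultimately show ?thesis
          by (simp add: levy_density_def N real_sqrt_divide real_sqrt_mult add_ac)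
      qed
      finally show ?thesis
        by (simp add: W_def left_diff_distrib[symmetric] abs_mult levy_density_def mult_ac)
    qed
    have "\<bar>(LBINT s:{0<..<1}. S s * levy_density \<beta> s) - log_moment \<beta> k\<bar>
        = \<bar>LBINT s:{0<..<1}. S s * levy_density \<beta> s - (- ln s) ^ k * levy_density \<beta> s\<bar>"
      unfolding log_moment_def by (subst set_integral_diff(2)[OF intS mom]) simp
    also have "\<dots> \<le> (LBINT s:{0<..<1}. \<bar>S s * levy_density \<beta> s - (- ln s) ^ k * levy_density \<beta> s\<bar>)"
      using set_integral_norm_bound[OF set_integral_diff(1)[OF intS mom]] by simp
    also have "\<dots> \<le> (LBINT s:{0<..<1}. 1 / sqrt m * W s)"
      using W intS mom pointwise
      by (intro set_integral_mono set_integrable_mult_right set_integrable_abs set_integral_diff(1)) auto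
    also have "\<dots> = (LBINT s:{0<..<1}. W s) / sqrt m"
      by simp
    finally show ?thesis unfolding rep .
  qed
  then show ?thesis by blast
qed

lemma phi_inf_conv_integral:
  assumes "-1 < \<beta>"
  shows "set_integrable lborel {0<..<1} (levy_density \<beta>)"
    and "phi_inf \<beta> = (LBINT s:{0<..<1}. levy_density \<beta> s)"
  using Beta_set_integral[of "\<beta> + 2" "\<beta> + 1"] assms
  by (simp_all add: levy_density_def[abs_def] phi_inf_def add_ac)

lemma power_le_inverse_powr:
  fixes s e :: real
  assumes "0 < s" "s < 1" "0 < e" "e \<le> 1" "1 \<le> N"
  shows "s ^ N \<le> (real N * (1 - s)) powr (- e)"
proof -
  define x where "x = real N * (1 - s)"
  have x: "0 < x" using assms by (simp add: x_def)
  have "s ^ N \<le> exp (- x)"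
  proof -
    have "s \<le> exp (- (1 - s))" using exp_ge_add_one_self[of "- (1 - s)"] by simp
    then have "s ^ N \<le> exp (- (1 - s)) ^ N" using assms by (intro power_mono) auto
    also have "\<dots> = exp (- x)" by (simp add: exp_of_nat_mult[symmetric] x_def algebra_simps)
    finally show ?thesis .
  qed
  also have "exp (- x) \<le> x powr (- e)"
  proof -
    have "x powr e \<le> exp x"
    proof (cases "x \<le> 1")
      case True
      then have "x powr e \<le> 1" using x assms by (simp add: powr_le1)
      also have "1 \<le> exp x" using x by simp
      finally show ?thesis .
    next
      case False
      then have "x powr e \<le> x powr 1" using assms by (intro powr_mono) auto
      also have "\<dots> = x" using x by simp
      also have "\<dots> \<le> exp x" using exp_ge_add_one_self[of x] by linarith
      finally show ?thesis .
    qed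
    then show ?thesis using x by (simp add: exp_minus powr_minus le_imp_inverse_le)
  qed
  finally show ?thesis unfolding x_def .
qed

text \<open>The difference is the integral of \<open>s ^ N\<close>, which is at most \<open>(N * (1 - s)) powr (- e)\<close>.\<close>

lemma phi_inf_rate:
  assumes \<beta>: "-1 < \<beta>"
  shows "\<exists>C e. 0 < e \<and> (\<forall>m\<ge>2. \<bar>phi_inf \<beta> - phi \<beta> (real m - 1)\<bar> \<le> C * (real m - 1) powr (- e))"
proof -
  \<comment> \<open>the density remains integrable at 1 after multiplication by (1 - s) powr (- e)\<close>
  define e where "e = min 1 ((\<beta> + 1) / 2)"
  have e: "0 < e" "e \<le> 1" "e < \<beta> + 1" using \<beta> by (auto simp: e_def min_def field_simps)
  define C where "C = (LBINT s:{0<..<1}. s powr ((\<beta> + 2) - 1) * (1 - s) powr ((\<beta> + 1 - e) - 1))"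
  have intC: "set_integrable lborel {0<..<1} (\<lambda>s. s powr ((\<beta> + 2) - 1) * (1 - s) powr ((\<beta> + 1 - e) - 1))"
    using e \<beta> by (intro Beta_set_integral) auto
  have "\<bar>phi_inf \<beta> - phi \<beta> (real m - 1)\<bar> \<le> C * (real m - 1) powr (- e)" if m: "2 \<le> m" for m
  proof -
    define N where "N = m - 1"
    have N: "1 \<le> N" "real m - 1 = real N" using m by (auto simp: N_def)
    have int1: "set_integrable lborel {0<..<1} (\<lambda>s. (1 - s powr real N) * s powr (\<beta> + 1) * (1 - s) powr \<beta>)"
    proof (rule set_integrable_bound[OF phi_inf_conv_integral(1)[OF \<beta>]])
      show "AE s in lborel. s \<in> {0<..<1} \<longrightarrow> norm ((1 - s powr real N) * s powr (\<beta> + 1) * (1 - s) powr \<beta>) \<le> norm (levy_density \<beta> s)"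
      proof (intro AE_I2 impI)
        fix s :: real assume "s \<in> {0<..<1}"
        then have "s powr real N \<le> 1" by (intro powr_le1) auto
        then have "\<bar>1 - s powr real N\<bar> \<le> 1" by simp
        then have "\<bar>1 - s powr real N\<bar> * levy_density \<beta> s \<le> 1 * levy_density \<beta> s"
          by (intro mult_right_mono) (auto simp: levy_density_def)
        then show "norm ((1 - s powr real N) * s powr (\<beta> + 1) * (1 - s) powr \<beta>) \<le> norm (levy_density \<beta> s)"
          by (simp add: levy_density_def abs_mult mult.assoc)
      qed
    qed (auto simp: set_borel_measurable_def)
    define g where "g = (\<lambda>s. levy_density \<beta> s - (1 - s powr real N) * s powr (\<beta> + 1) * (1 - s) powr \<beta>)"
    define h where "h = (\<lambda>s. s powr ((\<beta> + 2) - 1) * (1 - s) powr ((\<beta> + 1 - e) - 1))"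
    have "phi_inf \<beta> - phi \<beta> (real N) = (LBINT s:{0<..<1}. levy_density \<beta> s - (1 - s powr real N) * s powr (\<beta> + 1) * (1 - s) powr \<beta>)"
      unfolding phi_def phi_inf_conv_integral(2)[OF \<beta>]
      by (rule set_integral_diff(2)[symmetric, OF phi_inf_conv_integral(1)[OF \<beta>] int1])
    then have diff: "phi_inf \<beta> - phi \<beta> (real N) = (LBINT s:{0<..<1}. g s)"
      unfolding g_def .
    have g: "set_integrable lborel {0<..<1} g"
      unfolding g_def by (rule set_integral_diff(1)[OF phi_inf_conv_integral(1)[OF \<beta>] int1])
    have h: "set_integrable lborel {0<..<1} (\<lambda>s. real N powr (- e) * h s)"
      using intC unfolding h_def by (rule set_integrable_mult_right)
    have pointwise: "\<bar>g s\<bar> \<le> real N powr (- e) * h s" if "s \<in> {0<..<1}" for s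
    proof -
      from that have s: "0 < s" "s < 1" by auto
      have "g s = s ^ N * levy_density \<beta> s"
        using s by (simp add: g_def levy_density_def powr_realpow left_diff_distrib)
      then have "\<bar>g s\<bar> = s ^ N * levy_density \<beta> s"
        using s by (simp add: levy_density_def)
      also have "\<dots> \<le> (real N * (1 - s)) powr (- e) * levy_density \<beta> s"
        using power_le_inverse_powr[OF s e(1,2) N(1)] by (intro mult_right_mono) (auto simp: levy_density_def)
      also have "\<dots> = real N powr (- e) * (s powr (\<beta> + 1) * ((1 - s) powr (- e) * (1 - s) powr \<beta>))"
        using s by (simp add: powr_mult levy_density_def)
      also have "(1 - s) powr (- e) * (1 - s) powr \<beta> = (1 - s) powr ((\<beta> + 1 - e) - 1)"
        unfolding powr_add[symmetric] by simp
      also have "s powr (\<beta> + 1) = s powr ((\<beta> + 2) - 1)" by (simp add: algebra_simps)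
      finally show ?thesis unfolding h_def .
    qed
    have "\<bar>phi_inf \<beta> - phi \<beta> (real N)\<bar> \<le> (LBINT s:{0<..<1}. \<bar>g s\<bar>)"
      unfolding diff using set_integral_norm_bound[OF g] by simp
    also have "\<dots> \<le> (LBINT s:{0<..<1}. real N powr (- e) * h s)"
      by (rule set_integral_mono[OF set_integrable_abs[OF g] h pointwise])
    also have "\<dots> = C * real N powr (- e)" unfolding C_def h_def by simp
    finally show ?thesis unfolding N(2) .
  qed
  then show ?thesis using e by blast
qed

text \<open>For \<open>\<beta> = -1\<close> the chain goes from \<open>N + 1\<close> to \<open>k + 1\<close> at rate \<open>1 / (N - k)\<close>.\<close>

lemma phi_harmonic:
  assumes "1 \<le> N"
  shows "phi (-1) (real N) = harm N"
proof -
  have "phi (-1) (real N) = (\<Sum>j=1..<Suc N. phi (-1) (real N) * tagged_prob (-1) (Suc N) j)"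
    using tagged_prob_stochastic[of "-1" "Suc N"] assms by (simp add: sum_distrib_left[symmetric])
  also have "\<dots> = (\<Sum>k<N. phi (-1) (real N) * tagged_prob (-1) (Suc N) (Suc k))"
    by (rule sum.reindex_bij_witness[where i = Suc and j = "\<lambda>j. j - 1"]) auto
  also have "\<dots> = (\<Sum>k<N. 1 / (real N - real k))"
  proof (intro sum.cong refl)
    fix k assume "k \<in> {..<N}"
    then have k: "k < N" by simp
    define i where "i = N - Suc k"
    have N: "N = k + Suc i" using k by (simp add: i_def)
    have "Beta (real k + 1) (real N - real k) = fact k * fact i / fact N"
    proof -
      have "Beta (real k + 1) (real N - real k) = Gamma (1 + real k) * Gamma (1 + real i) / Gamma (1 + real N)"
        by (simp add: Beta_def N add_ac)
      then show ?thesis by (simp only: Gamma_fact)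
    qed
    moreover have "real (N choose k) = fact N / (fact k * fact (Suc i))"
      using k N by (subst binomial_fact) auto
    ultimately have "real (N choose k) * Beta (real k + 1) (real N - real k) = 1 / (real N - real k)"
      by (simp add: N)
    then show "phi (-1) (real N) * tagged_prob (-1) (Suc N) (Suc k) = 1 / (real N - real k)"
      using tagged_rate[of "-1" k N] k by (simp add: add.commute)
  qed
  also have "\<dots> = harm N"
    unfolding harm_def
    by (rule sum.reindex_bij_witness[where i = "\<lambda>j. N - j" and j = "\<lambda>k. N - k"])
       (auto simp: of_nat_diff inverse_eq_divide)
  finally show ?thesis .
qed

lemma phi_minus1_ln:
  assumes "2 \<le> m"
  shows "\<bar>phi (-1) (real m - 1) - ln m\<bar> \<le> 1"
proof -
  obtain N where N: "m = Suc N" "1 \<le> N" using assms by (cases m) auto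
  have p: "phi (-1) (real m - 1) = harm N" using phi_harmonic[OF N(2)] by (simp add: N)
  have "ln (real m) \<le> (harm N :: real)" using ln_le_harm[of N] by (simp add: N add_ac)
  moreover have "harm N - ln (real N) \<le> harm 1 - ln (real 1)"
    using euler_mascheroni_sequence_decreasing[of 1 N] N by simp
  moreover have "ln (real N) \<le> ln (real m)" using N by simp
  ultimately show ?thesis unfolding p by (simp add: harm_def)
qed

section \<open>Exact values and positivity of the constants\<close>

lemma set_integral_pos_except:
  fixes g :: "real \<Rightarrow> real"
  assumes g: "set_integrable lborel {0<..<1} g"
    and nonneg: "\<And>s. s \<in> {0<..<1} \<Longrightarrow> 0 \<le> g s"
    and pos: "\<And>s. s \<in> {0<..<1} \<Longrightarrow> s \<noteq> a \<Longrightarrow> 0 < g s"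
  shows "0 < (LBINT s:{0<..<1}. g s)"
proof (rule ccontr)
  let ?g = "\<lambda>s. indicator {0<..<1} s *\<^sub>R g s"
  assume "\<not> ?thesis"
  have ae: "AE s in lborel. 0 \<le> ?g s" using nonneg by (intro AE_I2) (auto simp: indicator_def)
  then have "0 \<le> integral\<^sup>L lborel ?g" by (rule integral_nonneg_AE)
  with \<open>\<not> ?thesis\<close> have "integral\<^sup>L lborel ?g = 0" by (simp add: set_lebesgue_integral_def)
  then have "AE s in lborel. ?g s = 0"
    using integral_nonneg_eq_0_iff_AE[OF g[unfolded set_integrable_def] ae] by simp
  moreover have "AE s in lborel. s \<noteq> a" by (rule AE_lborel_singleton)
  ultimately have "AE s in lborel. s \<notin> {0<..<1::real}"
  proof eventually_elim
    case (elim s)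
    show ?case
    proof
      assume "s \<in> {0<..<1}"
      then show False using pos[of s] elim by simp
    qed
  qed
  then have "emeasure lborel {0<..<1::real} = 0"
    by (subst (asm) AE_iff_measurable[where N = "{0<..<1}"]) auto
  then show False by simp
qed

lemma levy_density_pos: "s \<in> {0<..<1} \<Longrightarrow> 0 < levy_density \<beta> s"
  by (auto simp: levy_density_def)

lemma log_moment_integrable:
  assumes "-1 \<le> \<beta>" "1 \<le> k \<or> -1 < \<beta>"
  shows "set_integrable lborel {0<..<1} (\<lambda>s. (- ln s) ^ k * levy_density \<beta> s)"
  unfolding levy_density_def using assms by (intro ln_power_integrable) auto

lemma log_moment_pos:
  assumes "-1 \<le> \<beta>" "1 \<le> k \<or> -1 < \<beta>"
  shows "0 < log_moment \<beta> k"
  unfolding log_moment_def using levy_density_pos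
  by (intro set_integral_pos_except[OF log_moment_integrable[OF assms], of 0]) (auto intro!: mult_pos_pos mult_nonneg_nonneg less_imp_le)

text \<open>This is the strict Cauchy-Schwarz inequality for the constant \<open>1\<close> and the function \<open>- ln s\<close>: the
  integral of \<open>(- ln s - c)\<^sup>2\<close> with the mean \<open>c\<close> is positive, as the integrand vanishes at one point
  only. It shows that the limiting variance for \<open>\<beta> > -1\<close> does not degenerate.\<close>

lemma log_moment_variance_pos:
  assumes "-1 < \<beta>"
  shows "(log_moment \<beta> 1)\<^sup>2 < log_moment \<beta> 0 * log_moment \<beta> 2"
proof -
  define c where "c = log_moment \<beta> 1 / log_moment \<beta> 0"
  have pos: "0 < log_moment \<beta> 0" using assms by (intro log_moment_pos) auto
  have int: "set_integrable lborel {0<..<1} (\<lambda>s. (- ln s) ^ k * levy_density \<beta> s)" for k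
    using assms by (intro log_moment_integrable) auto
  have int': "set_integrable lborel {0<..<1} (\<lambda>s. a * ((- ln s) ^ k * levy_density \<beta> s))" for a k
    by (rule set_integrable_mult_right) (rule int)
  have eq: "(\<lambda>s. (- ln s - c)\<^sup>2 * levy_density \<beta> s) = (\<lambda>s. ((- ln s) ^ 2 * levy_density \<beta> s
      - (2 * c) * ((- ln s) ^ 1 * levy_density \<beta> s)) + c\<^sup>2 * ((- ln s) ^ 0 * levy_density \<beta> s))"
    by (simp add: fun_eq_iff power2_eq_square algebra_simps)
  note i1 = set_integral_diff[OF int[of 2] int'[of "2 * c" 1]]
  note i2 = set_integral_add[OF i1(1) int'[of "c\<^sup>2" 0]]
  have "0 < (LBINT s:{0<..<1}. (- ln s - c)\<^sup>2 * levy_density \<beta> s)"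
  proof (rule set_integral_pos_except)
    show "set_integrable lborel {0<..<1} (\<lambda>s. (- ln s - c)\<^sup>2 * levy_density \<beta> s)"
      unfolding eq by (rule i2(1))
    fix s :: real assume s: "s \<in> {0<..<1}"
    show "0 \<le> (- ln s - c)\<^sup>2 * levy_density \<beta> s" using levy_density_pos[OF s, of \<beta>] by simp
    assume "s \<noteq> exp (- c)"
    then have "- ln s - c \<noteq> 0" using s by (metis diff_eq_diff_eq exp_ln greaterThanLessThan_iff minus_equation_iff right_minus_eq)
    then show "0 < (- ln s - c)\<^sup>2 * levy_density \<beta> s" using levy_density_pos[OF s, of \<beta>] by simp
  qed
  also have "(LBINT s:{0<..<1}. (- ln s - c)\<^sup>2 * levy_density \<beta> s)
      = log_moment \<beta> 2 - 2 * c * log_moment \<beta> 1 + c\<^sup>2 * log_moment \<beta> 0"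
    by (simp only: eq i2(2) i1(2) log_moment_def set_integral_mult_right)
  also have "\<dots> = log_moment \<beta> 2 - (log_moment \<beta> 1)\<^sup>2 / log_moment \<beta> 0"
    using pos by (simp add: c_def power2_eq_square)
  finally show ?thesis using pos by (simp add: field_simps)
qed

lemma log_moment_0: "log_moment \<beta> 0 = phi_inf \<beta>" if "-1 < \<beta>"
  using phi_inf_conv_integral(2)[OF that] by (simp add: log_moment_def)

lemma power_ln_integral:
  shows "set_integrable lborel {0<..<1} (\<lambda>s::real. s ^ k * (- ln s))" (is ?A)
    and "(LBINT s:{0<..<1::real}. s ^ k * (- ln s)) = 1 / real (Suc k) ^ 2" (is ?B)
    and "set_integrable lborel {0<..<1} (\<lambda>s::real. s ^ k * (ln s)\<^sup>2)" (is ?C)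
    and "(LBINT s:{0<..<1::real}. s ^ k * (ln s)\<^sup>2) = 2 / real (Suc k) ^ 3" (is ?D)
proof -
  define n where "n = real (Suc k)"
  have n: "0 < n" by (simp add: n_def)
  have ei: "einterval 0 1 = {0<..<1::real}" by (auto simp: einterval_def)
  have d: "((\<lambda>s. s ^ Suc k) has_real_derivative n * s ^ k) (at s)" for s
    unfolding n_def by (rule derivative_eq_intros refl | simp)+
  have l1: "((\<lambda>s::real. s * ln s) \<longlongrightarrow> 0) (at_right 0)" by real_asymp
  have l2: "((\<lambda>s::real. s * (ln s)\<^sup>2) \<longlongrightarrow> 0) (at_right 0)" by real_asymp
  have lk: "((\<lambda>s::real. s ^ i) \<longlongrightarrow> 0 ^ i) (at_right 0)" for i
    by (intro tendsto_intros)
  have r1: "((\<lambda>s::real. s ^ Suc k * ln s) \<longlongrightarrow> 0) (at_right 0)"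
    using tendsto_mult[OF lk[of k] l1] by (simp add: mult_ac)
  have r2: "((\<lambda>s::real. s ^ Suc k * (ln s)\<^sup>2) \<longlongrightarrow> 0) (at_right 0)"
    using tendsto_mult[OF lk[of k] l2] by (simp add: mult_ac)
  have r0: "((\<lambda>s::real. s ^ Suc k) \<longlongrightarrow> 0) (at_right 0)"
    using lk[of "Suc k"] by simp
  have at_left: "(f \<longlongrightarrow> f 1) (at_left 1)" if "isCont f 1" for f :: "real \<Rightarrow> real"
    using that unfolding isCont_def by (rule tendsto_mono[OF at_le, rotated]) simp
  let ?F = "\<lambda>s. s ^ Suc k / n\<^sup>2 - (s ^ Suc k * ln s) / n"
  let ?G = "\<lambda>s. (s ^ Suc k * (ln s)\<^sup>2) / n - 2 * (s ^ Suc k * ln s) / n\<^sup>2 + 2 * s ^ Suc k / n ^ 3"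
  have F': "(?F has_real_derivative s ^ k * (- ln s)) (at s)" if s: "0 < s" for s
    by (rule DERIV_cong[OF DERIV_diff[OF DERIV_cdivide[OF d] DERIV_cdivide[OF DERIV_mult[OF d DERIV_ln[OF s]]]]])
       (use s n in \<open>simp add: field_simps power2_eq_square\<close>)
  have F0: "((?F \<circ> real_of_ereal) \<longlongrightarrow> 0) (at_right 0)"
    unfolding zero_ereal_def ereal_tendsto_simps
    using tendsto_diff[OF tendsto_divide[OF r0 tendsto_const[of "n\<^sup>2"]] tendsto_divide[OF r1 tendsto_const[of n]]] n
    by simp
  have F1: "((?F \<circ> real_of_ereal) \<longlongrightarrow> 1 / n\<^sup>2) (at_left 1)"
    unfolding one_ereal_def ereal_tendsto_simps
    using at_left[OF DERIV_isCont[OF F'[OF zero_less_one]]] by simp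
  have G': "(?G has_real_derivative s ^ k * (ln s)\<^sup>2) (at s)" if s: "0 < s" for s
    by (rule DERIV_cong[OF DERIV_add[OF DERIV_diff[OF
          DERIV_cdivide[OF DERIV_mult[OF d DERIV_power[OF DERIV_ln[OF s], of 2]]]
          DERIV_cdivide[OF DERIV_cmult[OF DERIV_mult[OF d DERIV_ln[OF s]]]]]
          DERIV_cdivide[OF DERIV_cmult[OF d]]]])
       (use s n in \<open>simp add: field_simps power2_eq_square power3_eq_cube\<close>)
  have G0: "((?G \<circ> real_of_ereal) \<longlongrightarrow> 0) (at_right 0)"
    unfolding zero_ereal_def ereal_tendsto_simps
    using tendsto_add[OF tendsto_diff[OF tendsto_divide[OF r2 tendsto_const[of n]]
        tendsto_divide[OF tendsto_mult[OF tendsto_const[of 2] r1] tendsto_const[of "n\<^sup>2"]]]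
        tendsto_divide[OF tendsto_mult[OF tendsto_const[of 2] r0] tendsto_const[of "n ^ 3"]]] n
    by simp
  have G1: "((?G \<circ> real_of_ereal) \<longlongrightarrow> 2 / n ^ 3) (at_left 1)"
    unfolding one_ereal_def ereal_tendsto_simps
    using at_left[OF DERIV_isCont[OF G'[OF zero_less_one]]] by simp
  have cont: "isCont (\<lambda>s. s ^ k * (- ln s)) s" "isCont (\<lambda>s. s ^ k * (ln s)\<^sup>2) s" if "0 < s" for s :: real
    using that by (auto intro!: isCont_mult isCont_power isCont_minus isCont_ln)
  have nonneg: "0 \<le> s ^ k * (- ln s)" "0 \<le> s ^ k * (ln s)\<^sup>2" if "0 < s" "s < 1" for s :: real
    using that by (intro mult_nonneg_nonneg; simp)+
  note 1 = interval_integral_FTC_nonneg[where F = ?F and f = "\<lambda>s. s ^ k * (- ln s)" and a = 0 and b = 1, OF _ F' cont(1) _ F0 F1]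
  note 2 = interval_integral_FTC_nonneg[where F = ?G and f = "\<lambda>s. s ^ k * (ln s)\<^sup>2" and a = 0 and b = 1, OF _ G' cont(2) _ G0 G1]
  have 1: "set_integrable lborel (einterval 0 1) (\<lambda>s. s ^ k * (- ln s))"
    "(LBINT s=0..1. s ^ k * (- ln s)) = 1 / n\<^sup>2 - 0"
    by (rule 1; use nonneg(1) in \<open>auto intro!: AE_I2 simp del: mult_minus_right\<close>)+
  have 2: "set_integrable lborel (einterval 0 1) (\<lambda>s. s ^ k * (ln s)\<^sup>2)"
    "(LBINT s=0..1. s ^ k * (ln s)\<^sup>2) = 2 / n ^ 3 - 0"
    by (rule 2; use nonneg(2) in \<open>auto intro!: AE_I2\<close>)+
  show ?A ?C using 1(1) 2(1) unfolding ei by auto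
  show ?B ?D using 1(2) 2(2) unfolding n_def
    by (simp_all add: interval_lebesgue_integral_def ei zero_ereal_def one_ereal_def)
qed

text \<open>For \<open>\<beta> = -1\<close> the Levy density is \<open>1 / (1 - s)\<close>, the sum of the geometric series.\<close>

lemma geometric_integral_sums:
  fixes w :: "real \<Rightarrow> real" and c :: "nat \<Rightarrow> real"
  assumes int: "\<And>k. set_integrable lborel {0<..<1} (\<lambda>s. s ^ k * w s)"
    and val: "\<And>k. (LBINT s:{0<..<1}. s ^ k * w s) = c k"
    and nonneg: "\<And>s. s \<in> {0<..<1} \<Longrightarrow> 0 \<le> w s" and sum: "summable c"
  shows "(LBINT s:{0<..<1}. w s * levy_density (-1) s) = (\<Sum>k. c k)"
proof -
  let ?f = "\<lambda>k s. indicator {0<..<1} s *\<^sub>R (s ^ k * w s)"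
  have geo: "(\<lambda>k. s ^ k * w s) sums (w s * levy_density (-1) s)" if "s \<in> {0<..<1}" for s :: real
  proof -
    have "(\<lambda>k. s ^ k * w s) sums (1 / (1 - s) * w s)"
      using that by (intro sums_mult2 geometric_sums) auto
    then show ?thesis using that by (simp add: levy_density_def powr_minus_divide)
  qed
  have n: "norm (?f k s) = ?f k s" for k s
    using nonneg[of s] by (auto simp: indicator_def abs_mult)
  have "(\<lambda>k. integral\<^sup>L lborel (?f k)) sums (\<integral>s. (\<Sum>k. ?f k s) \<partial>lborel)"
  proof (rule sums_integral)
    show "integrable lborel (?f k)" for k using int[of k] by (simp add: set_integrable_def)
    show "AE s in lborel. summable (\<lambda>k. norm (?f k s))"
      unfolding n using geo by (intro AE_I2) (auto simp: indicator_def sums_iff)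
    show "summable (\<lambda>k. \<integral>s. norm (?f k s) \<partial>lborel)"
      unfolding n using sum val by (simp add: set_lebesgue_integral_def)
  qed
  moreover have "(\<Sum>k. ?f k s) = indicator {0<..<1} s *\<^sub>R (w s * levy_density (-1) s)" for s
    using geo[of s] by (auto simp: indicator_def sums_iff)
  ultimately show ?thesis
    using val by (simp add: set_lebesgue_integral_def sums_iff)
qed

lemma mu_minus1: "mu (-1) = zeta 2"
proof -
  have "mu (-1) = (LBINT s:{0<..<1}. - ln s * levy_density (-1) s)"
    unfolding mu_conv_log_moment log_moment_def by simp
  also have "\<dots> = (\<Sum>k. 1 / real (Suc k) ^ 2)"
  proof (rule geometric_integral_sums[OF power_ln_integral(1,2)])
    show "summable (\<lambda>k. 1 / real (Suc k) ^ 2)"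
      using inverse_power_summable[of 2, where 'a = real] by (subst summable_Suc_iff) (simp add: inverse_eq_divide)
  qed auto
  finally show ?thesis unfolding zeta_def by simp
qed

lemma tau2_minus1: "tau2 (-1) = 2 * zeta 3"
proof -
  have s: "summable (\<lambda>k. 1 / real (Suc k) ^ 3)"
    using inverse_power_summable[of 3, where 'a = real] by (subst summable_Suc_iff) (simp add: inverse_eq_divide)
  have "tau2 (-1) = (LBINT s:{0<..<1}. (ln s)\<^sup>2 * levy_density (-1) s)"
    unfolding tau2_conv_log_moment log_moment_def by simp
  also have "\<dots> = (\<Sum>k. 2 / real (Suc k) ^ 3)"
    by (rule geometric_integral_sums[OF power_ln_integral(3,4)]) (use summable_mult[OF s, of 2] in auto)
  also have "\<dots> = 2 * (\<Sum>k. 1 / real (Suc k) ^ 3)"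
    using suminf_mult[OF s, of 2] by simp
  finally show ?thesis unfolding zeta_def by simp
qed

section \<open>Splits along the path of a label\<close>

text \<open>The number of splits of blocks that contain \<open>u\<close>, from \<open>B\<close> on, if every block \<open>A\<close> splits into
  \<open>S A\<close> and \<open>A - S A\<close>.\<close>

function descent :: "(nat set \<Rightarrow> nat set) \<Rightarrow> nat \<Rightarrow> nat set \<Rightarrow> nat" where
  "descent S u B =
     (if finite B \<and> 2 \<le> card B \<and> S B \<noteq> {} \<and> S B \<subset> B
      then Suc (descent S u (if u \<in> S B then S B else B - S B)) else 0)"
  by auto
termination
  by (relation "Wellfounded.measure (\<lambda>(S, u, B). card B)") (auto intro!: psubset_card_mono)

declare descent.simps [simp del]

lemma frag_block_subset:
  assumes "finite B" "B \<noteq> {}" "A \<in> frag T S B t"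
  shows "A \<subseteq> B"
  using frag_partition_on[OF assms(1,2), of T S t] assms(3)
  by (auto simp: partition_on_def)

text \<open>The blocks counted by \<open>leaf_height\<close>, for a fragmentation that starts from an arbitrary
  block.\<close>

definition transient_blocks :: "(nat set \<Rightarrow> real) \<Rightarrow> (nat set \<Rightarrow> nat set) \<Rightarrow> nat \<Rightarrow> nat set \<Rightarrow> nat set set" where
  "transient_blocks T S u B =
     {A. u \<in> A \<and> (\<exists>s t. 0 \<le> s \<and> s < t \<and> A \<in> frag T S B s \<and> A \<notin> frag T S B t)}"

lemma transient_blocks_subset:
  assumes "finite B" "B \<noteq> {}" "A \<in> transient_blocks T S u B"
  shows "A \<subseteq> B"
  using frag_block_subset[OF assms(1,2)] assms(3) unfolding transient_blocks_def by blast

text \<open>After the time \<open>T B > 0\<close> at which \<open>B\<close> splits, the blocks that contain \<open>u\<close> are those of the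
  fragmentation of the half that contains \<open>u\<close>, delayed by \<open>T B\<close>; the blocks in the other half do not
  contain \<open>u\<close>. Before that time \<open>B\<close> is the only block.\<close>

lemma transient_blocks_split:
  assumes B: "finite B" "2 \<le> card B" "S B \<noteq> {}" "S B \<subset> B" and T: "0 < T B"
    and u: "u \<in> B"
  defines "X \<equiv> if u \<in> S B then S B else B - S B"
  shows "transient_blocks T S u B = insert B (transient_blocks T S u X)"
proof -
  define Y where "Y = B - X"
  have XY: "u \<in> X" "u \<notin> Y" "X \<subset> B" "Y \<subset> B" "X \<noteq> {}" "Y \<noteq> {}" "finite X" "finite Y"
    using B u finite_subset[of "S B" B] by (auto simp: X_def Y_def)
  have late: "frag T S B t = frag T S X (t - T B) \<union> frag T S Y (t - T B)" if "T B \<le> t" for t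
  proof -
    have "B - (B - S B) = S B" using B by auto
    then show ?thesis using that B by (subst frag.simps) (auto simp: X_def Y_def)
  qed
  have early: "frag T S B t = {B}" if "t < T B" for t
    using that by (subst frag.simps) auto
  have noY: "A \<notin> frag T S Y t" if "u \<in> A" for A t
    using frag_block_subset[of Y A T S t] XY that by auto
  have noB: "B \<notin> frag T S X t" for t
    using frag_block_subset[of X B T S t] XY by auto
  show ?thesis
  proof (intro set_eqI iffI)
    fix A assume A: "A \<in> transient_blocks T S u B"
    then obtain s t where st: "u \<in> A" "0 \<le> s" "s < t" "A \<in> frag T S B s" "A \<notin> frag T S B t"
      by (auto simp: transient_blocks_def)
    show "A \<in> insert B (transient_blocks T S u X)"
    proof (cases "s < T B")
      case True then show ?thesis using st early by auto
    next
      case False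
      then have "A \<in> frag T S X (s - T B)" "A \<notin> frag T S X (t - T B)"
        using st late[of s] late[of t] noY[OF st(1)] by auto
      then have "A \<in> transient_blocks T S u X"
        unfolding transient_blocks_def using st False
        by (intro CollectI conjI exI[of _ "s - T B"] exI[of _ "t - T B"]) auto
      then show ?thesis by simp
    qed
  next
    fix A assume "A \<in> insert B (transient_blocks T S u X)"
    then show "A \<in> transient_blocks T S u B"
    proof
      assume "A = B"
      moreover have "B \<in> frag T S B 0" using early[OF T] by simp
      moreover have "B \<notin> frag T S B (T B)" using late[of "T B"] noB noY[OF u] by auto
      ultimately show ?thesis using T u unfolding transient_blocks_def by blast
    next
      assume "A \<in> transient_blocks T S u X"
      then obtain s t where st: "u \<in> A" "0 \<le> s" "s < t" "A \<in> frag T S X s" "A \<notin> frag T S X t"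
        by (auto simp: transient_blocks_def)
      then have "A \<in> frag T S B (s + T B)" "A \<notin> frag T S B (t + T B)"
        using late[of "s + T B"] late[of "t + T B"] noY[OF st(1)] by auto
      then show ?thesis unfolding transient_blocks_def using st T
        by (intro CollectI conjI exI[of _ "s + T B"] exI[of _ "t + T B"]) auto
    qed
  qed
qed

lemma card_transient_blocks:
  assumes "finite B" "u \<in> B" "\<And>A. A \<subseteq> B \<Longrightarrow> 2 \<le> card A \<Longrightarrow> 0 < T A"
  shows "card (transient_blocks T S u B) = descent S u B"
  using assms
proof (induction S u B rule: descent.induct)
  case (1 S u B)
  show ?case
  proof (cases "finite B \<and> 2 \<le> card B \<and> S B \<noteq> {} \<and> S B \<subset> B")
    case True
    define X where "X = (if u \<in> S B then S B else B - S B)"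
    have X: "X \<subset> B" "u \<in> X" "finite X" "X \<noteq> {}"
      using True "1.prems"(2) finite_subset[of "S B" B] by (auto simp: X_def)
    have "transient_blocks T S u B = insert B (transient_blocks T S u X)"
      unfolding X_def using True "1.prems" by (intro transient_blocks_split) auto
    moreover have "B \<notin> transient_blocks T S u X"
      using transient_blocks_subset[OF X(3,4)] X(1) by blast
    moreover have "transient_blocks T S u X \<subseteq> Pow X"
      using transient_blocks_subset[OF X(3,4)] by blast
    then have "finite (transient_blocks T S u X)"
      by (rule finite_subset) (simp add: X)
    moreover have "card (transient_blocks T S u X) = descent S u X"
      unfolding X_def by (rule "1.IH"[OF True]) (use X "1.prems" in \<open>auto simp: X_def split: if_splits\<close>)
    ultimately show ?thesis using True by (subst descent.simps) (simp add: X_def)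
  next
    case False
    then have "frag T S B t = {B}" for t by (subst frag.simps) auto
    then show ?thesis using False by (subst descent.simps) (auto simp: transient_blocks_def)
  qed
qed

lemma leaf_height_conv_descent:
  assumes "u \<in> {1..n}" "\<And>B. B \<in> splittable n \<Longrightarrow> 0 < T B"
  shows "leaf_height n (T, S, u) = descent S u {1..n}"
proof -
  have "leaf_height n (T, S, u) = card (transient_blocks T S u {1..n})"
    unfolding leaf_height_def transient_blocks_def by (intro arg_cong[where f = card]) auto
  then show ?thesis using assms by (simp add: card_transient_blocks splittable_def)
qed

text \<open>The blocks present at time \<open>t\<close> depend on \<open>t\<close> through finitely many comparisons of the form
  \<open>r \<le> t\<close>. Hence rational times suffice to detect a split, which makes the leaf height measurable.\<close>

lemma frag_right_continuous:
  "\<exists>e>0. \<forall>s'. s \<le> s' \<and> s' < s + e \<longrightarrow> frag T S B s' = frag T S B s"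
proof (induction T S B s rule: frag.induct)
  case (1 T S B s)
  let ?c = "finite B \<and> 2 \<le> card B \<and> S B \<noteq> {} \<and> S B \<subset> B"
  consider "?c" "T B \<le> s" | "?c" "s < T B" | "\<not> ?c" by linarith
  then show ?case
  proof cases
    case 1
    then have c: "finite B \<and> 2 \<le> card B \<and> S B \<noteq> {} \<and> S B \<subset> B \<and> T B \<le> s" by blast
    from "1.IH"(1)[OF c] obtain e1 where e1: "e1 > 0"
      "\<And>s'. s - T B \<le> s' \<Longrightarrow> s' < s - T B + e1 \<Longrightarrow> frag T S (S B) s' = frag T S (S B) (s - T B)" by blast
    from "1.IH"(2)[OF c] obtain e2 where e2: "e2 > 0"
      "\<And>s'. s - T B \<le> s' \<Longrightarrow> s' < s - T B + e2 \<Longrightarrow> frag T S (B - S B) s' = frag T S (B - S B) (s - T B)" by blast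
    show ?thesis
    proof (intro exI[of _ "min e1 e2"] conjI allI impI)
      fix s' assume s': "s \<le> s' \<and> s' < s + min e1 e2"
      then have c': "finite B \<and> 2 \<le> card B \<and> S B \<noteq> {} \<and> S B \<subset> B \<and> T B \<le> s'" using c by auto
      have "s' - T B < s - T B + e1" "s' - T B < s - T B + e2" using s' by auto
      then show "frag T S B s' = frag T S B s"
        unfolding frag.simps[of T S B s'] frag.simps[of T S B s]
        using e1(2)[of "s' - T B"] e2(2)[of "s' - T B"] s' by (simp only: c c' if_True) simp
    qed (use e1 e2 in auto)
  next
    case 2
    show ?thesis
    proof (intro exI[of _ "T B - s"] conjI allI impI)
      fix s' assume s': "s \<le> s' \<and> s' < s + (T B - s)"
      then show "frag T S B s' = frag T S B s"
        unfolding frag.simps[of T S B s'] frag.simps[of T S B s] using 2 by simp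
    qed (use 2 in auto)
  next
    case 3
    then have "frag T S B s' = {B}" for s' by (subst frag.simps) auto
    then show ?thesis by (intro exI[of _ 1]) auto
  qed
qed

lemma transient_blocks_rational:
  "A \<in> transient_blocks T S u B \<longleftrightarrow>
     u \<in> A \<and> (\<exists>p q::rat. 0 \<le> p \<and> p < q \<and> A \<in> frag T S B (of_rat p) \<and> A \<notin> frag T S B (of_rat q))"
proof
  assume "A \<in> transient_blocks T S u B"
  then obtain s t where st: "u \<in> A" "0 \<le> s" "s < t" "A \<in> frag T S B s" "A \<notin> frag T S B t"
    by (auto simp: transient_blocks_def)
  obtain e1 where e1: "e1 > 0" "\<And>s'. s \<le> s' \<Longrightarrow> s' < s + e1 \<Longrightarrow> frag T S B s' = frag T S B s"
    using frag_right_continuous[of s T S B] by blast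
  obtain e2 where e2: "e2 > 0" "\<And>s'. t \<le> s' \<Longrightarrow> s' < t + e2 \<Longrightarrow> frag T S B s' = frag T S B t"
    using frag_right_continuous[of t T S B] by blast
  obtain p :: rat where p: "s < of_rat p" "of_rat p < min t (s + e1)"
    using of_rat_dense[of s "min t (s + e1)"] st(3) e1(1) by (metis less_add_same_cancel1 min_less_iff_conj)
  obtain q :: rat where q: "t < of_rat q" "of_rat q < t + e2"
    using of_rat_dense[of t "t + e2"] e2(1) by (metis less_add_same_cancel1)
  have "A \<in> frag T S B (of_rat p)" "A \<notin> frag T S B (of_rat q)"
    using st(4,5) e1(2)[of "of_rat p"] e2(2)[of "of_rat q"] p q by auto
  moreover have "(0::real) \<le> of_rat p" "(of_rat p :: real) < of_rat q" using p q st(2,3) by linarith+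
  then have "0 \<le> p" "p < q" by (simp_all add: of_rat_less)
  ultimately show "u \<in> A \<and> (\<exists>p q::rat. 0 \<le> p \<and> p < q \<and> A \<in> frag T S B (of_rat p) \<and> A \<notin> frag T S B (of_rat q))"
    using st by blast
next
  assume "u \<in> A \<and> (\<exists>p q::rat. 0 \<le> p \<and> p < q \<and> A \<in> frag T S B (of_rat p) \<and> A \<notin> frag T S B (of_rat q))"
  then obtain p q :: rat where "u \<in> A" "0 \<le> p" "p < q" "A \<in> frag T S B (of_rat p)" "A \<notin> frag T S B (of_rat q)"
    by blast
  then show "A \<in> transient_blocks T S u B"
    unfolding transient_blocks_def
    by (intro CollectI conjI exI[of _ "of_rat p"] exI[of _ "of_rat q"]) (auto simp: of_rat_less)
qed

text \<open>A split matters only if it produces a nonempty proper subset of the block, so finitely many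
  values of \<open>S B\<close> have to be distinguished, even though the splits take values in an uncountable
  type.\<close>

lemma pred_frag:
  assumes B: "finite B"
    and T: "\<And>D. D \<subseteq> B \<Longrightarrow> 2 \<le> card D \<Longrightarrow> (\<lambda>\<omega>. T \<omega> D) \<in> borel_measurable M"
    and S: "\<And>D C. D \<subseteq> B \<Longrightarrow> 2 \<le> card D \<Longrightarrow> Measurable.pred M (\<lambda>\<omega>. S \<omega> D = C)"
    and t: "t \<in> borel_measurable M"
  shows "Measurable.pred M (\<lambda>\<omega>. A \<in> frag (T \<omega>) (S \<omega>) B (t \<omega>))"
  using B T S t
proof (induction "card B" arbitrary: B t rule: less_induct)
  case less
  note fin = less.prems(1)
  show ?case
  proof (cases "2 \<le> card B")
    case False
    then have "frag (T \<omega>) (S \<omega>) B (t \<omega>) = {B}" for \<omega> by (subst frag.simps) auto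
    then show ?thesis by simp
  next
    case True
    define \<C> where "\<C> = {C. C \<noteq> {} \<and> C \<subset> B}"
    have finC: "finite \<C>" using fin by (auto simp: \<C>_def intro: finite_subset[of _ "Pow B"])
    have [measurable]: "(\<lambda>\<omega>. T \<omega> B) \<in> borel_measurable M" "t \<in> borel_measurable M"
      using less.prems(2)[OF subset_refl True] less.prems(4) by auto
    have eq: "A \<in> frag (T \<omega>) (S \<omega>) B (t \<omega>) \<longleftrightarrow>
        (\<exists>C\<in>\<C>. S \<omega> B = C \<and> T \<omega> B \<le> t \<omega> \<and>
            (A \<in> frag (T \<omega>) (S \<omega>) C (t \<omega> - T \<omega> B) \<or> A \<in> frag (T \<omega>) (S \<omega>) (B - C) (t \<omega> - T \<omega> B)))
        \<or> A = B \<and> \<not> ((\<exists>C\<in>\<C>. S \<omega> B = C) \<and> T \<omega> B \<le> t \<omega>)" for \<omega>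
      using True fin by (subst frag.simps) (auto simp: \<C>_def)
    have split: "Measurable.pred M (\<lambda>\<omega>. S \<omega> B = C \<and> T \<omega> B \<le> t \<omega> \<and>
            (A \<in> frag (T \<omega>) (S \<omega>) C (t \<omega> - T \<omega> B) \<or> A \<in> frag (T \<omega>) (S \<omega>) (B - C) (t \<omega> - T \<omega> B)))"
      if C: "C \<in> \<C>" for C
    proof -
      have IH: "Measurable.pred M (\<lambda>\<omega>. A \<in> frag (T \<omega>) (S \<omega>) X (t \<omega> - T \<omega> B))" if X: "X \<subset> B" for X
      proof (rule less.hyps)
        show "card X < card B" "finite X" using X fin by (auto intro: psubset_card_mono finite_subset)
        show "(\<lambda>\<omega>. T \<omega> D) \<in> borel_measurable M" if "D \<subseteq> X" "2 \<le> card D" for D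
          using that X by (intro less.prems(2)) auto
        show "Measurable.pred M (\<lambda>\<omega>. S \<omega> D = E)" if "D \<subseteq> X" "2 \<le> card D" for D E
          using that X by (intro less.prems(3)) auto
      qed measurable
      have [measurable]: "Measurable.pred M (\<lambda>\<omega>. A \<in> frag (T \<omega>) (S \<omega>) C (t \<omega> - T \<omega> B))"
        "Measurable.pred M (\<lambda>\<omega>. A \<in> frag (T \<omega>) (S \<omega>) (B - C) (t \<omega> - T \<omega> B))"
        using C by (auto intro!: IH simp: \<C>_def)
      have [measurable]: "Measurable.pred M (\<lambda>\<omega>. S \<omega> B = C)" by (rule less.prems(3)[OF subset_refl True])
      show ?thesis by measurable
    qed
    have "Measurable.pred M (\<lambda>\<omega>. (\<exists>C\<in>\<C>. S \<omega> B = C) \<and> T \<omega> B \<le> t \<omega>)"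
      using finC less.prems(3)[OF subset_refl True] by (intro pred_intros_logic pred_intros_finite) auto
    then have never: "Measurable.pred M (\<lambda>\<omega>. A = B \<and> \<not> ((\<exists>C\<in>\<C>. S \<omega> B = C) \<and> T \<omega> B \<le> t \<omega>))"
      by measurable
    show ?thesis
      unfolding eq by (intro pred_intros_logic(5) pred_intros_finite(4) finC split never)
  qed
qed

lemma pred_descent:
  assumes B: "finite B"
    and S: "\<And>D C. D \<subseteq> B \<Longrightarrow> 2 \<le> card D \<Longrightarrow> Measurable.pred M (\<lambda>\<omega>. S \<omega> D = C)"
  shows "Measurable.pred M (\<lambda>\<omega>. descent (S \<omega>) u B = k)"
  using B S
proof (induction "card B" arbitrary: B k rule: less_induct)
  case less
  note fin = less.prems(1)
  show ?case
  proof (cases "2 \<le> card B")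
    case False
    then have "descent (S \<omega>) u B = 0" for \<omega> by (subst descent.simps) auto
    then show ?thesis by simp
  next
    case True
    define \<C> where "\<C> = {C. C \<noteq> {} \<and> C \<subset> B}"
    have finC: "finite \<C>" using fin by (auto simp: \<C>_def intro: finite_subset[of _ "Pow B"])
    have eq: "descent (S \<omega>) u B = k \<longleftrightarrow>
        (\<exists>C\<in>\<C>. S \<omega> B = C \<and> (\<exists>i<k. k = Suc i \<and> descent (S \<omega>) u (if u \<in> C then C else B - C) = i))
        \<or> k = 0 \<and> \<not> (\<exists>C\<in>\<C>. S \<omega> B = C)" for \<omega>
      using True fin by (subst descent.simps) (auto simp: \<C>_def)
    have *: "Measurable.pred M (\<lambda>\<omega>. descent (S \<omega>) u (if u \<in> C then C else B - C) = i)" if C: "C \<in> \<C>" for C i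
    proof (rule less.hyps)
      let ?X = "if u \<in> C then C else B - C"
      have X: "?X \<subset> B" using C by (auto simp: \<C>_def)
      then show "card ?X < card B" using fin by (rule psubset_card_mono[rotated])
      show "finite ?X" using X fin by (meson finite_subset psubset_imp_subset)
      show "Measurable.pred M (\<lambda>\<omega>. S \<omega> D = E)" if "D \<subseteq> ?X" "2 \<le> card D" for D E
        using that X by (intro less.prems(2)) auto
    qed
    show ?thesis
      unfolding eq using finC less.prems(2)[OF subset_refl True] *
      by (intro pred_intros_logic pred_intros_finite pred_intros_countable) auto
  qed
qed


lemma measurable_descent:
  assumes "finite B" "\<And>D C. D \<subseteq> B \<Longrightarrow> 2 \<le> card D \<Longrightarrow> Measurable.pred M (\<lambda>\<omega>. S \<omega> D = C)"
  shows "(\<lambda>\<omega>. descent (S \<omega>) u B) \<in> measurable M (count_space UNIV)"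
proof (subst measurable_count_space_eq2_countable, intro conjI ballI)
  show "(\<lambda>\<omega>. descent (S \<omega>) u B) -` {k} \<inter> space M \<in> sets M" for k
    using predE[OF pred_descent[OF assms, where u = u and k = k]] by (simp add: vimage_def Int_def conj_commute)
qed simp_all

lemma descent_cong:
  assumes "\<And>A. A \<subseteq> B \<Longrightarrow> 2 \<le> card A \<Longrightarrow> S A = S' A"
  shows "descent S u B = descent S' u B"
  using assms
proof (induction S u B rule: descent.induct)
  case (1 S u B)
  show ?case
  proof (cases "finite B \<and> 2 \<le> card B \<and> S B \<noteq> {} \<and> S B \<subset> B")
    case True
    define X where "X = (if u \<in> S B then S B else B - S B)"
    have X: "X \<subseteq> B" using True by (auto simp: X_def)
    have "S B = S' B" using "1.prems"[of B] True by simp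
    moreover have "descent S u X = descent S' u X"
      unfolding X_def by (rule "1.IH"[OF True]) (use X "1.prems" in \<open>auto simp: X_def\<close>)
    ultimately show ?thesis using True by (subst (1 2) descent.simps) (simp add: X_def)
  next
    case False
    moreover have "\<not> (finite B \<and> 2 \<le> card B \<and> S' B \<noteq> {} \<and> S' B \<subset> B)"
      using False "1.prems"[of B] by auto
    ultimately show ?thesis
      unfolding descent.simps[of S u B] descent.simps[of S' u B] by (simp only: if_False)
  qed
qed

definition split_space :: "real \<Rightarrow> nat \<Rightarrow> (nat set \<Rightarrow> nat set) measure" where
  "split_space \<beta> n = (\<Pi>\<^sub>M B\<in>splittable n. measure_pmf (split_law \<beta> B))"

lemma finite_splittable: "finite (splittable n)"
  unfolding splittable_def by (rule finite_subset[of _ "Pow {1..n}"]) auto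

lemma pred_PiM_component:
  assumes "B \<in> I"
  shows "Measurable.pred (\<Pi>\<^sub>M B\<in>I. measure_pmf (p B)) (\<lambda>S. S B = C)"
proof -
  have "(\<lambda>S. S B) \<in> measurable (\<Pi>\<^sub>M B\<in>I. measure_pmf (p B)) (measure_pmf (p B))"
    by (rule measurable_component_singleton[where M = "\<lambda>B. measure_pmf (p B)", OF assms])
  then show ?thesis
    by (rule measurable_compose[where g = "\<lambda>x. x = C"]) simp
qed

text \<open>The characteristic function at \<open>\<theta>\<close> of the number of steps that the chain with transition
  probabilities \<open>tagged_prob \<beta>\<close> takes from \<open>m\<close> to \<open>1\<close>, defined by conditioning on the first step.\<close>

function height_char :: "real \<Rightarrow> real \<Rightarrow> nat \<Rightarrow> complex" where
  "height_char \<beta> \<theta> m =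
     (if m < 2 then 1 else iexp \<theta> * (\<Sum>j=1..<m. tagged_prob \<beta> m j *\<^sub>R height_char \<beta> \<theta> j))"
  by auto
termination by (relation "Wellfounded.measure (\<lambda>(\<beta>, \<theta>, m). m)") auto

declare height_char.simps [simp del]

lemma size_law_support:
  assumes "\<beta> > -2" "m \<ge> 2"
  shows "set_pmf (size_law \<beta> m) \<subseteq> {1..<m}"
proof
  fix i assume "i \<in> set_pmf (size_law \<beta> m)"
  then have "pmf (size_law \<beta> m) i \<noteq> 0" by (simp add: set_pmf_eq)
  then have "1 \<le> i \<and> i \<le> m - 1" unfolding pmf_size_law[OF assms] by presburger
  then show "i \<in> {1..<m}" using assms by auto
qed

text \<open>Given its size, the first block is uniform, so the law of the split is determined by the law
  of the size.\<close>

lemma map_card_split_law: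
  assumes "\<beta> > -2" "card B \<ge> 2"
  shows "map_pmf card (split_law \<beta> B) = size_law \<beta> (card B)"
proof -
  have fin: "finite B" using assms(2) card.infinite by fastforce
  have "map_pmf card (split_law \<beta> B) = bind_pmf (size_law \<beta> (card B)) return_pmf"
    unfolding split_law_def map_bind_pmf
  proof (intro bind_pmf_cong refl)
    fix i assume "i \<in> set_pmf (size_law \<beta> (card B))"
    then have "i \<le> card B" using size_law_support[OF assms] by auto
    then obtain A where "A \<subseteq> B" "card A = i" using obtain_subset_with_card_n by metis
    then have "set_pmf (pmf_of_set {A. A \<subseteq> B \<and> card A = i}) = {A. A \<subseteq> B \<and> card A = i}"
      using fin by (intro set_pmf_of_set) auto
    then have "map_pmf card (pmf_of_set {A. A \<subseteq> B \<and> card A = i}) = map_pmf (\<lambda>_. i) (pmf_of_set {A. A \<subseteq> B \<and> card A = i})"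
      by (intro map_pmf_cong) auto
    then show "map_pmf card (pmf_of_set {A. A \<subseteq> B \<and> card A = i}) = return_pmf i" by simp
  qed
  then show ?thesis by (simp add: bind_return_pmf')
qed

lemma split_law_support:
  assumes "\<beta> > -2" "card B \<ge> 2"
  shows "set_pmf (split_law \<beta> B) \<subseteq> {C. C \<noteq> {} \<and> C \<subset> B}"
proof
  fix C assume C: "C \<in> set_pmf (split_law \<beta> B)"
  have fin: "finite B" using assms(2) card.infinite by fastforce
  have "card C \<in> set_pmf (size_law \<beta> (card B))"
    using C map_card_split_law[OF assms, symmetric] by auto
  then have card: "card C \<in> {1..<card B}" using size_law_support[OF assms] by auto
  from C obtain i where i: "i \<in> set_pmf (size_law \<beta> (card B))" "C \<in> set_pmf (pmf_of_set {A. A \<subseteq> B \<and> card A = i})"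
    unfolding split_law_def by auto
  then have "i \<le> card B" using size_law_support[OF assms] by auto
  then obtain A where "A \<subseteq> B" "card A = i" using obtain_subset_with_card_n by metis
  then have "set_pmf (pmf_of_set {A. A \<subseteq> B \<and> card A = i}) = {A. A \<subseteq> B \<and> card A = i}"
    using fin by (intro set_pmf_of_set) auto
  with i have "C \<subseteq> B" by auto
  then show "C \<in> {C. C \<noteq> {} \<and> C \<subset> B}" using card by auto
qed

section \<open>The characteristic function of the leaf height\<close>

lemma descent_update:
  assumes "B \<notin> Pow X"
  shows "descent (S(B := C)) u X = descent S u X"
  using assms by (intro descent_cong) auto

lemma descent_step:
  assumes "finite B" "C \<noteq> {}" "C \<subset> B" "2 \<le> card B" "S B = C"
  shows "descent S u B = Suc (descent S u (if u \<in> C then C else B - C))"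
  using assms by (subst descent.simps) simp

text \<open>The index set is arbitrary, as long as it contains all blocks that can arise from \<open>B\<close>: the
  lemma is needed for the full family of splits and for the family without the split of one
  block.\<close>

lemma integrable_iexp_descent:
  assumes "finite B" "\<And>D. D \<subseteq> B \<Longrightarrow> 2 \<le> card D \<Longrightarrow> D \<in> I"
  shows "integrable (\<Pi>\<^sub>M D\<in>I. measure_pmf (p D)) (\<lambda>S. iexp (\<theta> * real (descent S u B)))"
proof -
  interpret product_prob_space "\<lambda>D. measure_pmf (p D)" I
    by (intro product_prob_spaceI measure_pmf.prob_space_axioms)
  have "(\<lambda>S. descent S u B) \<in> measurable (\<Pi>\<^sub>M D\<in>I. measure_pmf (p D)) (count_space UNIV)"
    by (rule measurable_descent[where S = "\<lambda>S. S", OF assms(1)]) (rule pred_PiM_component, rule assms(2))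
  then have "(\<lambda>S. iexp (\<theta> * real (descent S u B))) \<in> borel_measurable (\<Pi>\<^sub>M D\<in>I. measure_pmf (p D))"
    by (rule measurable_compose) simp
  then show ?thesis
    by (intro P.integrable_const_bound[where B = 1]) auto
qed

text \<open>The split of \<open>B\<close> is independent of the splits of all smaller blocks, and the descent below \<open>B\<close>
  depends on the latter only. Conditioning on the value \<open>C\<close> of the split of \<open>B\<close> and summing over the
  labels leads to the sums for \<open>C\<close> and for \<open>B - C\<close>, which depend only on the sizes of these sets by
  induction; the sum over the labels thereby produces the size bias.\<close>

lemma tagged_block_char:
  assumes \<beta>: "-2 < \<beta>" and B: "B \<subseteq> {1..n}" "B \<noteq> {}"
  shows "(\<Sum>u\<in>B. \<integral>S. iexp (\<theta> * real (descent S u B)) \<partial>split_space \<beta> n)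
           = of_nat (card B) * height_char \<beta> \<theta> (card B)"
  using B
proof (induction "card B" arbitrary: B rule: less_induct)
  case less
  have fin: "finite B" using less.prems finite_subset by blast
  show ?case
  proof (cases "2 \<le> card B")
    case False
    then have "card B = 1" using less.prems fin by (cases "card B") auto
    moreover have "descent S u B = 0" for S u using False by (subst descent.simps) auto
    moreover have "prob_space (split_space \<beta> n)"
      unfolding split_space_def by (intro prob_space_PiM measure_pmf.prob_space_axioms)
    ultimately show ?thesis by (simp add: height_char.simps prob_space.prob_space)
  next
    case True
    define m where "m = card B"
    define I' where "I' = splittable n - {B}"
    define \<C> where "\<C> = {C. C \<noteq> {} \<and> C \<subset> B}"
    define e where "e = (\<lambda>u X. \<integral>S. iexp (\<theta> * real (descent S u X)) \<partial>split_space \<beta> n)"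
    define G where "G = (\<lambda>i. of_nat i * height_char \<beta> \<theta> i + of_nat (m - i) * height_char \<beta> \<theta> (m - i))"
    have m: "2 \<le> m" using True by (simp add: m_def)
    have finC: "finite \<C>" using fin by (auto simp: \<C>_def intro: finite_subset[of _ "Pow B"])
    have sp: "splittable n = insert B I'" "B \<notin> I'" "finite I'"
      using True less.prems finite_splittable[of n] by (auto simp: I'_def splittable_def)
    interpret product_prob_space "\<lambda>B. measure_pmf (split_law \<beta> B)" I'
      by (intro product_prob_spaceI measure_pmf.prob_space_axioms)
    let ?P' = "\<Pi>\<^sub>M B\<in>I'. measure_pmf (split_law \<beta> B)"
    have P: "split_space \<beta> n = (\<Pi>\<^sub>M B\<in>insert B I'. measure_pmf (split_law \<beta> B))"
      by (simp only: split_space_def sp(1))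
    \<comment> \<open>Fubini: the split of B is integrated out first\<close>
    have fold: "(\<integral>S. f S \<partial>split_space \<beta> n) = (\<integral>S. \<integral>C. f (S(B := C)) \<partial>measure_pmf (split_law \<beta> B) \<partial>?P')"
      if "integrable (split_space \<beta> n) f" for f :: "_ \<Rightarrow> complex"
      unfolding P using that by (intro product_integral_insert sp) (simp add: P)
    have int: "integrable (split_space \<beta> n) (\<lambda>S. iexp (\<theta> * real (descent S u X)))" if X: "X \<subseteq> B" for u X
      unfolding split_space_def using X fin less.prems
      by (intro integrable_iexp_descent) (auto simp: splittable_def intro: finite_subset)
    \<comment> \<open>below B the split of B is irrelevant, so that it can be added to the index set again\<close>
    have rest: "(\<integral>S. iexp (\<theta> * real (descent S u X)) \<partial>?P') = e u X" if "X \<subset> B" for u X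
    proof -
      have "e u X = (\<integral>S. \<integral>C. iexp (\<theta> * real (descent (S(B := C)) u X)) \<partial>measure_pmf (split_law \<beta> B) \<partial>?P')"
        unfolding e_def using that less.prems by (intro fold int) auto
      also have "\<dots> = (\<integral>S. \<integral>C. iexp (\<theta> * real (descent S u X)) \<partial>measure_pmf (split_law \<beta> B) \<partial>?P')"
        using that by (subst descent_update) auto
      finally show ?thesis by simp
    qed
    have int': "integrable ?P' (\<lambda>S. iexp (\<theta> * real (descent S u X)))" if X: "X \<subset> B" for u X
      using X fin less.prems by (intro integrable_iexp_descent) (auto simp: I'_def splittable_def intro: finite_subset)
    have one: "e u B = iexp \<theta> * (\<Sum>C\<in>\<C>. pmf (split_law \<beta> B) C *\<^sub>R e u (if u \<in> C then C else B - C))" for u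
    proof -
      have "e u B = (\<integral>S. \<integral>C. iexp (\<theta> * real (descent (S(B := C)) u B)) \<partial>measure_pmf (split_law \<beta> B) \<partial>?P')"
        unfolding e_def using less.prems by (intro fold int) auto
      also have "\<dots> = (\<integral>S. (\<Sum>C\<in>\<C>. pmf (split_law \<beta> B) C *\<^sub>R (iexp \<theta> * iexp (\<theta> * real (descent S u (if u \<in> C then C else B - C))))) \<partial>?P')"
      proof (intro Bochner_Integration.integral_cong refl)
        fix S
        have "(\<integral>C. iexp (\<theta> * real (descent (S(B := C)) u B)) \<partial>measure_pmf (split_law \<beta> B))
            = (\<Sum>C\<in>\<C>. pmf (split_law \<beta> B) C *\<^sub>R iexp (\<theta> * real (descent (S(B := C)) u B)))"
          using split_law_support[OF \<beta> True] by (intro integral_measure_pmf finC) (auto simp: \<C>_def)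
        also have "\<dots> = (\<Sum>C\<in>\<C>. pmf (split_law \<beta> B) C *\<^sub>R (iexp \<theta> * iexp (\<theta> * real (descent S u (if u \<in> C then C else B - C)))))"
        proof (intro sum.cong refl)
          fix C assume C: "C \<in> \<C>"
          then have "descent (S(B := C)) u B = Suc (descent (S(B := C)) u (if u \<in> C then C else B - C))"
            using fin True by (intro descent_step) (auto simp: \<C>_def)
          also have "descent (S(B := C)) u (if u \<in> C then C else B - C) = descent S u (if u \<in> C then C else B - C)"
            using C by (intro descent_update) (auto simp: \<C>_def)
          finally have Suc: "descent (S(B := C)) u B = Suc (descent S u (if u \<in> C then C else B - C))" .
          have "iexp (\<theta> * real (Suc k)) = iexp \<theta> * iexp (\<theta> * real k)" for k
            by (simp add: exp_add[symmetric] algebra_simps)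
          then show "pmf (split_law \<beta> B) C *\<^sub>R iexp (\<theta> * real (descent (S(B := C)) u B))
              = pmf (split_law \<beta> B) C *\<^sub>R (iexp \<theta> * iexp (\<theta> * real (descent S u (if u \<in> C then C else B - C))))"
            unfolding Suc by (simp only:)
        qed
        finally show "(\<integral>C. iexp (\<theta> * real (descent (S(B := C)) u B)) \<partial>measure_pmf (split_law \<beta> B)) = \<dots>" .
      qed
      also have "\<dots> = (\<Sum>C\<in>\<C>. pmf (split_law \<beta> B) C *\<^sub>R (iexp \<theta> * e u (if u \<in> C then C else B - C)))"
      proof (subst Bochner_Integration.integral_sum)
        fix C assume C: "C \<in> \<C>"
        then have "(if u \<in> C then C else B - C) \<subset> B" by (auto simp: \<C>_def)
        from int'[OF this]
        show "integrable ?P' (\<lambda>S. pmf (split_law \<beta> B) C *\<^sub>R (iexp \<theta> * iexp (\<theta> * real (descent S u (if u \<in> C then C else B - C)))))"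
          by (intro integrable_scaleR_right integrable_mult_right)
      next
        show "(\<Sum>C\<in>\<C>. \<integral>S. pmf (split_law \<beta> B) C *\<^sub>R (iexp \<theta> * iexp (\<theta> * real (descent S u (if u \<in> C then C else B - C)))) \<partial>?P')
            = (\<Sum>C\<in>\<C>. pmf (split_law \<beta> B) C *\<^sub>R (iexp \<theta> * e u (if u \<in> C then C else B - C)))"
        proof (intro sum.cong refl)
          fix C assume C: "C \<in> \<C>"
          then have "(if u \<in> C then C else B - C) \<subset> B" by (auto simp: \<C>_def)
          from rest[OF this, of u]
          show "(\<integral>S. pmf (split_law \<beta> B) C *\<^sub>R (iexp \<theta> * iexp (\<theta> * real (descent S u (if u \<in> C then C else B - C)))) \<partial>?P')
            = pmf (split_law \<beta> B) C *\<^sub>R (iexp \<theta> * e u (if u \<in> C then C else B - C))"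
            by (simp only: integral_scaleR_right integral_mult_right_zero)
        qed
      qed
      finally show ?thesis by (simp add: sum_distrib_left)
    qed
    have "(\<Sum>u\<in>B. e u B) = iexp \<theta> * (\<Sum>C\<in>\<C>. pmf (split_law \<beta> B) C *\<^sub>R (\<Sum>u\<in>B. e u (if u \<in> C then C else B - C)))"
      unfolding one sum_distrib_left[symmetric] scaleR_sum_right
      by (subst sum.swap) simp
    also have "(\<Sum>C\<in>\<C>. pmf (split_law \<beta> B) C *\<^sub>R (\<Sum>u\<in>B. e u (if u \<in> C then C else B - C)))
        = (\<Sum>C\<in>\<C>. pmf (split_law \<beta> B) C *\<^sub>R G (card C))"
    proof (intro sum.cong refl)
      fix C assume C: "C \<in> \<C>"
      have Cf: "finite C" "C \<subseteq> B" "C \<noteq> {}" "B - C \<noteq> {}" using C fin finite_subset by (auto simp: \<C>_def)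
      have "C \<subset> B" "B - C \<subset> B" using C by (auto simp: \<C>_def)
      then have cards: "card C < card B" "card (B - C) < card B"
        by (auto intro!: psubset_card_mono[OF fin])
      have card_Diff: "card (B - C) = m - card C"
        using Cf by (simp add: m_def card_Diff_subset)
      have "(\<Sum>u\<in>B. e u (if u \<in> C then C else B - C))
          = (\<Sum>u\<in>C. e u C) + (\<Sum>u\<in>B - C. e u (B - C))"
        using sum.subset_diff[OF Cf(2) fin, of "\<lambda>u. e u (if u \<in> C then C else B - C)"]
        by (simp add: add.commute)
      also have "(\<Sum>u\<in>C. e u C) = of_nat (card C) * height_char \<beta> \<theta> (card C)"
        unfolding e_def using Cf less.prems by (intro less.hyps cards) auto
      also have "(\<Sum>u\<in>B - C. e u (B - C)) = of_nat (card (B - C)) * height_char \<beta> \<theta> (card (B - C))"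
        unfolding e_def using Cf less.prems by (intro less.hyps cards) auto
      finally show "pmf (split_law \<beta> B) C *\<^sub>R (\<Sum>u\<in>B. e u (if u \<in> C then C else B - C))
          = pmf (split_law \<beta> B) C *\<^sub>R G (card C)"
        by (simp only: G_def card_Diff)
    qed
    also have "\<dots> = (\<integral>C. G (card C) \<partial>measure_pmf (split_law \<beta> B))"
      using split_law_support[OF \<beta> True] by (intro integral_measure_pmf[symmetric] finC) (auto simp: \<C>_def)
    also have "\<dots> = (\<integral>i. G i \<partial>measure_pmf (size_law \<beta> m))"
      unfolding m_def map_card_split_law[OF \<beta> True, symmetric] by simp
    also have "\<dots> = (\<Sum>i=1..<m. pmf (size_law \<beta> m) i *\<^sub>R G i)"
      using size_law_support[OF \<beta> m] by (intro integral_measure_pmf) auto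
    also have "\<dots> = (\<Sum>i=1..<m. split_prob \<beta> m i *\<^sub>R G i)"
      using pmf_size_law[OF \<beta> m] by (intro sum.cong refl) auto
    also have "\<dots> = of_nat m * (\<Sum>j=1..<m. tagged_prob \<beta> m j *\<^sub>R height_char \<beta> \<theta> j)"
      unfolding tagged_prob_sum sum_distrib_left
    proof (intro sum.cong refl)
      fix i
      have "of_nat m * ((real k / real m) *\<^sub>R x) = of_nat k * x" for k and x :: complex
        using m by (simp add: scaleR_conv_of_real)
      then show "split_prob \<beta> m i *\<^sub>R G i = of_nat m * split_prob \<beta> m i *\<^sub>R
          ((real i / real m) *\<^sub>R height_char \<beta> \<theta> i + (real (m - i) / real m) *\<^sub>R height_char \<beta> \<theta> (m - i))"
        by (simp only: G_def mult_scaleR_right distrib_left)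
    qed
    finally show ?thesis
      using m unfolding e_def m_def[symmetric] by (subst height_char.simps) (simp add: mult_ac)
  qed
qed


lemma AE_exponential_pos:
  assumes "0 < r"
  shows "AE x in density lborel (exponential_density r). 0 < x"
proof -
  have "AE x in lborel. x \<noteq> (0::real)" by (rule AE_lborel_singleton)
  then show ?thesis
    by (subst AE_density) (auto simp: exponential_density_def erlang_density_def split: if_splits)
qed

locale uniform_leaf =
  fixes \<beta> :: real and n :: nat
  assumes \<beta>: "-2 < \<beta>" and n: "1 \<le> n"
begin

abbreviation "waits \<equiv> (\<Pi>\<^sub>M B\<in>splittable n. density lborel (exponential_density (phi \<beta> (real (card B) - 1))))"
abbreviation "label_law \<equiv> uniform_count_measure {1..n}"

lemma rate_pos: "B \<in> splittable n \<Longrightarrow> 0 < phi \<beta> (real (card B) - 1)"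
  using phi_nat(2)[OF \<beta>] by (simp add: splittable_def)

lemma tree_space_eq: "tree_space \<beta> n = waits \<Otimes>\<^sub>M (split_space \<beta> n \<Otimes>\<^sub>M label_law)"
  by (simp add: tree_space_def split_space_def)

lemma prob_space_waits: "prob_space waits"
  by (intro prob_space_PiM prob_space_exponential_density rate_pos)

lemma prob_space_splits: "prob_space (split_space \<beta> n)"
  unfolding split_space_def by (intro prob_space_PiM measure_pmf.prob_space_axioms)

lemma prob_space_label: "prob_space label_law"
  using n by (intro prob_space_uniform_count_measure) auto

lemma prob_space_tree: "prob_space (tree_space \<beta> n)"
  unfolding tree_space_eq by (intro prob_space_pair prob_space_waits prob_space_splits prob_space_label)

lemma measurable_label:
  "g \<in> measurable label_law (count_space UNIV)"
  by (simp add: measurable_def space_uniform_count_measure sets_uniform_count_measure)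

lemma pred_tree_split:
  assumes "D \<in> splittable n"
  shows "Measurable.pred (tree_space \<beta> n) (\<lambda>\<omega>. fst (snd \<omega>) D = C)"
  unfolding tree_space_eq split_space_def
  by (rule measurable_compose[OF measurable_compose[OF measurable_snd measurable_fst] pred_PiM_component[OF assms]])

lemma measurable_tree_wait:
  assumes "D \<in> splittable n"
  shows "(\<lambda>\<omega>. fst \<omega> D) \<in> borel_measurable (tree_space \<beta> n)"
proof -
  have "(\<lambda>T. T D) \<in> borel_measurable waits"
    using measurable_component_singleton[OF assms, of "\<lambda>B. density lborel (exponential_density (phi \<beta> (real (card B) - 1)))"]
    by simp
  then show ?thesis
    unfolding tree_space_eq by (rule measurable_compose[OF measurable_fst])
qed

lemma pred_tree_transient:
  "Measurable.pred (tree_space \<beta> n) (\<lambda>\<omega>. A \<in> transient_blocks (fst \<omega>) (fst (snd \<omega>)) (snd (snd \<omega>)) {1..n})"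
proof -
  have [measurable]: "Measurable.pred (tree_space \<beta> n) (\<lambda>\<omega>. A \<in> frag (fst \<omega>) (fst (snd \<omega>)) {1..n} t)" for t
    by (rule pred_frag) (auto intro!: measurable_tree_wait pred_tree_split simp: splittable_def)
  have [measurable]: "Measurable.pred (tree_space \<beta> n) (\<lambda>\<omega>. snd (snd \<omega>) \<in> A)"
    unfolding tree_space_eq
    by (rule measurable_compose[OF measurable_compose[OF measurable_snd measurable_snd] measurable_label])
  show ?thesis unfolding transient_blocks_rational by measurable
qed

lemma measurable_leaf_height: "leaf_height n \<in> measurable (tree_space \<beta> n) (count_space UNIV)"
proof -
  have eq: "leaf_height n = (\<lambda>\<omega>. \<Sum>A\<in>Pow {1..n}. if A \<in> transient_blocks (fst \<omega>) (fst (snd \<omega>)) (snd (snd \<omega>)) {1..n} then 1 else 0)"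
  proof
    fix \<omega> :: sample
    obtain T S u where \<omega>: "\<omega> = (T, S, u)" by (cases \<omega>)
    have "transient_blocks T S u {1..n} \<subseteq> Pow {1..n}"
    proof -
      have "finite {1..n}" "{1..n} \<noteq> {}" using n by auto
      from transient_blocks_subset[OF this] show ?thesis by blast
    qed
    moreover have "leaf_height n \<omega> = card (transient_blocks T S u {1..n})"
      unfolding leaf_height_def transient_blocks_def \<omega> by (intro arg_cong[where f = card]) auto
    ultimately show "leaf_height n \<omega> = (\<Sum>A\<in>Pow {1..n}. if A \<in> transient_blocks (fst \<omega>) (fst (snd \<omega>)) (snd (snd \<omega>)) {1..n} then 1 else 0)"
      by (simp add: \<omega> sum.If_cases Int_absorb1)
  qed
  note [measurable] = pred_tree_transient
  show ?thesis unfolding eq by measurable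
qed

lemma AE_leaf_height:
  "AE \<omega> in tree_space \<beta> n. leaf_height n \<omega> = descent (fst (snd \<omega>)) (snd (snd \<omega>)) {1..n}"
proof -
  have ae: "AE T in waits. \<forall>B\<in>splittable n. 0 < T B"
    by (intro eventually_ball_finite finite_splittable ballI
        AE_PiM_component[where M = "\<lambda>B. density lborel (exponential_density (phi \<beta> (real (card B) - 1)))"]
        AE_exponential_pos rate_pos prob_space_exponential_density)
  have marginal: "distr (tree_space \<beta> n) waits fst = waits"
    unfolding tree_space_eq
    by (intro prob_space.distr_pair_fst prob_space_pair prob_space_splits prob_space_label)
  have "fst \<in> measurable (tree_space \<beta> n) waits"
    unfolding tree_space_eq by (rule measurable_fst)
  then have "AE \<omega> in tree_space \<beta> n. \<forall>B\<in>splittable n. 0 < fst \<omega> B"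
    by (rule AE_distrD) (subst marginal, rule ae)
  moreover have "AE \<omega> in tree_space \<beta> n. \<omega> \<in> space (tree_space \<beta> n)" by simp
  ultimately show ?thesis
  proof eventually_elim
    case (elim \<omega>)
    have "snd (snd \<omega>) \<in> {1..n}"
      using elim(2) by (auto simp: tree_space_eq space_pair_measure space_uniform_count_measure)
    then show ?case
      using leaf_height_conv_descent[of "snd (snd \<omega>)" n "fst \<omega>" "fst (snd \<omega>)"] elim(1) by simp
  qed
qed

theorem leaf_height_char:
  "(\<integral>\<omega>. iexp (\<theta> * real (leaf_height n \<omega>)) \<partial>tree_space \<beta> n) = height_char \<beta> \<theta> n"
proof -
  let ?f = "\<lambda>z. iexp (\<theta> * real (descent (fst z) (snd z) {1..n}))"
  let ?N = "split_space \<beta> n \<Otimes>\<^sub>M label_law"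
  interpret N: prob_space ?N by (intro prob_space_pair prob_space_splits prob_space_label)
  interpret S: prob_space "split_space \<beta> n" by (rule prob_space_splits)
  interpret U: prob_space label_law by (rule prob_space_label)
  interpret pair_sigma_finite "split_space \<beta> n" label_law ..
  have desc: "(\<lambda>z. descent (fst z) (snd z) {1..n}) \<in> measurable ?N (count_space UNIV)"
  proof -
    have 1: "(\<lambda>z. descent (fst z) u {1..n}) \<in> measurable ?N (count_space UNIV)" for u
    proof (rule measurable_descent)
      show "Measurable.pred ?N (\<lambda>z. fst z D = C)" if "D \<subseteq> {1..n}" "2 \<le> card D" for D C
        unfolding split_space_def
        by (rule measurable_compose[OF measurable_fst pred_PiM_component]) (use that in \<open>simp add: splittable_def\<close>)
    qed simp
    have 2: "snd \<in> measurable ?N (count_space UNIV)"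
      by (rule measurable_compose[OF measurable_snd measurable_label])
    show ?thesis by (rule measurable_compose_countable[OF 1 2])
  qed
  have f: "?f \<in> borel_measurable ?N"
    by (rule measurable_compose[OF desc]) simp
  have int: "integrable ?N ?f" using f by (intro N.integrable_const_bound[where B = 1]) auto
  have lh: "(\<lambda>\<omega>. iexp (\<theta> * real (leaf_height n \<omega>))) \<in> borel_measurable (tree_space \<beta> n)"
    by (rule measurable_compose[OF measurable_leaf_height]) simp
  have snd: "snd \<in> measurable (tree_space \<beta> n) ?N" by (simp add: tree_space_eq)
  have "(\<integral>\<omega>. iexp (\<theta> * real (leaf_height n \<omega>)) \<partial>tree_space \<beta> n) = (\<integral>\<omega>. ?f (snd \<omega>) \<partial>tree_space \<beta> n)"
  proof (rule integral_cong_AE[OF lh measurable_compose[OF snd f]])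
    show "AE \<omega> in tree_space \<beta> n. iexp (\<theta> * real (leaf_height n \<omega>)) = ?f (snd \<omega>)"
      using AE_leaf_height by eventually_elim simp
  qed
  also have "\<dots> = (\<integral>z. ?f z \<partial>?N)"
  proof -
    interpret W: prob_space waits by (rule prob_space_waits)
    interpret WN: pair_sigma_finite waits ?N ..
    interpret T: prob_space "waits \<Otimes>\<^sub>M ?N" by (intro prob_space_pair prob_space_waits N.prob_space_axioms)
    have "integrable (waits \<Otimes>\<^sub>M ?N) (\<lambda>\<omega>. ?f (snd \<omega>))"
      using measurable_compose[OF snd f, unfolded tree_space_eq]
      by (intro T.integrable_const_bound[where B = 1]) auto
    from WN.integral_fst'[OF this] show ?thesis by (simp add: tree_space_eq W.prob_space)
  qed
  also have "(\<integral>z. ?f z \<partial>?N) = (\<integral>S. \<integral>u. iexp (\<theta> * real (descent S u {1..n})) \<partial>label_law \<partial>split_space \<beta> n)"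
    using integral_fst'[OF int] by simp
  also have "\<dots> = (\<integral>S. (\<Sum>u\<in>{1..n}. (1 / real n) *\<^sub>R iexp (\<theta> * real (descent S u {1..n}))) \<partial>split_space \<beta> n)"
    unfolding uniform_count_measure_def by (subst lebesgue_integral_point_measure_finite) auto
  also have "\<dots> = (1 / real n) *\<^sub>R (\<Sum>u\<in>{1..n}. \<integral>S. iexp (\<theta> * real (descent S u {1..n})) \<partial>split_space \<beta> n)"
  proof -
    have "integrable (split_space \<beta> n) (\<lambda>S. iexp (\<theta> * real (descent S u {1..n})))" for u
      unfolding split_space_def by (intro integrable_iexp_descent) (auto simp: splittable_def)
    then show ?thesis
      by (subst Bochner_Integration.integral_sum) (auto simp: scaleR_sum_right)
  qed
  also have "\<dots> = height_char \<beta> \<theta> n"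
    using tagged_block_char[OF \<beta> subset_refl, of n \<theta>] n by (simp add: scaleR_conv_of_real)
  finally show ?thesis .
qed

end

section \<open>The central limit theorems\<close>

locale beta_chain =
  fixes \<beta> :: real
  assumes \<beta>: "-1 \<le> \<beta>"
begin

sublocale descending_chain "tagged_prob \<beta>" "\<lambda>m. ln (real m)"
proof
  show "filterlim (\<lambda>m. ln (real m)) at_top sequentially" by real_asymp
qed (use \<beta> tagged_prob_nonneg tagged_prob_stochastic in auto)

definition rate :: "nat \<Rightarrow> real" where
  "rate m = phi \<beta> (real m - 1)"

text \<open>The factor \<open>rate m\<close> makes this a moment per unit of time for the chain in continuous time; this
  normalisation has a limit for every \<open>k \<ge> 1\<close>, also when the rate is unbounded.\<close>

definition log_step :: "nat \<Rightarrow> nat \<Rightarrow> real" where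
  "log_step k m = rate m * step_mean m (\<lambda>j. (ln (real m) - ln (real j)) ^ k)"

lemma rate_pos: "2 \<le> m \<Longrightarrow> 0 < rate m"
  unfolding rate_def using phi_nat(2)[of \<beta> m] \<beta> by simp

lemma log_step_rate:
  assumes "1 \<le> k"
  shows "\<exists>C. \<forall>m\<ge>2. \<bar>log_step k m - log_moment \<beta> k\<bar> \<le> C / sqrt m"
  using step_log_moments[OF \<beta> assms] by (simp add: log_step_def rate_def step_mean_def)

lemma log_step_tendsto:
  assumes "1 \<le> k"
  shows "log_step k \<longlonglongrightarrow> log_moment \<beta> k"
proof -
  obtain C where C: "\<And>m. 2 \<le> m \<Longrightarrow> \<bar>log_step k m - log_moment \<beta> k\<bar> \<le> C / sqrt m"
    using log_step_rate[OF assms] by blast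
  have "(\<lambda>m. C / sqrt (real m)) \<longlonglongrightarrow> 0" by real_asymp
  then have "(\<lambda>m. log_step k m - log_moment \<beta> k) \<longlonglongrightarrow> 0"
    by (rule Lim_null_comparison[rotated]) (use C in \<open>auto simp: eventually_sequentially\<close>)
  then show ?thesis by (rule LIM_zero_cancel)
qed

lemma drift_eq: "2 \<le> m \<Longrightarrow> drift m = log_step 1 m / rate m"
  using rate_pos[of m] by (simp add: drift_def log_step_def)

lemma step_mean_poly:
  assumes "2 \<le> m"
  defines "D \<equiv> \<lambda>j. ln (real m) - ln (real j)"
  shows "step_mean m (\<lambda>j. a0 + a1 * D j ^ 1 + a2 * D j ^ 2 + a3 * D j ^ 3 + a4 * D j ^ 4)
     = (a0 * rate m + a1 * log_step 1 m + a2 * log_step 2 m + a3 * log_step 3 m + a4 * log_step 4 m) / rate m"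
proof -
  have d: "step_mean m (\<lambda>j. D j ^ k) = log_step k m / rate m" for k
    using rate_pos[OF assms(1)] by (simp add: log_step_def D_def)
  show ?thesis
    unfolding step_mean_add step_mean_mult step_mean_const[OF assms(1)] d
    using rate_pos[OF assms(1)] by (simp add: add_divide_distrib)
qed

lemma D_bounds:
  assumes "j \<in> {1..<m}"
  shows "0 \<le> ln (real m) - ln (real j)" "ln (real m) - ln (real j) \<le> ln (real m)"
  using assms by auto

lemma height_char_1: "height_char \<beta> u 1 = 1"
  by (subst height_char.simps) simp

lemma height_char_step:
  "2 \<le> m \<Longrightarrow> height_char \<beta> u m = iexp u * step_mean m (height_char \<beta> u)"
  by (subst height_char.simps) (simp add: step_mean_def)

lemma mu_eq: "mu \<beta> = log_moment \<beta> 1" and tau2_eq: "tau2 \<beta> = log_moment \<beta> 2"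
  by (rule mu_conv_log_moment, rule tau2_conv_log_moment)

lemma mu_pos: "0 < mu \<beta>" and tau2_pos: "0 < tau2 \<beta>"
  unfolding mu_eq tau2_eq using log_moment_pos[OF \<beta>] by auto

end

text \<open>Here \<open>rate\<close> tends to \<open>phi_inf \<beta>\<close>, the drift of \<open>ln m\<close> tends to \<open>mu \<beta> / phi_inf \<beta>\<close>, and with
  \<open>D\<close> the decrease of \<open>ln m\<close> in one step, \<open>\<sigma>\<close> is such that the mean of \<open>(1 - a * D)\<^sup>2 - \<sigma> * D\<close> tends to
  \<open>0\<close>. The first-order error has to be of smaller order than \<open>1 / sqrt (ln m)\<close>; this is where the rates of
  convergence of \<open>rate m\<close> and \<open>log_step 1 m\<close> are needed.\<close>

lemma height_char_limit_gt:
  fixes \<beta> t :: real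
  assumes gt: "-1 < \<beta>"
  defines "\<sigma> \<equiv> (phi_inf \<beta>)\<^sup>2 * tau2 \<beta> / (mu \<beta>) ^ 3 - phi_inf \<beta> / mu \<beta>"
    and "a \<equiv> phi_inf \<beta> / mu \<beta>"
  shows "(\<lambda>n. height_char \<beta> (t / sqrt (\<sigma> * ln (real n))) n
            * iexp (- (t / sqrt (\<sigma> * ln (real n)) * (a * ln (real n))))) \<longlonglongrightarrow> of_real (exp (- t\<^sup>2 / 2))"
proof -
  interpret beta_chain \<beta> using gt by unfold_locales simp
  have inf: "phi_inf \<beta> = log_moment \<beta> 0" using log_moment_0[OF gt] by simp
  have inf_pos: "0 < phi_inf \<beta>" unfolding inf using gt by (intro log_moment_pos) auto
  have a: "0 < a" using inf_pos mu_pos by (simp add: a_def)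
  have "(mu \<beta>)\<^sup>2 < phi_inf \<beta> * tau2 \<beta>"
    unfolding mu_eq tau2_eq inf using log_moment_variance_pos[OF gt] .
  then have "0 < phi_inf \<beta> * (phi_inf \<beta> * tau2 \<beta> - (mu \<beta>)\<^sup>2) / (mu \<beta>) ^ 3"
    using inf_pos mu_pos by (intro divide_pos_pos mult_pos_pos) auto
  also have "\<dots> = \<sigma>" unfolding \<sigma>_def using mu_pos by (simp add: field_simps power2_eq_square power3_eq_cube)
  finally have \<sigma>: "0 < \<sigma>" .
  define L where "L = (\<lambda>m. ln (real m))"
  define y where "y = (\<lambda>m. L m powr (- (1/2)))"
  have L_pos: "0 < L m" if "2 \<le> m" for m using that by (simp add: L_def)
  have y: "y \<longlonglongrightarrow> 0" unfolding y_def L_def by real_asymp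
  obtain C e where Ce: "0 < e" "\<And>m. 2 \<le> m \<Longrightarrow> \<bar>phi_inf \<beta> - rate m\<bar> \<le> C * (real m - 1) powr (- e)"
    using phi_inf_rate[OF gt] unfolding rate_def by blast
  obtain C1 where C1: "\<And>m. 2 \<le> m \<Longrightarrow> \<bar>log_step 1 m - mu \<beta>\<bar> \<le> C1 / sqrt m"
    using log_step_rate[of 1] unfolding mu_eq by blast
  have rate_err: "(\<lambda>m. sqrt (L m) * (rate m - phi_inf \<beta>)) \<longlonglongrightarrow> 0"
  proof (rule Lim_null_comparison)
    show "(\<lambda>m. C * (sqrt (L m) * (real m - 1) powr (- e))) \<longlonglongrightarrow> 0"
      unfolding L_def using Ce(1) by real_asymp
    show "\<forall>\<^sub>F m in sequentially. norm (sqrt (L m) * (rate m - phi_inf \<beta>)) \<le> C * (sqrt (L m) * (real m - 1) powr (- e))"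
      using eventually_ge_at_top[of 2]
    proof eventually_elim
      case (elim m)
      then show ?case using mult_left_mono[OF Ce(2)[OF elim], of "sqrt (L m)"] L_pos[OF elim]
        by (simp add: abs_mult abs_minus_commute mult_ac)
    qed
  qed
  have mu_err: "(\<lambda>m. sqrt (L m) * (log_step 1 m - mu \<beta>)) \<longlonglongrightarrow> 0"
  proof (rule Lim_null_comparison)
    show "(\<lambda>m. C1 * (sqrt (L m) / sqrt (real m))) \<longlonglongrightarrow> 0"
      unfolding L_def by real_asymp
    show "\<forall>\<^sub>F m in sequentially. norm (sqrt (L m) * (log_step 1 m - mu \<beta>)) \<le> C1 * (sqrt (L m) / sqrt (real m))"
      using eventually_ge_at_top[of 2]
    proof eventually_elim
      case (elim m)
      then show ?case using mult_left_mono[OF C1[OF elim], of "sqrt (L m)"] L_pos[OF elim]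
        by (simp add: abs_mult mult_ac)
    qed
  qed
  have "(\<lambda>m. y m * (sqrt (L m) * (rate m - phi_inf \<beta>)) + phi_inf \<beta>) \<longlonglongrightarrow> 0 * 0 + phi_inf \<beta>"
    by (intro tendsto_intros y rate_err)
  moreover have "\<forall>\<^sub>F m in sequentially. y m * (sqrt (L m) * (rate m - phi_inf \<beta>)) + phi_inf \<beta> = rate m"
    using eventually_ge_at_top[of 2]
  proof eventually_elim
    case (elim m)
    have "y m * sqrt (L m) = 1" using L_pos[OF elim] by (simp add: y_def powr_half_sqrt[symmetric] powr_add[symmetric])
    then show ?case by (simp add: mult.assoc[symmetric])
  qed
  ultimately have rate: "rate \<longlonglongrightarrow> phi_inf \<beta>" by (auto dest: Lim_transform_eventually)
  note S = log_step_tendsto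
  have S1: "log_step 1 \<longlonglongrightarrow> mu \<beta>" and S2: "log_step 2 \<longlonglongrightarrow> tau2 \<beta>"
    using S[of 1] S[of 2] by (simp_all add: mu_eq tau2_eq)
  have lim: "(\<lambda>n. height_char \<beta> (t / sqrt (\<sigma> * ln (real n) ^ 1)) n
            * iexp (- (t / sqrt (\<sigma> * ln (real n) ^ 1) * (a * ln (real n))))) \<longlonglongrightarrow> of_real (exp (- t\<^sup>2 / 2))"
  proof (rule char_fun_asymptotics[where F = "height_char \<beta>" and h = "\<lambda>m. a * ln (real m)" and c = 1])
    show "(\<lambda>m. \<bar>step_mean m (\<lambda>j. 1 - (a * ln (real m) - a * ln (real j)))\<bar> / (ln (real m) powr (real 1 / 2 - 1) * drift m)) \<longlonglongrightarrow> 0"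
    proof (rule Lim_transform_eventually)
      show "(\<lambda>m. \<bar>sqrt (L m) * (rate m - phi_inf \<beta>) - a * (sqrt (L m) * (log_step 1 m - mu \<beta>))\<bar> / log_step 1 m) \<longlonglongrightarrow> 0"
        by (rule tendsto_eq_intros rate_err mu_err S1 refl | use mu_pos in simp)+
      show "\<forall>\<^sub>F m in sequentially. \<bar>sqrt (L m) * (rate m - phi_inf \<beta>) - a * (sqrt (L m) * (log_step 1 m - mu \<beta>))\<bar> / log_step 1 m
          = \<bar>step_mean m (\<lambda>j. 1 - (a * ln (real m) - a * ln (real j)))\<bar> / (ln (real m) powr (real 1 / 2 - 1) * drift m)"
        using eventually_ge_at_top[of 2]
      proof eventually_elim
        case (elim m)
        have "step_mean m (\<lambda>j. 1 - (a * ln (real m) - a * ln (real j))) = (rate m - a * log_step 1 m) / rate m"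
          using step_mean_poly[OF elim, of 1 "-a" 0 0 0] by (simp add: algebra_simps)
        moreover have "sqrt (L m) * (rate m - phi_inf \<beta>) - a * (sqrt (L m) * (log_step 1 m - mu \<beta>)) = sqrt (L m) * (rate m - a * log_step 1 m)"
          using mu_pos by (simp add: a_def field_simps)
        moreover have "ln (real m) powr (real 1 / 2 - 1) = 1 / sqrt (L m)"
          using L_pos[OF elim] by (simp add: L_def powr_half_sqrt[symmetric] powr_minus_divide)
        ultimately show ?case
          using rate_pos[OF elim] L_pos[OF elim] by (simp add: drift_eq[OF elim] abs_mult abs_divide)
      qed
    qed
    show "(\<lambda>m. \<bar>step_mean m (\<lambda>j. (1 - (a * ln (real m) - a * ln (real j)))\<^sup>2 - (\<sigma> * ln (real m) ^ 1 - \<sigma> * ln (real j) ^ 1))\<bar>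
         / (ln (real m) powr (real 1 - 1) * drift m)) \<longlonglongrightarrow> 0"
    proof (rule Lim_transform_eventually)
      have "\<bar>phi_inf \<beta> - (2 * a + \<sigma>) * mu \<beta> + a\<^sup>2 * tau2 \<beta>\<bar> / mu \<beta> = 0"
        using mu_pos by (simp add: a_def \<sigma>_def field_simps power2_eq_square power3_eq_cube)
      moreover have "(\<lambda>m. \<bar>rate m - (2 * a + \<sigma>) * log_step 1 m + a\<^sup>2 * log_step 2 m\<bar> / log_step 1 m)
          \<longlonglongrightarrow> \<bar>phi_inf \<beta> - (2 * a + \<sigma>) * mu \<beta> + a\<^sup>2 * tau2 \<beta>\<bar> / mu \<beta>"
        by (intro tendsto_intros rate S1 S2) (use mu_pos in simp)
      ultimately show "(\<lambda>m. \<bar>rate m - (2 * a + \<sigma>) * log_step 1 m + a\<^sup>2 * log_step 2 m\<bar> / log_step 1 m) \<longlonglongrightarrow> 0"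
        by (simp only:)
      show "\<forall>\<^sub>F m in sequentially. \<bar>rate m - (2 * a + \<sigma>) * log_step 1 m + a\<^sup>2 * log_step 2 m\<bar> / log_step 1 m
          = \<bar>step_mean m (\<lambda>j. (1 - (a * ln (real m) - a * ln (real j)))\<^sup>2 - (\<sigma> * ln (real m) ^ 1 - \<sigma> * ln (real j) ^ 1))\<bar>
         / (ln (real m) powr (real 1 - 1) * drift m)"
        using eventually_ge_at_top[of 2]
      proof eventually_elim
        case (elim m)
        have "step_mean m (\<lambda>j. (1 - (a * ln (real m) - a * ln (real j)))\<^sup>2 - (\<sigma> * ln (real m) ^ 1 - \<sigma> * ln (real j) ^ 1))
            = step_mean m (\<lambda>j. 1 + (- (2 * a + \<sigma>)) * (ln (real m) - ln (real j)) ^ 1 + a\<^sup>2 * (ln (real m) - ln (real j)) ^ 2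
                + 0 * (ln (real m) - ln (real j)) ^ 3 + 0 * (ln (real m) - ln (real j)) ^ 4)"
          by (intro step_mean_cong) (simp add: power2_eq_square algebra_simps)
        also have "\<dots> = (rate m - (2 * a + \<sigma>) * log_step 1 m + a\<^sup>2 * log_step 2 m) / rate m"
          unfolding step_mean_poly[OF elim] by (simp add: algebra_simps)
        finally show ?case
          using rate_pos[OF elim] L_pos[OF elim] by (simp add: drift_eq[OF elim] abs_divide L_def)
      qed
    qed
    \<comment> \<open>rate m times the mean of the cubic polynomial in D that bounds the third-order error\<close>
    define B3 where "B3 = (\<lambda>m. rate m + (3 * a + \<sigma>) * log_step 1 m + (3 * a\<^sup>2 + a * \<sigma>) * log_step 2 m + a ^ 3 * log_step 3 m)"
    show "(\<lambda>m. step_mean m (\<lambda>j. \<bar>1 - (a * ln (real m) - a * ln (real j))\<bar> ^ 3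
          + \<bar>1 - (a * ln (real m) - a * ln (real j))\<bar> * (\<sigma> * ln (real m) ^ 1 - \<sigma> * ln (real j) ^ 1))
         / (ln (real m) powr (real (3 * 1) / 2 - 1) * drift m)) \<longlonglongrightarrow> 0"
    proof (rule Lim_null_comparison)
      have "B3 \<longlonglongrightarrow> phi_inf \<beta> + (3 * a + \<sigma>) * mu \<beta> + (3 * a\<^sup>2 + a * \<sigma>) * tau2 \<beta> + a ^ 3 * log_moment \<beta> 3"
        unfolding B3_def by (intro tendsto_intros rate S1 S2 S) simp
      from tendsto_divide[OF tendsto_mult[OF y this] S1]
      show "(\<lambda>m. y m * B3 m / log_step 1 m) \<longlonglongrightarrow> 0" using mu_pos by simp
      show "\<forall>\<^sub>F m in sequentially. norm (step_mean m (\<lambda>j. \<bar>1 - (a * ln (real m) - a * ln (real j))\<bar> ^ 3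
          + \<bar>1 - (a * ln (real m) - a * ln (real j))\<bar> * (\<sigma> * ln (real m) ^ 1 - \<sigma> * ln (real j) ^ 1))
         / (ln (real m) powr (real (3 * 1) / 2 - 1) * drift m)) \<le> y m * B3 m / log_step 1 m"
        using eventually_ge_at_top[of 2]
      proof eventually_elim
        case (elim m)
        let ?f = "\<lambda>j. \<bar>1 - (a * ln (real m) - a * ln (real j))\<bar> ^ 3
          + \<bar>1 - (a * ln (real m) - a * ln (real j))\<bar> * (\<sigma> * ln (real m) ^ 1 - \<sigma> * ln (real j) ^ 1)"
        have "step_mean m ?f \<le> step_mean m (\<lambda>j. 1 + (3 * a + \<sigma>) * (ln (real m) - ln (real j)) ^ 1
              + (3 * a\<^sup>2 + a * \<sigma>) * (ln (real m) - ln (real j)) ^ 2 + a ^ 3 * (ln (real m) - ln (real j)) ^ 3 + 0 * (ln (real m) - ln (real j)) ^ 4)"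
        proof (rule step_mean_mono[OF elim])
          fix j assume j: "j \<in> {1..<m}"
          define D where "D = ln (real m) - ln (real j)"
          have D: "0 \<le> D" using D_bounds[OF j] by (simp add: D_def)
          have 1: "\<bar>1 - a * D\<bar> \<le> 1 + a * D" using a D by (auto simp: abs_if)
          have "\<bar>1 - a * D\<bar> ^ 3 + \<bar>1 - a * D\<bar> * (\<sigma> * D) \<le> (1 + a * D) ^ 3 + (1 + a * D) * (\<sigma> * D)"
            using 1 \<sigma> D by (intro add_mono power_mono mult_right_mono) auto
          also have "\<dots> = 1 + (3 * a + \<sigma>) * D ^ 1 + (3 * a\<^sup>2 + a * \<sigma>) * D ^ 2 + a ^ 3 * D ^ 3 + 0 * D ^ 4"
            by (simp add: power2_eq_square power3_eq_cube algebra_simps)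
          finally show "?f j \<le> 1 + (3 * a + \<sigma>) * (ln (real m) - ln (real j)) ^ 1
              + (3 * a\<^sup>2 + a * \<sigma>) * (ln (real m) - ln (real j)) ^ 2 + a ^ 3 * (ln (real m) - ln (real j)) ^ 3 + 0 * (ln (real m) - ln (real j)) ^ 4"
            by (simp add: D_def right_diff_distrib)
        qed
        also have "\<dots> = B3 m / rate m"
          unfolding step_mean_poly[OF elim] B3_def by simp
        finally have le: "step_mean m ?f \<le> B3 m / rate m" .
        have "0 \<le> step_mean m ?f"
          using D_bounds a \<sigma> by (intro step_mean_nonneg[OF elim] add_nonneg_nonneg mult_nonneg_nonneg) auto
        have dr: "0 < drift m" by (rule drift_pos[OF elim])
        have S1m: "0 < log_step 1 m" using dr rate_pos[OF elim] by (simp add: drift_eq[OF elim] zero_less_divide_iff)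
        have "norm (step_mean m ?f / (ln (real m) powr (real (3 * 1) / 2 - 1) * drift m))
            = step_mean m ?f * y m / drift m"
          using \<open>0 \<le> step_mean m ?f\<close> dr L_pos[OF elim] by (simp add: y_def L_def powr_minus_divide)
        also have "\<dots> \<le> B3 m / rate m * y m / drift m"
          using le dr by (intro divide_right_mono mult_right_mono) (auto simp: y_def)
        also have "\<dots> = y m * B3 m / log_step 1 m"
          using rate_pos[OF elim] S1m by (simp add: drift_eq[OF elim])
        finally show ?case .
      qed
    qed
    show "(\<lambda>m. step_mean m (\<lambda>j. (\<sigma> * ln (real m) ^ 1 - \<sigma> * ln (real j) ^ 1)\<^sup>2)
         / (ln (real m) powr (2 * real 1 - 1) * drift m)) \<longlonglongrightarrow> 0"
    proof (rule Lim_transform_eventually)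
      have "(\<lambda>m. \<sigma>\<^sup>2 * log_step 2 m / log_step 1 m * (y m * y m)) \<longlonglongrightarrow> \<sigma>\<^sup>2 * tau2 \<beta> / mu \<beta> * (0 * 0)"
        by (intro tendsto_intros y S1 S2) (use mu_pos in simp)
      then show "(\<lambda>m. \<sigma>\<^sup>2 * log_step 2 m / log_step 1 m * (y m * y m)) \<longlonglongrightarrow> 0" by simp
      show "\<forall>\<^sub>F m in sequentially. \<sigma>\<^sup>2 * log_step 2 m / log_step 1 m * (y m * y m)
         = step_mean m (\<lambda>j. (\<sigma> * ln (real m) ^ 1 - \<sigma> * ln (real j) ^ 1)\<^sup>2)
         / (ln (real m) powr (2 * real 1 - 1) * drift m)"
        using eventually_ge_at_top[of 2]
      proof eventually_elim
        case (elim m)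
        have "step_mean m (\<lambda>j. (\<sigma> * ln (real m) ^ 1 - \<sigma> * ln (real j) ^ 1)\<^sup>2)
            = step_mean m (\<lambda>j. 0 + 0 * (ln (real m) - ln (real j)) ^ 1 + \<sigma>\<^sup>2 * (ln (real m) - ln (real j)) ^ 2
                + 0 * (ln (real m) - ln (real j)) ^ 3 + 0 * (ln (real m) - ln (real j)) ^ 4)"
          by (intro step_mean_cong) (simp add: power2_eq_square algebra_simps)
        also have "\<dots> = \<sigma>\<^sup>2 * log_step 2 m / rate m"
          unfolding step_mean_poly[OF elim] by simp
        finally have "step_mean m (\<lambda>j. (\<sigma> * ln (real m) ^ 1 - \<sigma> * ln (real j) ^ 1)\<^sup>2) = \<sigma>\<^sup>2 * log_step 2 m / rate m" .
        moreover have "y m * y m = 1 / L m"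
          using L_pos[OF elim] by (simp add: y_def powr_add[symmetric] powr_minus_divide)
        ultimately show ?case
          using rate_pos[OF elim] L_pos[OF elim] by (simp add: drift_eq[OF elim] L_def)
      qed
    qed
  qed (use \<sigma> height_char_1 height_char_step in auto)
  then show ?thesis by simp
qed


text \<open>Put \<open>L = ln m\<close>. The rate is \<open>L\<close> up to a bounded error. If \<open>D\<close> is the decrease of \<open>L\<close> in one step,
  then \<open>h\<close> decreases by about \<open>L * D / mu (-1)\<close> and \<open>v\<close> by about \<open>3 * \<sigma> * L\<^sup>2 * D\<close>, while the first two
  moments of \<open>D\<close> are about \<open>mu (-1) / L\<close> and \<open>tau2 (-1) / L\<close>. This fixes the constants in \<open>h\<close> and \<open>v\<close>.
  All moments of \<open>D\<close> are of order \<open>1 / L\<close>, so the four errors are at most of order \<open>1 / L\<close>, \<open>1\<close>, \<open>L\<^sup>2\<close>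
  and \<open>L\<^sup>3\<close>, where \<open>o(1 / sqrt L)\<close>, \<open>o(L)\<close>, \<open>o(L powr (5/2))\<close> and \<open>o(L ^ 4)\<close> would do.\<close>

lemma height_char_limit_minus1:
  fixes t :: real
  defines "\<sigma> \<equiv> tau2 (-1) / (3 * (mu (-1)) ^ 3)"
    and "h \<equiv> \<lambda>m. 1 / (2 * mu (-1)) * (ln (real m))\<^sup>2"
  shows "(\<lambda>n. height_char (-1) (t / sqrt (\<sigma> * ln (real n) ^ 3)) n
            * iexp (- (t / sqrt (\<sigma> * ln (real n) ^ 3) * h n))) \<longlonglongrightarrow> of_real (exp (- t\<^sup>2 / 2))"
proof -
  interpret beta_chain "-1" by unfold_locales simp
  define \<mu> where "\<mu> = mu (-1)"
  have \<mu>: "0 < \<mu>" using mu_pos by (simp add: \<mu>_def)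
  have \<sigma>: "0 < \<sigma>" using mu_pos tau2_pos by (simp add: \<sigma>_def)
  define L where "L = (\<lambda>m. ln (real m))"
  define x where "x = (\<lambda>m. 1 / L m)"
  define y where "y = (\<lambda>m. L m powr (- (1/2)))"
  have L_pos: "0 < L m" if "2 \<le> m" for m using that by (simp add: L_def)
  have x: "x \<longlonglongrightarrow> 0" unfolding x_def L_def by real_asymp
  have y: "y \<longlonglongrightarrow> 0" unfolding y_def L_def by real_asymp
  have rate_L: "\<bar>rate m - L m\<bar> \<le> 1" if "2 \<le> m" for m
    using phi_minus1_ln[OF that] by (simp add: rate_def L_def)
  obtain C1 where C1: "\<And>m. 2 \<le> m \<Longrightarrow> \<bar>log_step 1 m - \<mu>\<bar> \<le> C1 / sqrt m"
    using log_step_rate[of 1] unfolding mu_eq \<mu>_def by auto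
  note S = log_step_tendsto
  have S1: "log_step 1 \<longlonglongrightarrow> \<mu>" and S2: "log_step 2 \<longlonglongrightarrow> tau2 (-1)"
    using S[of 1] S[of 2] by (simp_all add: mu_eq tau2_eq \<mu>_def)
  have rate_err: "(\<lambda>m. (rate m - L m) * z m) \<longlonglongrightarrow> 0" if "z \<longlonglongrightarrow> 0" "\<And>m. 0 \<le> z m" for z :: "nat \<Rightarrow> real"
  proof (rule Lim_null_comparison[OF _ that(1)])
    show "\<forall>\<^sub>F m in sequentially. norm ((rate m - L m) * z m) \<le> z m"
      using eventually_ge_at_top[of 2]
    proof eventually_elim
      case (elim m)
      then show ?case using mult_right_mono[OF rate_L[OF elim] that(2)[of m]] that(2)[of m] by (simp add: abs_mult)
    qed
  qed
  have ratio: "(\<lambda>m. rate m / L m) \<longlonglongrightarrow> 1"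
  proof (rule Lim_transform_eventually)
    have "(\<lambda>m. (rate m - L m) * \<bar>x m\<bar> + 1) \<longlonglongrightarrow> 0 + 1"
      using x by (intro tendsto_add rate_err tendsto_const tendsto_rabs_zero) auto
    then show "(\<lambda>m. (rate m - L m) * \<bar>x m\<bar> + 1) \<longlonglongrightarrow> 1" by simp
    show "\<forall>\<^sub>F m in sequentially. (rate m - L m) * \<bar>x m\<bar> + 1 = rate m / L m"
      using eventually_ge_at_top[of 2]
    proof eventually_elim
      case (elim m)
      then show ?case using L_pos[OF elim] by (simp add: x_def diff_divide_distrib)
    qed
  qed
  have mu_err: "(\<lambda>m. L m * (log_step 1 m - \<mu>)) \<longlonglongrightarrow> 0"
  proof (rule Lim_null_comparison)
    show "(\<lambda>m. C1 * (L m / sqrt (real m))) \<longlonglongrightarrow> 0"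
      unfolding L_def by real_asymp
    show "\<forall>\<^sub>F m in sequentially. norm (L m * (log_step 1 m - \<mu>)) \<le> C1 * (L m / sqrt (real m))"
      using eventually_ge_at_top[of 2]
    proof eventually_elim
      case (elim m)
      then show ?case using mult_left_mono[OF C1[OF elim], of "L m"] L_pos[OF elim]
        by (simp add: abs_mult mult_ac)
    qed
  qed
  have S1_pos: "0 < log_step 1 m" if "2 \<le> m" for m
    using drift_pos[OF that] rate_pos[OF that] by (simp add: drift_eq[OF that] zero_less_divide_iff)
  define p where "p = (\<lambda>m. L m / \<mu>)"
  define q where "q = 1 / (2 * \<mu>)"
  have h_diff: "h m - h j = p m * (L m - L j) - q * (L m - L j)\<^sup>2" for m j
    using \<mu> by (simp add: h_def \<mu>_def[symmetric] L_def p_def q_def power2_eq_square field_simps)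
  have v_diff: "\<sigma> * ln (real m) ^ 3 - \<sigma> * ln (real j) ^ 3
      = \<sigma> * (3 * (L m)\<^sup>2 * (L m - L j) - 3 * L m * (L m - L j)\<^sup>2 + (L m - L j) ^ 3)" for m j
    by (simp add: L_def power2_eq_square power3_eq_cube algebra_simps)
  have v_le: "0 \<le> \<sigma> * ln (real m) ^ 3 - \<sigma> * ln (real j) ^ 3"
      "\<sigma> * ln (real m) ^ 3 - \<sigma> * ln (real j) ^ 3 \<le> 3 * \<sigma> * (L m)\<^sup>2 * (L m - L j)"
      if j: "j \<in> {1..<m}" for m j
  proof -
    have D: "0 \<le> L m - L j" "L m - L j \<le> L m" using D_bounds[OF j] by (simp_all add: L_def)
    have "0 \<le> L j" "L j \<le> L m" using j by (auto simp: L_def)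
    then show "0 \<le> \<sigma> * ln (real m) ^ 3 - \<sigma> * ln (real j) ^ 3"
      using \<sigma> by (simp add: L_def power_mono)
    have "(L m - L j) * (L m - L j)\<^sup>2 \<le> 3 * L m * (L m - L j)\<^sup>2"
      using D by (intro mult_right_mono) auto
    then have "3 * (L m)\<^sup>2 * (L m - L j) - 3 * L m * (L m - L j)\<^sup>2 + (L m - L j) ^ 3 \<le> 3 * (L m)\<^sup>2 * (L m - L j)"
      by (simp add: power3_eq_cube power2_eq_square mult.assoc)
    then have "\<sigma> * (3 * (L m)\<^sup>2 * (L m - L j) - 3 * L m * (L m - L j)\<^sup>2 + (L m - L j) ^ 3) \<le> \<sigma> * (3 * (L m)\<^sup>2 * (L m - L j))"
      using less_imp_le[OF \<sigma>] by (rule mult_left_mono)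
    then show "\<sigma> * ln (real m) ^ 3 - \<sigma> * ln (real j) ^ 3 \<le> 3 * \<sigma> * (L m)\<^sup>2 * (L m - L j)"
      unfolding v_diff by (simp only: mult_ac)
  qed
  show ?thesis
  proof (rule char_fun_asymptotics[where F = "height_char (-1)" and h = h and c = 3])
    show "(\<lambda>m. \<bar>step_mean m (\<lambda>j. 1 - (h m - h j))\<bar> / (ln (real m) powr (real 3 / 2 - 1) * drift m)) \<longlonglongrightarrow> 0"
    proof (rule Lim_transform_eventually)
      have "(\<lambda>m. \<bar>(rate m - L m) * y m - y m * (L m * (log_step 1 m - \<mu>)) / \<mu> + y m * q * log_step 2 m\<bar> / log_step 1 m)
          \<longlonglongrightarrow> \<bar>0 - 0 * 0 / \<mu> + 0 * q * tau2 (-1)\<bar> / \<mu>"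
        by (intro tendsto_intros rate_err y mu_err S1 S2) (use \<mu> in \<open>simp_all add: y_def\<close>)
      then show "(\<lambda>m. \<bar>(rate m - L m) * y m - y m * (L m * (log_step 1 m - \<mu>)) / \<mu> + y m * q * log_step 2 m\<bar> / log_step 1 m) \<longlonglongrightarrow> 0"
        by simp
      show "\<forall>\<^sub>F m in sequentially. \<bar>(rate m - L m) * y m - y m * (L m * (log_step 1 m - \<mu>)) / \<mu> + y m * q * log_step 2 m\<bar> / log_step 1 m
          = \<bar>step_mean m (\<lambda>j. 1 - (h m - h j))\<bar> / (ln (real m) powr (real 3 / 2 - 1) * drift m)"
        using eventually_ge_at_top[of 2]
      proof eventually_elim
        case (elim m)
        have "step_mean m (\<lambda>j. 1 - (h m - h j))
            = step_mean m (\<lambda>j. 1 + (- p m) * (ln (real m) - ln (real j)) ^ 1 + q * (ln (real m) - ln (real j)) ^ 2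
                + 0 * (ln (real m) - ln (real j)) ^ 3 + 0 * (ln (real m) - ln (real j)) ^ 4)"
          unfolding h_diff by (intro step_mean_cong) (simp add: L_def)
        also have "\<dots> = (rate m - p m * log_step 1 m + q * log_step 2 m) / rate m"
          unfolding step_mean_poly[OF elim] by simp
        finally have 1: "step_mean m (\<lambda>j. 1 - (h m - h j)) = (rate m - p m * log_step 1 m + q * log_step 2 m) / rate m" .
        have 2: "(rate m - L m) * y m - y m * (L m * (log_step 1 m - \<mu>)) / \<mu> + y m * q * log_step 2 m
            = y m * (rate m - p m * log_step 1 m + q * log_step 2 m)"
          using \<mu> by (simp add: p_def field_simps)
        have 3: "ln (real m) powr (real 3 / 2 - 1) = 1 / y m"
          by (simp add: y_def L_def powr_minus_divide)
        have "0 < y m" using L_pos[OF elim] by (simp add: y_def)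
        then show ?case
          unfolding 1 2 3 using rate_pos[OF elim] by (simp add: drift_eq[OF elim] abs_mult abs_divide)
      qed
    qed
    \<comment> \<open>rate m times the mean of the second-order term, divided by (L m)^2\<close>
    define E2 where "E2 = (\<lambda>m. rate m / L m * x m - (2 * x m / \<mu> + 3 * \<sigma>) * log_step 1 m
        + (2 * q * (x m)\<^sup>2 + 1 / \<mu>\<^sup>2 + 3 * \<sigma> * x m) * log_step 2 m
        - (2 * x m * q / \<mu> + \<sigma> * (x m)\<^sup>2) * log_step 3 m + (q * x m)\<^sup>2 * log_step 4 m)"
    show "(\<lambda>m. \<bar>step_mean m (\<lambda>j. (1 - (h m - h j))\<^sup>2 - (\<sigma> * ln (real m) ^ 3 - \<sigma> * ln (real j) ^ 3))\<bar>
         / (ln (real m) powr (real 3 - 1) * drift m)) \<longlonglongrightarrow> 0"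
    proof (rule Lim_transform_eventually)
      have "E2 \<longlonglongrightarrow> 1 * 0 - (2 * 0 / \<mu> + 3 * \<sigma>) * \<mu>
        + (2 * q * 0\<^sup>2 + 1 / \<mu>\<^sup>2 + 3 * \<sigma> * 0) * tau2 (-1)
        - (2 * 0 * q / \<mu> + \<sigma> * 0\<^sup>2) * log_moment (-1) 3 + (q * 0)\<^sup>2 * log_moment (-1) 4"
        unfolding E2_def by (intro tendsto_intros x ratio S1 S2 S) (use \<mu> in simp_all)
      moreover have "tau2 (-1) / \<mu>\<^sup>2 - 3 * \<sigma> * \<mu> = 0"
        using \<mu> by (simp add: \<sigma>_def \<mu>_def[symmetric] field_simps power2_eq_square power3_eq_cube)
      ultimately have "E2 \<longlonglongrightarrow> 0" by simp
      from tendsto_divide[OF tendsto_rabs[OF this] S1]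
      show "(\<lambda>m. \<bar>E2 m\<bar> / log_step 1 m) \<longlonglongrightarrow> 0" using \<mu> by simp
      show "\<forall>\<^sub>F m in sequentially. \<bar>E2 m\<bar> / log_step 1 m
          = \<bar>step_mean m (\<lambda>j. (1 - (h m - h j))\<^sup>2 - (\<sigma> * ln (real m) ^ 3 - \<sigma> * ln (real j) ^ 3))\<bar>
         / (ln (real m) powr (real 3 - 1) * drift m)"
        using eventually_ge_at_top[of 2]
      proof eventually_elim
        case (elim m)
        have L: "0 < L m" by (rule L_pos[OF elim])
        have "step_mean m (\<lambda>j. (1 - (h m - h j))\<^sup>2 - (\<sigma> * ln (real m) ^ 3 - \<sigma> * ln (real j) ^ 3))
            = step_mean m (\<lambda>j. 1 + (- 2 * p m - 3 * \<sigma> * (L m)\<^sup>2) * (ln (real m) - ln (real j)) ^ 1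
                + (2 * q + (p m)\<^sup>2 + 3 * \<sigma> * L m) * (ln (real m) - ln (real j)) ^ 2
                + (- 2 * p m * q - \<sigma>) * (ln (real m) - ln (real j)) ^ 3 + q\<^sup>2 * (ln (real m) - ln (real j)) ^ 4)"
          unfolding h_diff v_diff
        proof (intro step_mean_cong)
          fix j
          define D where "D = L m - L j"
          have "(1 - (p m * D - q * D\<^sup>2))\<^sup>2 - \<sigma> * (3 * (L m)\<^sup>2 * D - 3 * L m * D\<^sup>2 + D ^ 3)
            = 1 + (- 2 * p m - 3 * \<sigma> * (L m)\<^sup>2) * D ^ 1 + (2 * q + (p m)\<^sup>2 + 3 * \<sigma> * L m) * D ^ 2
                + (- 2 * p m * q - \<sigma>) * D ^ 3 + q\<^sup>2 * D ^ 4"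
            by (simp add: power2_eq_square power3_eq_cube power4_eq_xxxx algebra_simps)
          then show "(1 - (p m * (L m - L j) - q * (L m - L j)\<^sup>2))\<^sup>2
              - \<sigma> * (3 * (L m)\<^sup>2 * (L m - L j) - 3 * L m * (L m - L j)\<^sup>2 + (L m - L j) ^ 3)
            = 1 + (- 2 * p m - 3 * \<sigma> * (L m)\<^sup>2) * (ln (real m) - ln (real j)) ^ 1
                + (2 * q + (p m)\<^sup>2 + 3 * \<sigma> * L m) * (ln (real m) - ln (real j)) ^ 2
                + (- 2 * p m * q - \<sigma>) * (ln (real m) - ln (real j)) ^ 3 + q\<^sup>2 * (ln (real m) - ln (real j)) ^ 4"
            unfolding D_def L_def .
        qed
        also have "\<dots> = (1 * rate m + (- 2 * p m - 3 * \<sigma> * (L m)\<^sup>2) * log_step 1 m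
            + (2 * q + (p m)\<^sup>2 + 3 * \<sigma> * L m) * log_step 2 m
            + (- 2 * p m * q - \<sigma>) * log_step 3 m + q\<^sup>2 * log_step 4 m) / rate m"
          by (rule step_mean_poly[OF elim])
        also have "\<dots> = (L m)\<^sup>2 * E2 m / rate m"
        proof -
          have "(L m)\<^sup>2 * x m = L m" "(L m)\<^sup>2 * (x m)\<^sup>2 = 1" using L by (simp_all add: x_def power2_eq_square)
          moreover have "(L m)\<^sup>2 * E2 m = ((L m)\<^sup>2 * x m) * (rate m / L m) - (2 * ((L m)\<^sup>2 * x m) / \<mu> + 3 * \<sigma> * (L m)\<^sup>2) * log_step 1 m
            + (2 * q * ((L m)\<^sup>2 * (x m)\<^sup>2) + (L m)\<^sup>2 / \<mu>\<^sup>2 + 3 * \<sigma> * ((L m)\<^sup>2 * x m)) * log_step 2 m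
            - (2 * ((L m)\<^sup>2 * x m) * q / \<mu> + \<sigma> * ((L m)\<^sup>2 * (x m)\<^sup>2)) * log_step 3 m
            + q\<^sup>2 * ((L m)\<^sup>2 * (x m)\<^sup>2) * log_step 4 m"
            by (simp add: E2_def power_mult_distrib algebra_simps)
          ultimately have "(L m)\<^sup>2 * E2 m = 1 * rate m + (- 2 * p m - 3 * \<sigma> * (L m)\<^sup>2) * log_step 1 m
            + (2 * q + (p m)\<^sup>2 + 3 * \<sigma> * L m) * log_step 2 m
            + (- 2 * p m * q - \<sigma>) * log_step 3 m + q\<^sup>2 * log_step 4 m"
            using L by (simp add: p_def power_divide algebra_simps)
          then show ?thesis by simp
        qed
        finally have 1: "step_mean m (\<lambda>j. (1 - (h m - h j))\<^sup>2 - (\<sigma> * ln (real m) ^ 3 - \<sigma> * ln (real j) ^ 3)) = (L m)\<^sup>2 * E2 m / rate m" .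
        have 2: "ln (real m) powr (real 3 - 1) = (L m)\<^sup>2"
          using L by (simp add: L_def powr_numeral)
        show ?case
          unfolding 1 2 using rate_pos[OF elim] L by (simp add: drift_eq[OF elim] abs_mult abs_divide)
      qed
    qed
    \<comment> \<open>rate m times the mean of the cubic polynomial in D that bounds the third-order error, divided by (L m)^3\<close>
    define B3 where "B3 = (\<lambda>m. rate m / L m * (x m)\<^sup>2 + (3 * (x m)\<^sup>2 / \<mu> + 3 * \<sigma> * x m) * log_step 1 m
        + (3 * x m / \<mu>\<^sup>2 + 3 * \<sigma> / \<mu>) * log_step 2 m + 1 / \<mu> ^ 3 * log_step 3 m)"
    show "(\<lambda>m. step_mean m (\<lambda>j. \<bar>1 - (h m - h j)\<bar> ^ 3 + \<bar>1 - (h m - h j)\<bar> * (\<sigma> * ln (real m) ^ 3 - \<sigma> * ln (real j) ^ 3))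
         / (ln (real m) powr (real (3 * 3) / 2 - 1) * drift m)) \<longlonglongrightarrow> 0"
    proof (rule Lim_null_comparison)
      have "B3 \<longlonglongrightarrow> 1 * 0\<^sup>2 + (3 * 0\<^sup>2 / \<mu> + 3 * \<sigma> * 0) * \<mu>
        + (3 * 0 / \<mu>\<^sup>2 + 3 * \<sigma> / \<mu>) * tau2 (-1) + 1 / \<mu> ^ 3 * log_moment (-1) 3"
        unfolding B3_def by (intro tendsto_intros x ratio S1 S2 S) (use \<mu> in simp_all)
      from tendsto_divide[OF tendsto_mult[OF y this] S1]
      show "(\<lambda>m. y m * B3 m / log_step 1 m) \<longlonglongrightarrow> 0" using \<mu> by simp
      show "\<forall>\<^sub>F m in sequentially. norm (step_mean m (\<lambda>j. \<bar>1 - (h m - h j)\<bar> ^ 3 + \<bar>1 - (h m - h j)\<bar> * (\<sigma> * ln (real m) ^ 3 - \<sigma> * ln (real j) ^ 3))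
         / (ln (real m) powr (real (3 * 3) / 2 - 1) * drift m)) \<le> y m * B3 m / log_step 1 m"
        using eventually_ge_at_top[of 2]
      proof eventually_elim
        case (elim m)
        have L: "0 < L m" by (rule L_pos[OF elim])
        have p: "0 \<le> p m" using L \<mu> by (simp add: p_def)
        let ?f = "\<lambda>j. \<bar>1 - (h m - h j)\<bar> ^ 3 + \<bar>1 - (h m - h j)\<bar> * (\<sigma> * ln (real m) ^ 3 - \<sigma> * ln (real j) ^ 3)"
        let ?g = "\<lambda>D::real. 1 + (3 * p m + 3 * \<sigma> * (L m)\<^sup>2) * D ^ 1
              + (3 * (p m)\<^sup>2 + 3 * \<sigma> * (L m)\<^sup>2 * p m) * D ^ 2 + (p m) ^ 3 * D ^ 3 + 0 * D ^ 4"
        have "step_mean m ?f \<le> step_mean m (\<lambda>j. ?g (ln (real m) - ln (real j)))"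
        proof (rule step_mean_mono[OF elim])
          fix j assume j: "j \<in> {1..<m}"
          define D where "D = L m - L j"
          have D: "0 \<le> D" "D \<le> L m" using D_bounds[OF j] by (simp_all add: D_def L_def)
          have "\<bar>1 - (h m - h j)\<bar> \<le> 1 + p m * D"
          proof -
            have "q * D\<^sup>2 = q * D * D" by (simp add: power2_eq_square)
            also have "\<dots> \<le> q * D * L m" using D \<mu> by (intro mult_left_mono) (auto simp: q_def)
            also have "\<dots> \<le> p m * D" using D L \<mu> by (simp add: q_def p_def field_simps)
            finally have "q * D\<^sup>2 \<le> p m * D" .
            moreover have "0 \<le> q * D\<^sup>2" using \<mu> by (simp add: q_def)
            ultimately show ?thesis unfolding h_diff D_def[symmetric] by linarith
          qed
          then have "?f j \<le> (1 + p m * D) ^ 3 + (1 + p m * D) * (3 * \<sigma> * (L m)\<^sup>2 * D)"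
            using v_le[OF j] p D unfolding D_def by (intro add_mono power_mono mult_mono) auto
          also have "\<dots> = ?g D"
            by (simp add: power2_eq_square power3_eq_cube algebra_simps)
          finally show "?f j \<le> ?g (ln (real m) - ln (real j))" unfolding D_def L_def .
        qed
        also have "\<dots> = (1 * rate m + (3 * p m + 3 * \<sigma> * (L m)\<^sup>2) * log_step 1 m
              + (3 * (p m)\<^sup>2 + 3 * \<sigma> * (L m)\<^sup>2 * p m) * log_step 2 m + (p m) ^ 3 * log_step 3 m + 0 * log_step 4 m) / rate m"
          by (rule step_mean_poly[OF elim])
        also have "\<dots> = L m ^ 3 * B3 m / rate m"
        proof -
          have "L m ^ 3 * x m = (L m)\<^sup>2" "L m ^ 3 * (x m)\<^sup>2 = L m" using L by (simp_all add: x_def power2_eq_square power3_eq_cube)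
          moreover have "L m ^ 3 * B3 m = (L m ^ 3 * (x m)\<^sup>2) * (rate m / L m) + (3 * (L m ^ 3 * (x m)\<^sup>2) / \<mu> + 3 * \<sigma> * (L m ^ 3 * x m)) * log_step 1 m
            + (3 * (L m ^ 3 * x m) / \<mu>\<^sup>2 + 3 * \<sigma> * L m ^ 3 / \<mu>) * log_step 2 m + L m ^ 3 / \<mu> ^ 3 * log_step 3 m"
            by (simp add: B3_def algebra_simps)
          moreover have "L m ^ 3 / \<mu> = (L m)\<^sup>2 * p m" by (simp add: p_def power2_eq_square power3_eq_cube)
          ultimately have "L m ^ 3 * B3 m = 1 * rate m + (3 * p m + 3 * \<sigma> * (L m)\<^sup>2) * log_step 1 m
              + (3 * (p m)\<^sup>2 + 3 * \<sigma> * (L m)\<^sup>2 * p m) * log_step 2 m + (p m) ^ 3 * log_step 3 m + 0 * log_step 4 m"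
            using L by (simp add: p_def power_divide algebra_simps power2_eq_square power3_eq_cube)
          then show ?thesis by simp
        qed
        finally have le: "step_mean m ?f \<le> L m ^ 3 * B3 m / rate m" .
        have nonneg: "0 \<le> step_mean m ?f"
          using v_le(1) by (intro step_mean_nonneg[OF elim] add_nonneg_nonneg mult_nonneg_nonneg) auto
        have dr: "0 < drift m" by (rule drift_pos[OF elim])
        have "ln (real m) powr (real (3 * 3) / 2 - 1) = L m powr 3 * L m powr (1/2)"
          unfolding powr_add[symmetric] by (simp add: L_def)
        also have "\<dots> = L m ^ 3 / y m"
          using L by (simp add: y_def powr_minus_divide powr_numeral)
        finally have "norm (step_mean m ?f / (ln (real m) powr (real (3 * 3) / 2 - 1) * drift m))
            = step_mean m ?f * y m / L m ^ 3 / drift m"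
          using nonneg dr L by (simp add: y_def)
        also have "\<dots> \<le> (L m ^ 3 * B3 m / rate m) * y m / L m ^ 3 / drift m"
          using le dr L by (intro divide_right_mono mult_right_mono) (auto simp: y_def)
        also have "\<dots> = y m * B3 m / log_step 1 m"
          using rate_pos[OF elim] S1_pos[OF elim] L by (simp add: drift_eq[OF elim])
        finally show ?case .
      qed
    qed
    show "(\<lambda>m. step_mean m (\<lambda>j. (\<sigma> * ln (real m) ^ 3 - \<sigma> * ln (real j) ^ 3)\<^sup>2)
         / (ln (real m) powr (2 * real 3 - 1) * drift m)) \<longlonglongrightarrow> 0"
    proof (rule Lim_null_comparison)
      have "(\<lambda>m. 9 * \<sigma>\<^sup>2 * x m * log_step 2 m / log_step 1 m) \<longlonglongrightarrow> 9 * \<sigma>\<^sup>2 * 0 * tau2 (-1) / \<mu>"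
        by (intro tendsto_intros x S1 S2) (use \<mu> in simp)
      then show "(\<lambda>m. 9 * \<sigma>\<^sup>2 * x m * log_step 2 m / log_step 1 m) \<longlonglongrightarrow> 0" by simp
      show "\<forall>\<^sub>F m in sequentially. norm (step_mean m (\<lambda>j. (\<sigma> * ln (real m) ^ 3 - \<sigma> * ln (real j) ^ 3)\<^sup>2)
         / (ln (real m) powr (2 * real 3 - 1) * drift m)) \<le> 9 * \<sigma>\<^sup>2 * x m * log_step 2 m / log_step 1 m"
        using eventually_ge_at_top[of 2]
      proof eventually_elim
        case (elim m)
        have L: "0 < L m" by (rule L_pos[OF elim])
        let ?f = "\<lambda>j. (\<sigma> * ln (real m) ^ 3 - \<sigma> * ln (real j) ^ 3)\<^sup>2"
        have "step_mean m ?f \<le> step_mean m (\<lambda>j. 0 + 0 * (ln (real m) - ln (real j)) ^ 1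
            + (9 * \<sigma>\<^sup>2 * L m ^ 4) * (ln (real m) - ln (real j)) ^ 2
            + 0 * (ln (real m) - ln (real j)) ^ 3 + 0 * (ln (real m) - ln (real j)) ^ 4)"
        proof (rule step_mean_mono[OF elim])
          fix j assume j: "j \<in> {1..<m}"
          have "?f j \<le> (3 * \<sigma> * (L m)\<^sup>2 * (L m - L j))\<^sup>2"
            using v_le[OF j] by (intro power_mono) auto
          also have "\<dots> = 9 * \<sigma>\<^sup>2 * L m ^ 4 * (L m - L j)\<^sup>2"
            by (simp add: power_mult_distrib)
          finally show "?f j \<le> 0 + 0 * (ln (real m) - ln (real j)) ^ 1
            + (9 * \<sigma>\<^sup>2 * L m ^ 4) * (ln (real m) - ln (real j)) ^ 2
            + 0 * (ln (real m) - ln (real j)) ^ 3 + 0 * (ln (real m) - ln (real j)) ^ 4"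
            by (simp add: L_def)
        qed
        also have "\<dots> = 9 * \<sigma>\<^sup>2 * L m ^ 4 * log_step 2 m / rate m"
          unfolding step_mean_poly[OF elim] by simp
        finally have le: "step_mean m ?f \<le> 9 * \<sigma>\<^sup>2 * L m ^ 4 * log_step 2 m / rate m" .
        have nonneg: "0 \<le> step_mean m ?f" by (intro step_mean_nonneg[OF elim]) auto
        have dr: "0 < drift m" by (rule drift_pos[OF elim])
        have pw: "ln (real m) powr (2 * real 3 - 1) = L m ^ 5"
          using L by (simp add: L_def powr_numeral)
        have "norm (step_mean m ?f / (ln (real m) powr (2 * real 3 - 1) * drift m)) = step_mean m ?f / (L m ^ 5 * drift m)"
          unfolding pw using nonneg dr L by simp
        also have "\<dots> \<le> 9 * \<sigma>\<^sup>2 * L m ^ 4 * log_step 2 m / rate m / (L m ^ 5 * drift m)"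
          using le dr L by (intro divide_right_mono) auto
        also have "\<dots> = 9 * \<sigma>\<^sup>2 * x m * log_step 2 m / log_step 1 m"
          using rate_pos[OF elim] S1_pos[OF elim] L by (simp add: drift_eq[OF elim] x_def power4_eq_xxxx eval_nat_numeral)
        finally show ?case .
      qed
    qed
  qed (use \<sigma> height_char_1 height_char_step in \<open>auto simp: h_def\<close>)
qed

text \<open>The continuity theorem needs probability measures throughout, and without labels there is no
  uniform label; it is therefore applied to the shifted sequence.\<close>

lemma weak_conv_leaf_height:
  assumes \<beta>: "-2 < \<beta>"
    and lim: "\<And>t. (\<lambda>n. height_char \<beta> (t / s n) n * iexp (- (t / s n * h n))) \<longlonglongrightarrow> of_real (exp (- t\<^sup>2 / 2))"
  shows "weak_conv_m (\<lambda>n. distr (tree_space \<beta> n) borel (\<lambda>\<omega>. (real (leaf_height n \<omega>) - h n) / s n)) std_normal_distribution"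
proof -
  define Q where "Q = (\<lambda>n. distr (tree_space \<beta> n) borel (\<lambda>\<omega>. (real (leaf_height n \<omega>) - h n) / s n))"
  have meas: "(\<lambda>\<omega>. (real (leaf_height n \<omega>) - h n) / s n) \<in> borel_measurable (tree_space \<beta> n)" if "1 \<le> n" for n
  proof -
    interpret uniform_leaf \<beta> n using \<beta> that by unfold_locales
    show ?thesis by (rule measurable_compose[OF measurable_leaf_height]) simp
  qed
  have "weak_conv_m (\<lambda>n. Q (Suc n)) std_normal_distribution"
  proof (rule levy_continuity)
    fix n
    interpret uniform_leaf \<beta> "Suc n" using \<beta> by unfold_locales auto
    interpret prob_space "tree_space \<beta> (Suc n)" by (rule prob_space_tree)
    show "real_distribution (Q (Suc n))"
      unfolding Q_def using meas by (intro real_distribution_distr) auto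
  next
    show "real_distribution std_normal_distribution" by (rule real_dist_normal_dist)
  next
    fix t
    have char: "char (Q (Suc n)) t = height_char \<beta> (t / s (Suc n)) (Suc n) * iexp (- (t / s (Suc n) * h (Suc n)))" for n
    proof -
      interpret uniform_leaf \<beta> "Suc n" using \<beta> by unfold_locales auto
      let ?M = "tree_space \<beta> (Suc n)" and ?s = "s (Suc n)" and ?h = "h (Suc n)"
      have "char (Q (Suc n)) t = (\<integral>\<omega>. iexp (t * ((real (leaf_height (Suc n) \<omega>) - ?h) / ?s)) \<partial>?M)"
        unfolding char_def Q_def using meas[of "Suc n"] by (intro integral_distr) auto
      also have "\<dots> = (\<integral>\<omega>. iexp (t / ?s * real (leaf_height (Suc n) \<omega>)) * iexp (- (t / ?s * ?h)) \<partial>?M)"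
        unfolding exp_add[symmetric] by (simp add: algebra_simps diff_divide_distrib)
      also have "\<dots> = height_char \<beta> (t / ?s) (Suc n) * iexp (- (t / ?s * ?h))"
        by (simp only: integral_mult_left_zero leaf_height_char)
      finally show ?thesis .
    qed
    show "(\<lambda>n. char (Q (Suc n)) t) \<longlonglongrightarrow> char std_normal_distribution t"
      unfolding char char_std_normal_distribution using LIMSEQ_Suc[OF lim[of t]] by simp
  qed
  then have "weak_conv_m Q std_normal_distribution"
    unfolding weak_conv_m_def weak_conv_def by (intro allI impI) (rule LIMSEQ_imp_Suc, blast)
  then show ?thesis unfolding Q_def .
qed

theorem corollaryC2:
  shows "(\<forall>\<beta>::real. \<beta> > -1 \<longrightarrow>
           weak_conv_m
             (\<lambda>n. distr (tree_space \<beta> n) borel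
                (\<lambda>\<omega>. (real (leaf_height n \<omega>) - phi_inf \<beta> / mu \<beta> * ln (real n)) /
                     sqrt (((phi_inf \<beta>)\<^sup>2 * tau2 \<beta> / (mu \<beta>) ^ 3 - phi_inf \<beta> / mu \<beta>) * ln (real n))))
             std_normal_distribution)
       \<and> weak_conv_m
             (\<lambda>n. distr (tree_space (-1) n) borel
                (\<lambda>\<omega>. (real (leaf_height n \<omega>) - 1 / (2 * mu (-1)) * (ln (real n))\<^sup>2) /
                     sqrt (tau2 (-1) / (3 * (mu (-1)) ^ 3) * (ln (real n)) ^ 3)))
             std_normal_distribution
       \<and> mu (-1) = zeta 2
       \<and> tau2 (-1) = 2 * zeta 3"
proof (intro conjI allI impI)
  fix \<beta> :: real assume \<beta>: "-1 < \<beta>"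
  show "weak_conv_m
             (\<lambda>n. distr (tree_space \<beta> n) borel
                (\<lambda>\<omega>. (real (leaf_height n \<omega>) - phi_inf \<beta> / mu \<beta> * ln (real n)) /
                     sqrt (((phi_inf \<beta>)\<^sup>2 * tau2 \<beta> / (mu \<beta>) ^ 3 - phi_inf \<beta> / mu \<beta>) * ln (real n))))
             std_normal_distribution"
    using \<beta> by (intro weak_conv_leaf_height height_char_limit_gt) auto
next
  show "weak_conv_m
             (\<lambda>n. distr (tree_space (-1) n) borel
                (\<lambda>\<omega>. (real (leaf_height n \<omega>) - 1 / (2 * mu (-1)) * (ln (real n))\<^sup>2) /
                     sqrt (tau2 (-1) / (3 * (mu (-1)) ^ 3) * (ln (real n)) ^ 3)))
             std_normal_distribution"
    by (intro weak_conv_leaf_height height_char_limit_minus1) auto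
qed (rule mu_minus1, rule tau2_minus1)


end
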